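(* There exist constants $C_*>0$ and $C_{**}>0$, depending only on the data and $\theta$ as specified in the context (in particular independent of $|\mathcal{T}|$ and $\tau$), such that any solution $((\mu_{i,K}^{k})_{i,K},(\phi_{K}^{k})_K)_k$ of the scheme (S1)-(S6) satisfies the entropy inequalities $$\sum_{k=1}^{N_T}\tau^{k}\frac{C_{\min}}2\sum_{i=1}^nD_i\sum_{S\in\mathcal{T}}\frac{|S|}{h_S^2}u_{0,S}^{k}u_{i,S}^{k}\sum_{\{K,L\}\in\mathcal{E}_S}(\mu_{i,K}^{k}-\mu_{i,L}^{k})^2\le\sum_{k=1}^{N_T}\frac{\tau^{k}}2\sum_{i=1}^n\sum_{K\in\mathcal{M}}\sum_{S\in\mathcal{T}_K}|S|u_{0,S}^{k}u_{i,S}^{k}D_i|\nabla[\mu_i]^{k}_{\mathcal{T}}(S)|^2\le\sum_{i=1}^n\sum_{K\in\mathcal{M}}|K|\zeta(u_{i,K}^{0})+T\,C_*$$ and $$\sum_{i=1}^n\big\|\nabla[u_i\sqrt{u_0}]_{\mathcal{T}}\big\|_{L^2((0,T)\times\Omega)}^2+\big\|\nabla[u_0]_{\mathcal{T}}\big\|_{L^2((0,T)\times\Omega)}^2+\big\|\nabla[\sqrt{u_0}]_{\mathcal{T}}\big\|_{L^2((0,T)\times\Omega)}^2\le C_{**}.$$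
   Context: **Data.** $d\in\{2,3\}$; $\Omega\subset\mathbb{R}^d$ is a bounded connected open polytopal set, with regular boundary $\partial\Omega=\Gamma_D\cup\Gamma_N$ regularly partitioned into $\Gamma_D,\Gamma_N$; $T>0$; $\lambda,\beta>0$; $n\ge 1$; $z_i\in\mathbb{R}$ and $D_i>0$ for $i=1,\dots,n$; $u_i^{\rm ini}\in L^\infty(\Omega)$, $i=0,\dots,n$, with $u_i^{\rm ini}\ge 0$, $\sum_{i=0}^n u_i^{\rm ini}=1$ a.e. and $M_i=\int_\Omega u_i^{\rm ini}\,dx>0$ for $i=0,\dots,n$; $\phi^D\in H^1(\Omega)$; $f\in L^2(\Omega)$. $H^1_D(\Omega)$ is the set of elements of $H^1(\Omega)$ with zero trace on $\Gamma_D$; it is assumed that there is $C_P>0$ with $\|v\|_{L^2(\Omega)}\le C_P\|\nabla v\|_{L^2(\Omega)}$ for all $v\in H^1_D(\Omega)$. **Mesh.** $\mathcal{T}$ is a finite collection of disjoint open simplices with $\bigcup_{S\in\mathcal{T}}\overline S=\overline\Omega$, conforming (no hanging nodes). Its vertices are $\{x_K, K\in\mathcal{M}\}$. $\mathcal{M}_S$ is the set of (indices of) vertices of $S$, $\mathcal{E}_S$ the set of edges (unordered pairs of distinct vertices) of $S$, $\mathcal{T}_K$ the set of simplices having $x_K$ as a vertex, $\mathcal{M}_D$ the set of (indices of) vertices located on $\Gamma_D$. $h_S$ is the diameter of $S$, $\rho_S$ its maximal inscribed ball radius, $|\mathcal{T}|=\max_S h_S$, $\theta_{\mathcal{T}}=\max_S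 h_S/\rho_S$. $V_{\mathcal{T}}$ is the conforming $\mathbb{P}_1$ finite element space with nodal basis $(e_K)_{K\in\mathcal{M}}$; for $v\in V_{\mathcal{T}}$, $\nabla v(S)$ is the constant value of $\nabla v$ in $S$. $V_{\mathcal{T},D}=\{v\in V_{\mathcal{T}}: v(x_K)=0\ \forall K\in\mathcal{M}_D\}\subset H^1_D(\Omega)$ (assumed). The dual cell, also denoted $K$, is $\{x\in\Omega: e_K(x)>e_L(x)\ \forall L\ne K\}$, with measure $|K|$. $\phi^D_{\mathcal{T}}\in V_{\mathcal{T}}$ is a given discrete lifting with $\|\phi^D_{\mathcal{T}}\|_{H^1(\Omega)}\le C_\phi^D$, $C^D_\phi$ independent of the discretisation, and $(\phi^D_{\mathcal{T}})_K=\phi^D_{\mathcal{T}}(x_K)$. Time sequence $\tau$: $0=t^0<t^1<\dots<t^{N_T}=T$, $\tau^k=t^k-t^{k-1}$. **Scheme.** Unknowns: reals $\mu_{i,K}^k$ ($i=1,\dots,n$) and $\phi_K^k$, $K\in\mathcal{M}$, $k=1,\dots,N_T$. (S1) $u_{i,K}^0=\frac1{|K|}\int_K u_i^{\rm ini}\,dx$, $i=0,\dots,n$. (S2) $u_{0,K}^k=\frac{1}{1+\sum_{j=1}^n\exp(\mu_{j,K}^k)}$ and $u_{i,K}^k=u_{0,K}^k\exp(\mu_{i,K}^k)$, $i=1,\dots,n$, $k\ge1$. (S3) for $i=1,\dots,n$, $K\in\mathcal{M}$, $k=1,\dots,N_T$: $|K|\frac{u_{i,K}^k-u_{i,K}^{k-1}}{\tau^k}+\sum_{S\in\mathcal{T}_K}\sum_{L\in\mathcal{M}_S}u_{0,S}^k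 u_{i,S}^k F_{i,K,L}^{k,S}=0$. (S4) $F_{i,K,L}^{k,S}=D_i a_{KL}^S\big((\mu_{i,K}^k-\mu_{i,L}^k)+\beta z_i(\phi_K^k-\phi_L^k)\big)$ with $a_{KL}^S=-|S|\nabla e_K(S)\cdot\nabla e_L(S)$. (S5) Either (max): $u_{j,S}^k=\max_{L\in\mathcal{M}_S}u_{j,L}^k$ for $j=0,\dots,n$; or (ave): $u_{j,S}^k=\frac1{d+1}\sum_{L\in\mathcal{M}_S}u_{j,L}^k$ for $j=0,\dots,n$. (Results hold for either choice.) (S6) $\phi_K^k=(\phi^D_{\mathcal{T}})_K$ for $K\in\mathcal{M}_D$, and $\lambda^2\sum_{S\in\mathcal{T}_K}\sum_{L\in\mathcal{M}_S}a_{KL}^S(\phi_K^k-\phi_L^k)=|K|\sum_{i=1}^n z_iu_{i,K}^k+\int_K f\,dx$ for $K\in\mathcal{M}\setminus\mathcal{M}_D$. **Reconstructions.** For $v=(v_K^k)$, $[v]^k_{\mathcal{T}}\in V_{\mathcal{T}}$ has value $v_K^k$ at $x_K$, and $[v]_{\mathcal{T}}(t,\cdot)=[v]_{\mathcal{T}}^k$ for $t\in(t^{k-1},t^k]$. $[g(u_0,u_i)]$ is the reconstruction of the nodal values $g(u_{0,K}^k,u_{i,K}^k)$. **Function and constants.** $\zeta(0)=0$ and $\zeta(x)=x(\log x-1)+1$ for $x>0$. A number $\theta\ge\theta_{\mathcal{T}}$ is given. $C_{\min}>0$ is a constant depending only on $d$ and $\theta$ such that $C_{\min}\frac{|S|}{h_S^2}\sum_{\{K,L\}\in\mathcal{E}_S}(v_K-v_L)^2\le|S||\nabla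 v_{\mathcal{T}}(S)|^2$ for all $S\in\mathcal{T}$ and all $(v_K)_{K\in\mathcal{M}}$, where $v_{\mathcal{T}}\in V_{\mathcal{T}}$ has nodal values $v_K$. Constants "depending only on the data and $\theta$" may depend on $d,T,\Omega,(z_i,M_i,D_i)_i,\lambda,\beta,\|f\|_{L^2(\Omega)},\theta,C_\phi^D,C_P$ but not on $|\mathcal{T}|$ nor on $\tau$. *)

theory Defs
  imports "HOL-Analysis.Analysis"
begin

section \<open>Lebesgue and Sobolev spaces\<close>

text \<open>Elements of $L^2$ and $H^1$ are represented by functions; only their values almost everywhere
  on the domain matter.\<close>

definition in_L2 :: "'a::euclidean_space set \<Rightarrow> ('a \<Rightarrow> 'b::euclidean_space) \<Rightarrow> bool" where
  "in_L2 A f \<longleftrightarrow> f \<in> borel_measurable (lebesgue_on A) \<and> integrable (lebesgue_on A) (\<lambda>x. (norm (f x))\<^sup>2)"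

definition L2_norm :: "'a::euclidean_space set \<Rightarrow> ('a \<Rightarrow> 'b::euclidean_space) \<Rightarrow> real" where
  "L2_norm A f = sqrt (integral\<^sup>L (lebesgue_on A) (\<lambda>x. (norm (f x))\<^sup>2))"

definition grad :: "(real^'d \<Rightarrow> real) \<Rightarrow> real^'d::finite \<Rightarrow> real^'d" where
  "grad v x = (\<chi> i. frechet_derivative v (at x) (axis i 1))"

definition C1 :: "(real^'d::finite \<Rightarrow> real) \<Rightarrow> bool" where
  "C1 w \<longleftrightarrow> (\<forall>x. w differentiable (at x)) \<and> continuous_on UNIV (grad w)"

text \<open>Test functions are $C^1$ with compact support in the domain; by mollification this gives the same
  weak gradients as $C^\infty_c$.\<close>

definition test_function :: "(real^'d::finite) set \<Rightarrow> (real^'d \<Rightarrow> real) \<Rightarrow> bool" where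
  "test_function \<Omega> p \<longleftrightarrow> C1 p \<and> compact (closure {x. p x \<noteq> 0}) \<and> closure {x. p x \<noteq> 0} \<subseteq> \<Omega>"

definition has_weak_grad ::
  "(real^'d::finite) set \<Rightarrow> (real^'d \<Rightarrow> real) \<Rightarrow> (real^'d \<Rightarrow> real^'d) \<Rightarrow> bool" where
  "has_weak_grad \<Omega> v g \<longleftrightarrow> (\<forall>p. test_function \<Omega> p \<longrightarrow> (\<forall>i.
     integral\<^sup>L (lebesgue_on \<Omega>) (\<lambda>x. v x * grad p x $ i)
       = - integral\<^sup>L (lebesgue_on \<Omega>) (\<lambda>x. g x $ i * p x)))"

definition H1 :: "(real^'d::finite) set \<Rightarrow> (real^'d \<Rightarrow> real) set" where
  "H1 \<Omega> = {v. in_L2 \<Omega> v \<and> (\<exists>g. in_L2 \<Omega> g \<and> has_weak_grad \<Omega> v g)}"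

text \<open>A representative of the weak gradient (unique almost everywhere) of an element of $H^1$.\<close>

definition weak_grad :: "(real^'d::finite) set \<Rightarrow> (real^'d \<Rightarrow> real) \<Rightarrow> real^'d \<Rightarrow> real^'d" where
  "weak_grad \<Omega> v = (SOME g. in_L2 \<Omega> g \<and> has_weak_grad \<Omega> v g)"

definition H1_norm :: "(real^'d::finite) set \<Rightarrow> (real^'d \<Rightarrow> real) \<Rightarrow> real" where
  "H1_norm \<Omega> v = sqrt ((L2_norm \<Omega> v)\<^sup>2 + (L2_norm \<Omega> (weak_grad \<Omega> v))\<^sup>2)"

text \<open>Surface measure: the $(d-1)$-dimensional Hausdorff measure, obtained from its outer measure by
  restriction to the Borel sets.\<close>

definition hausdorff_outer :: "nat \<Rightarrow> 'a::euclidean_space set \<Rightarrow> ennreal" where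
  "hausdorff_outer s A = (SUP \<delta>\<in>{0<..}. INF U\<in>{U :: nat \<Rightarrow> 'a set.
       A \<subseteq> (\<Union>j. U j) \<and> (\<forall>j. bounded (U j) \<and> diameter (U j) \<le> \<delta>)}.
       (\<Sum>j. ennreal (unit_ball_vol (real s) * (diameter (U j) / 2) ^ s)))"

definition surface_measure :: "(real^'d::finite) measure" where
  "surface_measure = measure_of UNIV (sets borel) (hausdorff_outer (CARD('d) - 1))"

text \<open>The trace operator is the continuous extension to $H^1$, with values in $L^2(\partial\Omega)$, of
  the restriction of functions that are $C^1$ up to the boundary; its graph is the following relation.\<close>

definition has_trace ::
  "(real^'d::finite) set \<Rightarrow> (real^'d \<Rightarrow> real) \<Rightarrow> (real^'d \<Rightarrow> real) \<Rightarrow> bool" where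
  "has_trace \<Omega> v g \<longleftrightarrow> g \<in> borel_measurable borel \<and>
     (\<exists>w :: nat \<Rightarrow> real^'d \<Rightarrow> real. (\<forall>m. C1 (w m)) \<and>
        (\<lambda>m. H1_norm \<Omega> (\<lambda>x. w m x - v x)) \<longlonglongrightarrow> 0 \<and>
        (\<lambda>m. \<integral>\<^sup>+x\<in>frontier \<Omega>. ennreal ((w m x - g x)\<^sup>2) \<partial>surface_measure) \<longlonglongrightarrow> 0)"

definition H1D :: "(real^'d::finite) set \<Rightarrow> (real^'d) set \<Rightarrow> (real^'d \<Rightarrow> real) set" where
  "H1D \<Omega> \<Gamma>D = {v \<in> H1 \<Omega>. \<exists>g. has_trace \<Omega> v g \<and> (AE x in surface_measure. x \<in> \<Gamma>D \<longrightarrow> g x = 0)}"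

section \<open>Domain\<close>

text \<open>Regularity of the boundary: near each boundary point the domain is the strict epigraph, in some
  direction $e$, of a Lipschitz function of the component orthogonal to $e$.\<close>

definition lipschitz_boundary :: "(real^'d::finite) set \<Rightarrow> bool" where
  "lipschitz_boundary \<Omega> \<longleftrightarrow> (\<forall>x\<in>frontier \<Omega>. \<exists>r>0. \<exists>e \<gamma> L. norm e = 1 \<and> L-lipschitz_on UNIV \<gamma> \<and>
     \<Omega> \<inter> ball x r = {y \<in> ball x r. \<gamma> (y - (y \<bullet> e) *\<^sub>R e) < y \<bullet> e})"

definition polytopal_domain :: "(real^'d::finite) set \<Rightarrow> bool" where
  "polytopal_domain \<Omega> \<longleftrightarrow> \<Omega> \<noteq> {} \<and> open \<Omega> \<and> bounded \<Omega> \<and> connected \<Omega> \<and> lipschitz_boundary \<Omega> \<and>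
     (\<exists>P. finite P \<and> (\<forall>p\<in>P. polytope p) \<and> closure \<Omega> = \<Union>P)"

text \<open>The partition is regular in the sense that the interface between both parts is negligible.\<close>

definition boundary_partition ::
  "(real^'d::finite) set \<Rightarrow> (real^'d) set \<Rightarrow> (real^'d) set \<Rightarrow> bool" where
  "boundary_partition \<Omega> \<Gamma>D \<Gamma>N \<longleftrightarrow> frontier \<Omega> = \<Gamma>D \<union> \<Gamma>N \<and> \<Gamma>D \<inter> \<Gamma>N = {} \<and>
     \<Gamma>D \<in> sets borel \<and> \<Gamma>N \<in> sets borel \<and> closure \<Gamma>D \<inter> closure \<Gamma>N \<in> null_sets surface_measure"

definition poincare_const :: "(real^'d::finite) set \<Rightarrow> (real^'d) set \<Rightarrow> real \<Rightarrow> bool" where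
  "poincare_const \<Omega> \<Gamma>D C \<longleftrightarrow>
     (\<forall>v\<in>H1D \<Omega> \<Gamma>D. L2_norm \<Omega> v \<le> C * L2_norm \<Omega> (weak_grad \<Omega> v))"

definition admissible_initial ::
  "(real^'d::finite) set \<Rightarrow> nat \<Rightarrow> (nat \<Rightarrow> real) \<Rightarrow> (nat \<Rightarrow> real^'d \<Rightarrow> real) \<Rightarrow> bool" where
  "admissible_initial \<Omega> n M uini \<longleftrightarrow>
     (\<forall>i\<in>{0..n}. uini i \<in> borel_measurable (lebesgue_on \<Omega>) \<and>
        (\<exists>B. AE x in lebesgue_on \<Omega>. \<bar>uini i x\<bar> \<le> B) \<and>
        (AE x in lebesgue_on \<Omega>. 0 \<le> uini i x) \<and>
        integral\<^sup>L (lebesgue_on \<Omega>) (uini i) = M i) \<and>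
     (AE x in lebesgue_on \<Omega>. (\<Sum>i=0..n. uini i x) = 1)"

section \<open>Simplicial meshes and P1 finite elements\<close>

text \<open>The elements of a mesh are open simplices; a vertex is identified with its index, so that the index
  set of vertices is the set \<open>mesh_vertices\<close>.\<close>

definition vertices_of :: "(real^'d::finite) set \<Rightarrow> (real^'d) set" where
  "vertices_of S = {x. x extreme_point_of (closure S)}"

definition edges_of :: "(real^'d::finite) set \<Rightarrow> (real^'d) set set" where
  "edges_of S = {{K, L} | K L. K \<in> vertices_of S \<and> L \<in> vertices_of S \<and> K \<noteq> L}"

definition sqdiff :: "('a \<Rightarrow> real) \<Rightarrow> 'a set \<Rightarrow> real" where
  "sqdiff v E = (THE r. \<exists>K L. E = {K, L} \<and> r = (v K - v L)\<^sup>2)"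

lemma sqdiff_edge: "sqdiff v {K, L} = (v K - v L)\<^sup>2"
  unfolding sqdiff_def
  by (rule the_equality) (auto simp: doubleton_eq_iff power2_commute)

definition mesh_vertices :: "(real^'d::finite) set set \<Rightarrow> (real^'d) set" where
  "mesh_vertices \<T> = (\<Union>S\<in>\<T>. vertices_of S)"

definition simplices_at :: "(real^'d::finite) set set \<Rightarrow> real^'d \<Rightarrow> (real^'d) set set" where
  "simplices_at \<T> K = {S \<in> \<T>. K \<in> vertices_of S}"

text \<open>\<open>triangulation\<close> expresses conformity: two closed simplices meet in a common face.\<close>

definition simplicial_mesh :: "(real^'d::finite) set \<Rightarrow> (real^'d) set set \<Rightarrow> bool" where
  "simplicial_mesh \<Omega> \<T> \<longleftrightarrow> finite \<T> \<and>
     (\<forall>S\<in>\<T>. \<exists>C. int (CARD('d)) simplex C \<and> S = interior C) \<and>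
     pairwise disjnt \<T> \<and> (\<Union>S\<in>\<T>. closure S) = closure \<Omega> \<and> triangulation (closure ` \<T>)"

definition inradius :: "(real^'d::finite) set \<Rightarrow> real" where
  "inradius S = Sup {r. 0 < r \<and> (\<exists>x. ball x r \<subseteq> S)}"

definition mesh_regularity :: "(real^'d::finite) set set \<Rightarrow> real" where
  "mesh_regularity \<T> = Max ((\<lambda>S. diameter S / inradius S) ` \<T>)"

text \<open>Finite element functions live on the closed domain; they are extended by zero so that they are
  determined by their nodal values.\<close>

definition P1_space :: "(real^'d::finite) set set \<Rightarrow> (real^'d \<Rightarrow> real) set" where
  "P1_space \<T> = {v. continuous_on (\<Union>S\<in>\<T>. closure S) v \<and>
     (\<forall>S\<in>\<T>. \<exists>g c. \<forall>x\<in>S. v x = g \<bullet> x + c) \<and>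
     (\<forall>x. x \<notin> (\<Union>S\<in>\<T>. closure S) \<longrightarrow> v x = 0)}"

definition P1_space_D :: "(real^'d::finite) set set \<Rightarrow> (real^'d) set \<Rightarrow> (real^'d \<Rightarrow> real) set" where
  "P1_space_D \<T> \<Gamma>D = {v \<in> P1_space \<T>. \<forall>K\<in>mesh_vertices \<T> \<inter> \<Gamma>D. v K = 0}"

definition interp :: "(real^'d::finite) set set \<Rightarrow> (real^'d \<Rightarrow> real) \<Rightarrow> real^'d \<Rightarrow> real" where
  "interp \<T> v = (THE w. w \<in> P1_space \<T> \<and> (\<forall>K\<in>mesh_vertices \<T>. w K = v K))"

definition nodal_basis :: "(real^'d::finite) set set \<Rightarrow> real^'d \<Rightarrow> real^'d \<Rightarrow> real" where
  "nodal_basis \<T> K = interp \<T> (\<lambda>L. if L = K then 1 else 0)"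

definition grad_on :: "(real^'d \<Rightarrow> real) \<Rightarrow> (real^'d::finite) set \<Rightarrow> real^'d" where
  "grad_on v S = (THE g. \<forall>x\<in>S. grad v x = g)"

definition dual_cell :: "(real^'d::finite) set \<Rightarrow> (real^'d) set set \<Rightarrow> real^'d \<Rightarrow> (real^'d) set" where
  "dual_cell \<Omega> \<T> K =
     {x \<in> \<Omega>. \<forall>L\<in>mesh_vertices \<T>. L \<noteq> K \<longrightarrow> nodal_basis \<T> K x > nodal_basis \<T> L x}"

abbreviation vol :: "(real^'d::finite) set \<Rightarrow> real" where
  "vol A \<equiv> measure lebesgue A"

definition stiffness :: "(real^'d::finite) set set \<Rightarrow> (real^'d) set \<Rightarrow> real^'d \<Rightarrow> real^'d \<Rightarrow> real" where
  "stiffness \<T> S K L = - vol S * (grad_on (nodal_basis \<T> K) S \<bullet> grad_on (nodal_basis \<T> L) S)"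

section \<open>Time discretisation and scheme\<close>

definition time_grid :: "real \<Rightarrow> nat \<Rightarrow> (nat \<Rightarrow> real) \<Rightarrow> bool" where
  "time_grid T N t \<longleftrightarrow> t 0 = 0 \<and> (\<forall>k\<in>{1..N}. t (k - 1) < t k) \<and> t N = T"

definition time_step :: "(nat \<Rightarrow> real) \<Rightarrow> nat \<Rightarrow> real" where
  "time_step t k = t k - t (k - 1)"

text \<open>Reconstruction in space and time of the values \<open>v k K\<close>, used for times in $(0,T]$.\<close>

definition recon ::
  "(real^'d::finite) set set \<Rightarrow> nat \<Rightarrow> (nat \<Rightarrow> real) \<Rightarrow> (nat \<Rightarrow> real^'d \<Rightarrow> real) \<Rightarrow> real \<Rightarrow> real^'d \<Rightarrow> real" where
  "recon \<T> N t v s = interp \<T> (v (THE k. k \<in> {1..N} \<and> s \<in> {t (k - 1)<..t k}))"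

text \<open>Squared $L^2((0,T)\times\Omega)$ norm of the space gradient. The reconstruction is piecewise affine
  and continuous in space, so its weak gradient is the classical one, defined off the skeleton
  of the mesh.\<close>

definition grad_recon_sq ::
  "(real^'d::finite) set \<Rightarrow> real \<Rightarrow> (real^'d) set set \<Rightarrow> nat \<Rightarrow> (nat \<Rightarrow> real)
     \<Rightarrow> (nat \<Rightarrow> real^'d \<Rightarrow> real) \<Rightarrow> real" where
  "grad_recon_sq \<Omega> T \<T> N t v =
     (L2_norm ({0<..<T} \<times> \<Omega>) (\<lambda>(s, x). grad (recon \<T> N t v s) x))\<^sup>2"

definition conc ::
  "nat \<Rightarrow> (real^'d::finite) set \<Rightarrow> (real^'d) set set \<Rightarrow> (nat \<Rightarrow> real^'d \<Rightarrow> real)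
     \<Rightarrow> (nat \<Rightarrow> nat \<Rightarrow> real^'d \<Rightarrow> real) \<Rightarrow> nat \<Rightarrow> nat \<Rightarrow> real^'d \<Rightarrow> real" where
  "conc n \<Omega> \<T> uini \<mu> i k K =
    (if k = 0 then
       integral\<^sup>L (lebesgue_on (dual_cell \<Omega> \<T> K)) (uini i) / vol (dual_cell \<Omega> \<T> K)
     else if i = 0 then 1 / (1 + (\<Sum>j=1..n. exp (\<mu> j k K)))
     else 1 / (1 + (\<Sum>j=1..n. exp (\<mu> j k K))) * exp (\<mu> i k K))"

datatype simplex_choice = Maximum | Average

fun simplex_value :: "simplex_choice \<Rightarrow> (real^'d::finite) set \<Rightarrow> (real^'d \<Rightarrow> real) \<Rightarrow> real" where
  "simplex_value Maximum S v = Max (v ` vertices_of S)"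
| "simplex_value Average S v = 1 / (real CARD('d) + 1) * (\<Sum>L\<in>vertices_of S. v L)"

definition flux ::
  "(nat \<Rightarrow> real) \<Rightarrow> (nat \<Rightarrow> real) \<Rightarrow> real \<Rightarrow> (real^'d::finite) set set
     \<Rightarrow> (nat \<Rightarrow> nat \<Rightarrow> real^'d \<Rightarrow> real) \<Rightarrow> (nat \<Rightarrow> real^'d \<Rightarrow> real)
     \<Rightarrow> nat \<Rightarrow> nat \<Rightarrow> (real^'d) set \<Rightarrow> real^'d \<Rightarrow> real^'d \<Rightarrow> real" where
  "flux D z \<beta> \<T> \<mu> \<phi> i k S K L =
     D i * stiffness \<T> S K L * ((\<mu> i k K - \<mu> i k L) + \<beta> * z i * (\<phi> k K - \<phi> k L))"

text \<open>Unknowns: \<open>\<mu> i k K\<close> and \<open>\<phi> k K\<close>; only $1\le i\le n$, $1\le k\le N$ and mesh vertices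
  \<open>K\<close> are relevant.\<close>

definition scheme_solution ::
  "nat \<Rightarrow> (nat \<Rightarrow> real) \<Rightarrow> (nat \<Rightarrow> real) \<Rightarrow> real \<Rightarrow> real
     \<Rightarrow> (real^'d::finite) set \<Rightarrow> (real^'d) set \<Rightarrow> (real^'d \<Rightarrow> real) \<Rightarrow> (nat \<Rightarrow> real^'d \<Rightarrow> real)
     \<Rightarrow> (real^'d) set set \<Rightarrow> (real^'d \<Rightarrow> real) \<Rightarrow> nat \<Rightarrow> (nat \<Rightarrow> real) \<Rightarrow> simplex_choice
     \<Rightarrow> (nat \<Rightarrow> nat \<Rightarrow> real^'d \<Rightarrow> real) \<Rightarrow> (nat \<Rightarrow> real^'d \<Rightarrow> real) \<Rightarrow> bool" where
  "scheme_solution n z D lam \<beta> \<Omega> \<Gamma>D f uini \<T> \<phi>DT N t ch \<mu> \<phi> \<longleftrightarrow>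
    (let u = conc n \<Omega> \<T> uini \<mu> in
     (\<forall>i\<in>{1..n}. \<forall>K\<in>mesh_vertices \<T>. \<forall>k\<in>{1..N}.
        vol (dual_cell \<Omega> \<T> K) * ((u i k K - u i (k - 1) K) / time_step t k)
        + (\<Sum>S\<in>simplices_at \<T> K. \<Sum>L\<in>vertices_of S.
             simplex_value ch S (u 0 k) * simplex_value ch S (u i k) * flux D z \<beta> \<T> \<mu> \<phi> i k S K L) = 0) \<and>
     (\<forall>k\<in>{1..N}. \<forall>K\<in>mesh_vertices \<T>.
        if K \<in> \<Gamma>D then \<phi> k K = \<phi>DT K
        else lam\<^sup>2 * (\<Sum>S\<in>simplices_at \<T> K. \<Sum>L\<in>vertices_of S. stiffness \<T> S K L * (\<phi> k K - \<phi> k L))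
             = vol (dual_cell \<Omega> \<T> K) * (\<Sum>i=1..n. z i * u i k K)
               + integral\<^sup>L (lebesgue_on (dual_cell \<Omega> \<T> K)) f))"

text \<open>The value at 0 is the stated convention; it is not the limit at 0, which is 1.\<close>

definition zeta :: "real \<Rightarrow> real" where
  "zeta x = (if x = 0 then 0 else x * (ln x - 1) + 1)"

end

theory Submission
  imports Defs
begin

text \<open>
  Testing the conservation laws with the chemical potentials \<open>\<mu> i = ln (u i / u 0)\<close> makes the convex
  entropy \<open>u 0 ln u 0 + \<dots> + u n ln u n\<close> decrease up to the drift term, which Young's inequality
  bounds by half of the dissipation and the Dirichlet energy of the potential. The latter is bounded
  uniformly in time by testing the Poisson equation with \<open>\<phi> - \<phi>DT\<close>. Since the concentrations lie in
  $[0,1]$, the entropy is bounded by a multiple of the volume, so the dissipation is controlled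
  even with the factor \<open>d + 1\<close> hidden in the sum over vertices.

  For the gradients of the concentrations it suffices to bound differences along edges by the
  dissipation along the same edge. The key point is that the difference of \<open>1 / u 0\<close> between the end with
  smaller and the end with larger \<open>u 0\<close> is bounded by the increments of those \<open>exp (\<mu> i)\<close> that are larger at
  the former; a bound along the segment between the two states would fail, because \<open>u 0\<close> may be much larger
  there than at both ends.
\<close>

section \<open>Affine functions on simplices\<close>

text \<open>The Poincare inequality and the bound on the lifting speak of weak gradients, which are
  chosen up to null sets, while the scheme sees one constant gradient per simplex. Testing inside
  each open simplex identifies the two; this is what the fundamental lemma of the calculus of
  variations is for. \<open>Cmin\<close> bounds edge differences by gradients, as needed for the
  potentials. The concentrations need the converse, which comes from inscribed balls and brings in
  \<theta>. In the middle sum of the first estimate each simplex is counted d + 1 times, whereas the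
  entropy argument controls it counted once, so the initial entropy would appear with the factor d +
  1. The constant \<open>C1\<close> therefore absorbs the whole bound, and the sum of
  \<open>zeta\<close> enters only through its sign; in the second estimate it is replaced by n times
  the volume of \<Omega>, which keeps \<open>C2\<close> independent of the initial data. Dual cells
  may a priori be null sets. There the initial average is 0 by the convention for division and does
  not add up to 1, but the weight \<open>vol\<close> removes the cell from the entropy.\<close>

lemma affine_interpolation:
  fixes c :: "'a::euclidean_space set" and v :: "'a \<Rightarrow> real"
  assumes "\<not> affine_dependent c"
  shows "\<exists>g b. \<forall>x\<in>c. v x = g \<bullet> x + b"
proof (cases "c = {}")
  case False
  then obtain a where a: "a \<in> c" by auto
  have "independent ((\<lambda>x. x - a) ` (c - {a}))"
    using affine_dependent_iff_dependent2[OF a] assms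
    by (simp add: uminus_add_conv_diff)
  from linear_independent_extend[OF this, of "\<lambda>y. v (y + a) - v a"]
  obtain l where l: "linear l" "\<forall>y\<in>(\<lambda>x. x - a) ` (c - {a}). l y = v (y + a) - v a" by auto
  \<comment> \<open>Riesz representation: the adjoint of a linear functional, applied to 1, is the
    vector that represents it.\<close>
  define g where "g = adjoint l 1"
  have lg: "l y = g \<bullet> y" for y
    using adjoint_works[OF l(1), of y 1] by (simp add: g_def inner_commute)
  have "v x = g \<bullet> x + (v a - g \<bullet> a)" if "x \<in> c" for x
  proof (cases "x = a")
    case False
    then have "l (x - a) = v x - v a" using l(2) that by auto
    then show ?thesis by (simp add: lg inner_diff_right)
  qed simp
  then show ?thesis by blast
qed auto

lemma affine_eq_on_convex_hull:
  fixes g g' :: "'a::euclidean_space"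
  assumes "\<And>x. x \<in> c \<Longrightarrow> g \<bullet> x + b = g' \<bullet> x + b'" and "x \<in> convex hull c"
  shows "g \<bullet> x + b = g' \<bullet> x + b'"
proof -
  have "convex {x. (g - g') \<bullet> x = b' - b}" by (rule convex_hyperplane)
  then have "convex hull c \<subseteq> {x. (g - g') \<bullet> x = b' - b}"
    by (rule hull_minimal[rotated]) (auto simp: inner_diff_left dest: assms(1))
  then show ?thesis using assms(2) by (auto simp: inner_diff_left)
qed

lemma affine_le_on_convex_hull:
  fixes g :: "'a::euclidean_space"
  assumes "\<And>x. x \<in> c \<Longrightarrow> g \<bullet> x + b \<le> m" and "x \<in> convex hull c"
  shows "g \<bullet> x + b \<le> m"
proof -
  have "convex hull c \<subseteq> {x. g \<bullet> x \<le> m - b}"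
    using convex_halfspace_le[of g "m - b"]
    by (intro hull_minimal) (force dest: assms(1))+
  then show ?thesis using assms(2) by auto
qed

lemma grad_affine:
  fixes S :: "(real^'d::finite) set"
  assumes "open S" "x \<in> S" "\<And>x. x \<in> S \<Longrightarrow> w x = g \<bullet> x + b"
  shows "grad w x = g"
proof -
  have "((\<lambda>x. g \<bullet> x + b) has_derivative (\<lambda>h. g \<bullet> h)) (at x)"
    by (auto intro!: derivative_eq_intros)
  then have "(w has_derivative (\<lambda>h. g \<bullet> h)) (at x)"
    by (rule has_derivative_transform_within_open[OF _ assms(1,2)]) (simp add: assms(3))
  then have "frechet_derivative w (at x) = (\<lambda>h. g \<bullet> h)"
    by (rule frechet_derivative_at[symmetric])
  then show ?thesis by (simp add: grad_def vec_eq_iff inner_axis)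
qed

section \<open>Finite elements on a conforming mesh\<close>

locale mesh =
  fixes \<Omega> :: "(real^'d::finite) set" and \<T>
  assumes mesh: "simplicial_mesh \<Omega> \<T>"
begin

section \<open>Simplices and elementwise affine functions\<close>

lemma finite_mesh: "finite \<T>"
  using mesh by (simp add: simplicial_mesh_def)

text \<open>A mesh element is only given as the interior of some simplex \<open>C\<close>. Since
  \<open>C\<close> has full dimension, its interior is its relative interior, hence nonempty, and
  its closure returns \<open>C\<close>; the extreme points are then the affinely independent points
  spanning \<open>C\<close>.\<close>

lemma simplex_hull:
  assumes "S \<in> \<T>"
  shows "\<not> affine_dependent (vertices_of S)" "card (vertices_of S) = CARD('d) + 1"
    "closure S = convex hull (vertices_of S)" "open S" "S \<noteq> {}" "S = interior (closure S)"
proof -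
  from mesh assms obtain C where C: "int (CARD('d)) simplex C" "S = interior C"
    unfolding simplicial_mesh_def by auto
  then obtain c where c: "\<not> affine_dependent c" "int (card c) = int CARD('d) + 1" "C = convex hull c"
    unfolding simplex_def by auto
  have "aff_dim C = int (CARD('d))" using C(1) aff_dim_simplex by blast
  then have "interior C = rel_interior C"
    by (metis aff_dim_eq_full rel_interior_interior DIM_cart DIM_real mult.right_neutral)
  moreover have "C \<noteq> {}" using c by auto
  ultimately have ne: "interior C \<noteq> {}"
    by (simp add: c(3) rel_interior_eq_empty)
  have cl: "closure S = C"
    using convex_closure_interior[of C] ne C c(3) closed_simplex[OF C(1)] by simp
  have v: "vertices_of S = c"
    unfolding vertices_of_def cl using extreme_point_of_convex_hull_affine_independent[OF c(1)] c(3) by auto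
  show "\<not> affine_dependent (vertices_of S)" "card (vertices_of S) = CARD('d) + 1"
    "closure S = convex hull (vertices_of S)" "open S" "S \<noteq> {}" "S = interior (closure S)"
    using v cl c ne C by auto
qed

lemma finite_vertices_of: "S \<in> \<T> \<Longrightarrow> finite (vertices_of S)"
  using simplex_hull(2) card.infinite by fastforce

lemma vertices_of_nonempty: "S \<in> \<T> \<Longrightarrow> vertices_of S \<noteq> {}"
  using simplex_hull(2) by fastforce

lemma vertices_of_subset_closure: "S \<in> \<T> \<Longrightarrow> vertices_of S \<subseteq> closure S"
  using simplex_hull(3) hull_subset by metis

lemma finite_mesh_vertices: "finite (mesh_vertices \<T>)"
  unfolding mesh_vertices_def using finite_mesh finite_vertices_of by auto

lemma vertices_of_subset: "S \<in> \<T> \<Longrightarrow> vertices_of S \<subseteq> mesh_vertices \<T>"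
  unfolding mesh_vertices_def by auto

text \<open>The set where \<open>w\<close> agrees with its affine formula is closed in
  \<open>closure S\<close> and contains \<open>S\<close>.\<close>

lemma P1_affine:
  assumes "w \<in> P1_space \<T>" "S \<in> \<T>"
  shows "\<exists>g b. \<forall>x\<in>closure S. w x = g \<bullet> x + b"
proof -
  from assms have "\<exists>g b. \<forall>x\<in>S. w x = g \<bullet> x + b" by (simp add: P1_space_def)
  then obtain g b where gb: "\<forall>x\<in>S. w x = g \<bullet> x + b" by blast
  have "continuous_on (closure S) w"
    using assms by (auto simp: P1_space_def intro: continuous_on_subset)
  then have "closure S \<subseteq> {x \<in> closure S. w x = g \<bullet> x + b}"
    by (intro closure_minimal continuous_closed_preimage_constant[of "closure S" "\<lambda>x. w x - (g \<bullet> x + b)" 0, simplified] continuous_intros)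
      (use gb closure_subset in auto)
  then show ?thesis by blast
qed

lemma grad_on_eq:
  assumes "S \<in> \<T>" "\<forall>x\<in>closure S. w x = g \<bullet> x + b"
  shows "grad_on w S = g" "x \<in> S \<Longrightarrow> grad w x = g"
proof -
  have g: "grad w x = g" if "x \<in> S" for x
    using grad_affine[OF simplex_hull(4)[OF assms(1)] that, of w g b] assms(2) closure_subset by blast
  then show "x \<in> S \<Longrightarrow> grad w x = g" by simp
  show "grad_on w S = g"
    unfolding grad_on_def using g simplex_hull(5)[OF assms(1)] by (intro the_equality) auto
qed

lemma P1_on_closure:
  assumes "w \<in> P1_space \<T>" "S \<in> \<T>"
  shows "\<exists>b. \<forall>x\<in>closure S. w x = grad_on w S \<bullet> x + b"
proof -
  obtain g b where gb: "\<forall>x\<in>closure S. w x = g \<bullet> x + b" using P1_affine[OF assms] by (elim exE)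
  then show ?thesis using grad_on_eq(1)[OF assms(2) gb] by auto
qed

lemma P1_grad:
  assumes "w \<in> P1_space \<T>" "S \<in> \<T>" "x \<in> S"
  shows "grad w x = grad_on w S"
proof -
  obtain g b where gb: "\<forall>x\<in>closure S. w x = g \<bullet> x + b" using P1_affine[OF assms(1,2)] by (elim exE)
  then show ?thesis using grad_on_eq[OF assms(2) gb] assms(3) by auto
qed

lemma P1_eqI:
  assumes "w \<in> P1_space \<T>" "w' \<in> P1_space \<T>" "\<And>K. K \<in> mesh_vertices \<T> \<Longrightarrow> w K = w' K"
  shows "w = w'"
proof
  fix x
  show "w x = w' x"
  proof (cases "x \<in> (\<Union>S\<in>\<T>. closure S)")
    case True
    then obtain S where S: "S \<in> \<T>" "x \<in> closure S" by auto
    obtain b where b: "\<forall>x\<in>closure S. w x = grad_on w S \<bullet> x + b" using P1_on_closure[OF assms(1) S(1)] by (elim exE)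
    obtain b' where b': "\<forall>x\<in>closure S. w' x = grad_on w' S \<bullet> x + b'" using P1_on_closure[OF assms(2) S(1)] by (elim exE)
    have "grad_on w S \<bullet> K + b = grad_on w' S \<bullet> K + b'" if "K \<in> vertices_of S" for K
      using that b[rule_format, of K] b'[rule_format, of K] assms(3)[of K] vertices_of_subset_closure[OF S(1)] vertices_of_subset[OF S(1)]
      by (auto simp: subset_iff)
    then show ?thesis
      using affine_eq_on_convex_hull[of "vertices_of S" "grad_on w S" b "grad_on w' S" b' x] S simplex_hull(3)[OF S(1)] b b' by auto
  qed (use assms in \<open>auto simp: P1_space_def\<close>)
qed

text \<open>By conformity the intersection is a face of both closed simplices, so its extreme points
  are the common vertices; Krein-Milman recovers the intersection from them.\<close>

lemma face_hull:
  assumes "S \<in> \<T>" "S' \<in> \<T>"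
  shows "closure S \<inter> closure S' = convex hull (vertices_of S \<inter> vertices_of S')"
proof -
  have tr: "triangulation (closure ` \<T>)" using mesh by (simp add: simplicial_mesh_def)
  have f: "(closure S \<inter> closure S') face_of closure S" "(closure S \<inter> closure S') face_of closure S'"
    using tr assms unfolding triangulation_def by (metis imageI Int_commute)+
  have in_closure: "x \<in> A" if "x extreme_point_of A" for x :: "real^'d" and A
    using that by (simp add: extreme_point_of_def)
  have "{x. x extreme_point_of (closure S \<inter> closure S')} = vertices_of S \<inter> vertices_of S'"
    using extreme_point_of_face[OF f(1)] extreme_point_of_face[OF f(2)]
      in_closure[of _ "closure S"] in_closure[of _ "closure S'"]
    unfolding vertices_of_def by blast
  moreover have "compact (closure S)" "compact (closure S')" "convex (closure S)" "convex (closure S')"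
    using simplex_hull(3) assms finite_vertices_of by (auto simp: finite_imp_compact_convex_hull)
  ultimately show ?thesis
    using Krein_Milman_Minkowski[of "closure S \<inter> closure S'"] by (simp add: compact_Int convex_Int)
qed

text \<open>Interpolate on each simplex and glue. Where two closed simplices meet, the two affine
  formulas agree at the common vertices and hence on their hull, which by \<open>face_hull\<close>
  is the whole intersection; so the choice made by \<open>SOME\<close> is harmless, and finitely
  many closed pieces give continuity.\<close>

lemma interp_exists:
  "\<exists>w. w \<in> P1_space \<T> \<and> (\<forall>K\<in>mesh_vertices \<T>. w K = v K)"
proof -
  have "\<forall>S\<in>\<T>. \<exists>g b. \<forall>K\<in>vertices_of S. v K = g \<bullet> K + b"
    using affine_interpolation simplex_hull(1) by blast
  then obtain g b where gb: "\<And>S K. S \<in> \<T> \<Longrightarrow> K \<in> vertices_of S \<Longrightarrow> v K = g S \<bullet> K + (b S :: real)"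
    by metis
  define w where "w x = (if x \<in> (\<Union>S\<in>\<T>. closure S)
    then let S = (SOME S. S \<in> \<T> \<and> x \<in> closure S) in g S \<bullet> x + b S else 0)" for x
  have w: "w x = g S \<bullet> x + b S" if S: "S \<in> \<T>" "x \<in> closure S" for S x
  proof -
    define S' where "S' = (SOME S. S \<in> \<T> \<and> x \<in> closure S)"
    have S': "S' \<in> \<T> \<and> x \<in> closure S'" unfolding S'_def using S by (metis (mono_tags, lifting) someI_ex)
    have "w x = g S' \<bullet> x + b S'" using S unfolding w_def S'_def by (auto simp: Let_def)
    also have "\<dots> = g S \<bullet> x + b S"
    proof (rule affine_eq_on_convex_hull)
      show "x \<in> convex hull (vertices_of S \<inter> vertices_of S')"
        using face_hull[OF S(1), of S'] S' S by auto
      fix K assume "K \<in> vertices_of S \<inter> vertices_of S'"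
      then show "g S' \<bullet> K + b S' = g S \<bullet> K + b S"
        using gb[of S K] gb[of S' K] S' S by auto
    qed
    finally show ?thesis .
  qed
  have "continuous_on (\<Union>S\<in>\<T>. closure S) w"
  proof (rule continuous_on_closed_Union)
    show "finite \<T>" by (rule finite_mesh)
    fix S assume S: "S \<in> \<T>"
    show "continuous_on (closure S) w"
      by (rule continuous_on_eq[of _ "\<lambda>x. g S \<bullet> x + b S"]) (auto intro!: continuous_intros simp: w[OF S])
  qed auto
  moreover have "\<forall>S\<in>\<T>. \<exists>g c. \<forall>x\<in>S. w x = g \<bullet> x + c"
    using w closure_subset by blast
  moreover have "\<forall>x. x \<notin> (\<Union>S\<in>\<T>. closure S) \<longrightarrow> w x = 0" unfolding w_def by auto
  ultimately have "w \<in> P1_space \<T>" by (simp add: P1_space_def)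
  moreover have "w K = v K" if K: "K \<in> mesh_vertices \<T>" for K
  proof -
    obtain S where S: "S \<in> \<T>" "K \<in> vertices_of S" using K unfolding mesh_vertices_def by blast
    then show ?thesis using w[OF S(1)] gb[OF S] vertices_of_subset_closure[OF S(1)] by auto
  qed
  ultimately show ?thesis by blast
qed

lemma interp_P1: "interp \<T> v \<in> P1_space \<T>"
  and interp_vertex: "K \<in> mesh_vertices \<T> \<Longrightarrow> interp \<T> v K = v K"
proof -
  have "\<exists>!w. w \<in> P1_space \<T> \<and> (\<forall>K\<in>mesh_vertices \<T>. w K = v K)"
    using interp_exists[of v] P1_eqI by (intro ex_ex1I) auto
  from theI'[OF this] show "interp \<T> v \<in> P1_space \<T>" "K \<in> mesh_vertices \<T> \<Longrightarrow> interp \<T> v K = v K"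
    unfolding interp_def by auto
qed

lemma interp_P1_space: "w \<in> P1_space \<T> \<Longrightarrow> interp \<T> w = w"
  by (rule P1_eqI) (auto simp: interp_P1 interp_vertex)

section \<open>Elementwise gradients of interpolants and the stiffness matrix\<close>

lemma grad_on_interp_eqI:
  assumes "S \<in> \<T>" "\<And>K. K \<in> vertices_of S \<Longrightarrow> v K = g \<bullet> K + b"
  shows "grad_on (interp \<T> v) S = g"
proof (rule grad_on_eq[OF assms(1)], rule)
  fix x assume x: "x \<in> closure S"
  obtain b' where b': "\<forall>x\<in>closure S. interp \<T> v x = grad_on (interp \<T> v) S \<bullet> x + b'"
    using P1_on_closure[OF interp_P1[of v] assms(1)] by (elim exE)
  have "grad_on (interp \<T> v) S \<bullet> K + b' = g \<bullet> K + b" if "K \<in> vertices_of S" for K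
    using that b'[rule_format, of K] assms(2)[of K] interp_vertex[of K v] vertices_of_subset_closure[OF assms(1)] vertices_of_subset[OF assms(1)]
    by (auto simp: subset_iff)
  from affine_eq_on_convex_hull[OF this, where x = x] show "interp \<T> v x = g \<bullet> x + b"
    using x simplex_hull(3)[OF assms(1)] b' by simp
qed

lemma interp_affine:
  assumes "S \<in> \<T>"
  shows "\<exists>b. (\<forall>K\<in>vertices_of S. v K = grad_on (interp \<T> v) S \<bullet> K + b)
    \<and> (\<forall>x\<in>closure S. interp \<T> v x = grad_on (interp \<T> v) S \<bullet> x + b)"
proof -
  obtain b where b: "\<forall>x\<in>closure S. interp \<T> v x = grad_on (interp \<T> v) S \<bullet> x + b"
    using P1_on_closure[OF interp_P1[of v] assms] by (elim exE)
  moreover have "v K = grad_on (interp \<T> v) S \<bullet> K + b" if "K \<in> vertices_of S" for K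
    using that b[rule_format, of K] vertices_of_subset_closure[OF assms] vertices_of_subset[OF assms] interp_vertex[of K v] by (auto simp: subset_iff)
  ultimately show ?thesis by (intro exI[of _ b]) simp
qed

lemma interp_affine_vertices:
  assumes "S \<in> \<T>"
  obtains b where "\<forall>K\<in>vertices_of S. v K = grad_on (interp \<T> v) S \<bullet> K + b"
  using interp_affine[OF assms, of v] by (elim exE conjE) (rule that)

lemma grad_on_interp_combination:
  assumes "S \<in> \<T>"
  shows "grad_on (interp \<T> (\<lambda>K. \<Sum>L\<in>A. a L * v L K)) S = (\<Sum>L\<in>A. a L *\<^sub>R grad_on (interp \<T> (v L)) S)"
proof -
  have "\<forall>L. \<exists>b. \<forall>K\<in>vertices_of S. v L K = grad_on (interp \<T> (v L)) S \<bullet> K + b"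
    by (meson interp_affine[OF assms])
  then obtain b where b: "\<forall>L. \<forall>K\<in>vertices_of S. v L K = grad_on (interp \<T> (v L)) S \<bullet> K + b L"
    by (rule choice[THEN exE])
  show ?thesis
  proof (rule grad_on_interp_eqI[OF assms, where b = "\<Sum>L\<in>A. a L * b L"])
    fix K assume "K \<in> vertices_of S"
    then have "a L * v L K = (a L *\<^sub>R grad_on (interp \<T> (v L)) S) \<bullet> K + a L * b L" for L
      using b[rule_format, of K L] by (simp add: algebra_simps)
    then show "(\<Sum>L\<in>A. a L * v L K)
        = (\<Sum>L\<in>A. a L *\<^sub>R grad_on (interp \<T> (v L)) S) \<bullet> K + (\<Sum>L\<in>A. a L * b L)"
      by (simp add: inner_sum_left sum.distrib)
  qed
qed

lemma grad_on_interp_cong: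
  assumes "S \<in> \<T>" "\<And>K. K \<in> vertices_of S \<Longrightarrow> v K = w K"
  shows "grad_on (interp \<T> v) S = grad_on (interp \<T> w) S"
proof -
  obtain b where "\<forall>K\<in>vertices_of S. w K = grad_on (interp \<T> w) S \<bullet> K + b"
    by (rule interp_affine_vertices[OF assms(1)])
  then show ?thesis using assms(2) by (intro grad_on_interp_eqI[OF assms(1), where b = b]) simp
qed

lemma grad_on_interp_diff:
  assumes "S \<in> \<T>"
  shows "grad_on (interp \<T> (\<lambda>K. v K - w K)) S = grad_on (interp \<T> v) S - grad_on (interp \<T> w) S"
proof -
  obtain b where b: "\<forall>K\<in>vertices_of S. v K = grad_on (interp \<T> v) S \<bullet> K + b"
    by (rule interp_affine_vertices[OF assms])
  obtain b' where b': "\<forall>K\<in>vertices_of S. w K = grad_on (interp \<T> w) S \<bullet> K + b'"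
    by (rule interp_affine_vertices[OF assms])
  show ?thesis
  proof (rule grad_on_interp_eqI[OF assms, where b = "b - b'"])
    fix K assume "K \<in> vertices_of S"
    from b[rule_format, OF this] b'[rule_format, OF this]
    show "v K - w K = (grad_on (interp \<T> v) S - grad_on (interp \<T> w) S) \<bullet> K + (b - b')"
      unfolding inner_diff_left by linarith
  qed
qed

text \<open>On one simplex only the nodal functions of its own vertices are needed to reproduce the
  nodal values there.\<close>

lemma sum_nodal_basis:
  assumes "S \<in> \<T>"
  shows "(\<Sum>K\<in>vertices_of S. v K *\<^sub>R grad_on (nodal_basis \<T> K) S) = grad_on (interp \<T> v) S"
proof -
  have "(\<Sum>L\<in>vertices_of S. v L *\<^sub>R grad_on (nodal_basis \<T> L) S)
      = grad_on (interp \<T> (\<lambda>K. \<Sum>L\<in>vertices_of S. v L * (if K = L then 1 else 0))) S"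
    unfolding nodal_basis_def by (subst grad_on_interp_combination[OF assms]) simp
  also have "\<dots> = grad_on (interp \<T> v) S"
    by (rule grad_on_interp_cong[OF assms]) (simp add: finite_vertices_of[OF assms] sum.delta if_distrib cong: if_cong)
  finally show ?thesis .
qed

text \<open>Discrete integration by parts. The minus sign in \<open>stiffness\<close> meets the
  minus sign of \<open>w L\<close>, and the part with \<open>w K\<close> drops out because the nodal
  functions of a simplex add up to 1 on it, so that their gradients add up to 0.\<close>

lemma sum_stiffness:
  assumes "S \<in> \<T>"
  shows "(\<Sum>K\<in>vertices_of S. \<Sum>L\<in>vertices_of S. stiffness \<T> S K L * (w K - w L) * v K)
    = vol S * (grad_on (interp \<T> w) S \<bullet> grad_on (interp \<T> v) S)"
proof -
  let ?V = "vertices_of S" and ?e = "\<lambda>K. grad_on (nodal_basis \<T> K) S"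
  have one: "(\<Sum>L\<in>?V. ?e L) = 0"
    using sum_nodal_basis[OF assms, of "\<lambda>_. 1"] grad_on_interp_eqI[OF assms, of "\<lambda>_. 1" 0 1] by simp
  have "(\<Sum>L\<in>?V. stiffness \<T> S K L * (w K - w L) * v K)
      = vol S * ((v K *\<^sub>R ?e K) \<bullet> (\<Sum>L\<in>?V. w L *\<^sub>R ?e L)) - vol S * w K * v K * (?e K \<bullet> (\<Sum>L\<in>?V. ?e L))" for K
    by (simp add: inner_sum_right sum_distrib_left sum_subtractf[symmetric] stiffness_def algebra_simps)
  then have "(\<Sum>K\<in>?V. \<Sum>L\<in>?V. stiffness \<T> S K L * (w K - w L) * v K)
      = vol S * ((\<Sum>K\<in>?V. v K *\<^sub>R ?e K) \<bullet> (\<Sum>L\<in>?V. w L *\<^sub>R ?e L))"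
    by (simp add: one inner_sum_left sum_distrib_left)
  then show ?thesis by (simp add: sum_nodal_basis[OF assms] inner_commute)
qed

text \<open>Assembly: turns equations tested node by node into sums over elements, where
  \<open>sum_stiffness\<close> applies.\<close>

lemma sum_vertices_simplices:
  "(\<Sum>K\<in>mesh_vertices \<T>. \<Sum>S\<in>simplices_at \<T> K. F K S) = (\<Sum>S\<in>\<T>. \<Sum>K\<in>vertices_of S. F K S)"
proof -
  have "(\<Sum>K\<in>mesh_vertices \<T>. \<Sum>S\<in>simplices_at \<T> K. F K S) = (\<Sum>S\<in>\<T>. \<Sum>K\<in>{K\<in>mesh_vertices \<T>. K \<in> vertices_of S}. F K S)"
    unfolding simplices_at_def by (rule sum.swap_restrict[OF finite_mesh_vertices finite_mesh])
  also have "\<dots> = (\<Sum>S\<in>\<T>. \<Sum>K\<in>vertices_of S. F K S)"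
    using vertices_of_subset by (intro sum.cong) auto
  finally show ?thesis .
qed

end

section \<open>Weak gradients of piecewise affine functions\<close>

lemma grad_eqI:
  fixes p :: "real^'d::finite \<Rightarrow> real"
  assumes "(p has_derivative (\<lambda>h. g \<bullet> h)) (at x)"
  shows "grad p x = g"
  using frechet_derivative_at[OF assms, symmetric] by (simp add: grad_def vec_eq_iff inner_axis)

lemma C1I:
  fixes p :: "real^'d::finite \<Rightarrow> real"
  assumes "\<And>x. (p has_derivative (\<lambda>h. G x \<bullet> h)) (at x)" "continuous_on UNIV G"
  shows "C1 p"
  unfolding C1_def
proof
  show "\<forall>x. p differentiable at x" using assms(1) by (auto simp: differentiable_def)
  have "grad p = G" using grad_eqI[OF assms(1)] by auto
  then show "continuous_on UNIV (grad p)" using assms(2) by simp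
qed

lemma C1_has_derivative:
  fixes p :: "real^'d::finite \<Rightarrow> real"
  assumes "C1 p"
  shows "(p has_derivative (\<lambda>h. grad p x \<bullet> h)) (at x)"
proof -
  have d: "(p has_derivative frechet_derivative p (at x)) (at x)"
    using assms by (auto simp: C1_def frechet_derivative_works)
  then have lin: "linear (frechet_derivative p (at x))" by (rule has_derivative_linear)
  have "frechet_derivative p (at x) = (\<lambda>h. grad p x \<bullet> h)"
  proof
    fix h
    have "frechet_derivative p (at x) h = frechet_derivative p (at x) (\<Sum>i\<in>UNIV. h $ i *s axis i 1)"
      by (simp only: basis_expansion)
    also have "\<dots> = (\<Sum>i\<in>UNIV. h $ i * grad p x $ i)"
      by (simp add: linear_sum[OF lin] linear_scale[OF lin] scalar_mult_eq_scaleR grad_def)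
    finally show "frechet_derivative p (at x) h = grad p x \<bullet> h" by (simp add: inner_vec_def mult.commute)
  qed
  then show ?thesis using d by (simp only:)
qed

lemma C1_continuous:
  assumes "C1 p" shows "continuous_on UNIV p"
  using assms by (auto simp: C1_def intro!: continuous_at_imp_continuous_on differentiable_imp_continuous_within)

lemma C1_grad_continuous: "C1 p \<Longrightarrow> continuous_on UNIV (\<lambda>x. grad p x $ i)"
  unfolding C1_def by (intro continuous_intros) auto

lemma C1_mult:
  fixes p q :: "real^'d::finite \<Rightarrow> real"
  assumes "C1 p" "C1 q" shows "C1 (\<lambda>x. p x * q x)"
proof (rule C1I)
  show "((\<lambda>x. p x * q x) has_derivative (\<lambda>h. (p x *\<^sub>R grad q x + q x *\<^sub>R grad p x) \<bullet> h)) (at x)" for x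
    by (rule has_derivative_eq_rhs, rule has_derivative_mult[OF C1_has_derivative[OF assms(1)] C1_has_derivative[OF assms(2)]])
      (auto simp: inner_add_left fun_eq_iff mult.commute)
  show "continuous_on UNIV (\<lambda>x. p x *\<^sub>R grad q x + q x *\<^sub>R grad p x)"
    using assms C1_continuous by (intro continuous_intros) (auto simp: C1_def)
qed

lemma C1_affine: "C1 (\<lambda>x. g \<bullet> x + b)"
  by (rule C1I[where G = "\<lambda>_. g"]) (auto intro!: derivative_eq_intros)

lemma C1_prod:
  fixes p :: "'i \<Rightarrow> real^'d::finite \<Rightarrow> real"
  assumes "\<And>i. i \<in> I \<Longrightarrow> C1 (p i)"
  shows "C1 (\<lambda>x. \<Prod>i\<in>I. p i x)"
  using assms
proof (induction I rule: infinite_finite_induct)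
  case (insert i I)
  then show ?case using C1_mult[of "p i" "\<lambda>x. \<Prod>i\<in>I. p i x"] by simp
qed (use C1_affine[of 0 1] in simp_all)

lemma C1_compose:
  fixes p :: "real^'d::finite \<Rightarrow> real"
  assumes "C1 p" "\<And>s. (f has_real_derivative f' s) (at s)" "continuous_on UNIV f'"
  shows "C1 (\<lambda>x. f (p x))"
proof (rule C1I)
  show "((\<lambda>x. f (p x)) has_derivative (\<lambda>h. (f' (p x) *\<^sub>R grad p x) \<bullet> h)) (at x)" for x
    by (rule has_derivative_eq_rhs, rule has_derivative_compose[OF C1_has_derivative[OF assms(1)], unfolded o_def])
      (use assms(2)[of "p x"] in \<open>auto simp: has_field_derivative_def\<close>)
  have "continuous_on UNIV (\<lambda>x. f' (p x))"
    using continuous_on_compose2[OF assms(3) C1_continuous[OF assms(1)]] by auto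
  then show "continuous_on UNIV (\<lambda>x. f' (p x) *\<^sub>R grad p x)"
    using assms(1) by (intro continuous_intros) (auto simp: C1_def)
qed

section \<open>Integrals of compactly supported functions and of their derivatives\<close>

lemma integrable_bounded_support:
  fixes p :: "'a::euclidean_space \<Rightarrow> real"
  assumes "continuous_on UNIV p" "bounded {x. p x \<noteq> 0}"
  shows "integrable lborel p"
proof -
  obtain R where R: "{x. p x \<noteq> 0} \<subseteq> cball 0 R"
    using assms(2) unfolding bounded_pos by (auto simp: subset_iff)
  have "integrable lborel (\<lambda>x. indicator (cball 0 R) x *\<^sub>R p x)"
    by (rule borel_integrable_compact) (auto intro: continuous_on_subset[OF assms(1)])
  also have "(\<lambda>x. indicator (cball 0 R) x *\<^sub>R p x) = p"
    using R by (auto simp: indicator_def fun_eq_iff)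
  finally show ?thesis .
qed

lemma grad_eq_0_outside_support:
  fixes p :: "real^'d::finite \<Rightarrow> real"
  assumes "x \<notin> closure {x. p x \<noteq> 0}"
  shows "grad p x = 0"
proof (rule grad_eqI)
  have "((\<lambda>x. 0) has_derivative (\<lambda>h. 0 \<bullet> h)) (at x)" by simp
  then show "(p has_derivative (\<lambda>h. 0 \<bullet> h)) (at x)"
  proof (rule has_derivative_transform_within_open)
    show "open (- closure {x. p x \<noteq> 0})" by (rule open_Compl[OF closed_closure])
    show "x \<in> - closure {x. p x \<noteq> 0}" using assms by simp
    show "0 = p y" if "y \<in> - closure {x. p x \<noteq> 0}" for y
      using that closure_subset[of "{x. p x \<noteq> 0}"] by auto
  qed
qed

text \<open>Difference quotients of \<open>q\<close> have vanishing integral by translation invariance.\<close>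

lemma integral_grad_eq_0:
  fixes q :: "real^'d::finite \<Rightarrow> real"
  assumes "C1 q" "bounded {x. q x \<noteq> 0}"
  shows "integral\<^sup>L lborel (\<lambda>x. grad q x $ i) = 0"
proof -
  let ?e = "axis i 1 :: real^'d"
  obtain R where R: "{x. q x \<noteq> 0} \<subseteq> cball 0 R" "R > 0"
    using assms(2) unfolding bounded_pos by (auto simp: subset_iff)
  have "compact ((\<lambda>x. grad q x $ i) ` cball 0 (R + 2))"
    by (intro compact_continuous_image continuous_on_subset[OF C1_grad_continuous[OF assms(1)]]) auto
  then obtain B where B: "\<And>x. x \<in> cball 0 (R + 2) \<Longrightarrow> \<bar>grad q x $ i\<bar> \<le> B"
    using compact_imp_bounded bounded_real by (metis (no_types, lifting) imageI)
  have qint: "integrable lborel q" by (rule integrable_bounded_support[OF C1_continuous[OF assms(1)] assms(2)])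
  \<comment> \<open>As the increments are at most 1, the quotients vanish beyond radius
    \<open>R + 1\<close>, and for the other points the mean value point stays within radius
    \<open>R + 2\<close>, where \<open>B\<close> bounds the derivative. This gives the integrable
    majorant.\<close>
  define h :: "nat \<Rightarrow> real" where "h m = 1 / real (Suc m)" for m
  have h: "0 < h m" "h m \<le> 1" for m by (auto simp: h_def)
  define s where "s m x = (q (h m *\<^sub>R ?e + x) - q x) / h m" for m x
  have der: "((\<lambda>t. q (t *\<^sub>R ?e + x)) has_real_derivative grad q (t *\<^sub>R ?e + x) $ i) (at t)" for x t
  proof -
    have "((\<lambda>t. q (t *\<^sub>R ?e + x)) has_derivative (\<lambda>d. grad q (t *\<^sub>R ?e + x) \<bullet> (d *\<^sub>R ?e))) (at t)"
      by (rule has_derivative_compose[OF _ C1_has_derivative[OF assms(1)]]) (auto intro!: derivative_eq_intros)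
    then show ?thesis
      unfolding has_field_derivative_def by (rule has_derivative_eq_rhs) (auto simp: inner_axis fun_eq_iff)
  qed
  have int0: "integral\<^sup>L lborel (s m) = 0" for m
  proof -
    have i1: "integral\<^sup>L lborel (\<lambda>x. q (h m *\<^sub>R ?e + x)) = integral\<^sup>L lborel q"
      "integrable lborel (\<lambda>x. q (h m *\<^sub>R ?e + x))"
    proof -
      have m: "q \<in> borel_measurable borel" using qint by auto
      have "integral\<^sup>L (distr lborel borel ((+) (h m *\<^sub>R ?e))) q = integral\<^sup>L lborel (\<lambda>x. q (h m *\<^sub>R ?e + x))"
        by (rule integral_distr) (use m in auto)
      then show "integral\<^sup>L lborel (\<lambda>x. q (h m *\<^sub>R ?e + x)) = integral\<^sup>L lborel q" by (simp add: lborel_distr_plus)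
      have "integrable (distr lborel borel ((+) (h m *\<^sub>R ?e))) q" using qint by (simp add: lborel_distr_plus)
      then show "integrable lborel (\<lambda>x. q (h m *\<^sub>R ?e + x))"
        by (subst (asm) integrable_distr_eq) (use m in auto)
    qed
    then show ?thesis unfolding s_def using qint by simp
  qed
  have bound: "norm (s m x) \<le> B * indicator (cball 0 (R + 1)) x" for m x
  proof (cases "x \<in> cball 0 (R + 1)")
    case True
    obtain t where t: "0 < t" "t < h m" "q (h m *\<^sub>R ?e + x) - q (0 *\<^sub>R ?e + x) = (h m - 0) * grad q (t *\<^sub>R ?e + x) $ i"
      using MVT2[OF h(1)[of m], of "\<lambda>t. q (t *\<^sub>R ?e + x)" "\<lambda>t. grad q (t *\<^sub>R ?e + x) $ i"] der by auto
    have "norm (t *\<^sub>R ?e + x) \<le> t * norm ?e + norm x" using norm_triangle_ineq[of "t *\<^sub>R ?e" x] t(1) by simp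
    then have "norm (t *\<^sub>R ?e + x) \<le> R + 2" using t h(2)[of m] True by (simp add: norm_axis_1)
    then show ?thesis using t B[of "t *\<^sub>R ?e + x"] True h(1)[of m] by (simp add: s_def)
  next
    case False
    have "norm x - norm (h m *\<^sub>R ?e) \<le> norm (h m *\<^sub>R ?e + x)"
      using norm_diff_ineq[of x "h m *\<^sub>R ?e"] by (simp add: add.commute)
    then have "norm (h m *\<^sub>R ?e + x) > R" "norm x > R" using False h[of m] by (auto simp: norm_axis_1)
    then have "q (h m *\<^sub>R ?e + x) = 0" "q x = 0" using R(1) by (force simp: subset_iff)+
    then show ?thesis using False by (simp add: s_def)
  qed
  have lim: "(\<lambda>m. s m x) \<longlonglongrightarrow> grad q x $ i" for x
  proof -
    have "((\<lambda>t. (q (t *\<^sub>R ?e + x) - q x) / t) \<longlongrightarrow> grad q x $ i) (at 0)"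
      using der[of x 0] by (simp add: has_field_derivative_iff)
    moreover have "filterlim h (at 0) sequentially"
      unfolding filterlim_at h_def using LIMSEQ_inverse_real_of_nat by (auto simp: inverse_eq_divide simp del: of_nat_Suc)
    ultimately show ?thesis unfolding s_def by (rule filterlim_compose)
  qed
  have qm: "q \<in> borel_measurable borel" using qint by auto
  have "(\<lambda>m. integral\<^sup>L lborel (s m)) \<longlonglongrightarrow> integral\<^sup>L lborel (\<lambda>x. grad q x $ i)"
  proof (rule integral_dominated_convergence[where w = "\<lambda>x. B * indicator (cball 0 (R + 1)) x"])
    show "(\<lambda>x. grad q x $ i) \<in> borel_measurable lborel"
      using C1_grad_continuous[OF assms(1)] by (auto intro: borel_measurable_continuous_onI)
    show "s m \<in> borel_measurable lborel" for m unfolding s_def using qm by measurable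
    show "integrable lborel (\<lambda>x. B * indicator (cball 0 (R + 1)) x)"
      by (intro integrable_mult_right integrable_real_indicator) (auto simp: emeasure_bounded_finite[OF bounded_cball, unfolded infinity_ennreal_def])
  qed (use lim bound in auto)
  then show ?thesis using int0 by (simp add: LIMSEQ_const_iff)
qed

section \<open>Cutoff functions of boxes\<close>

lemma has_real_derivative_max_0_square:
  "((\<lambda>s. (max 0 s)\<^sup>2) has_real_derivative 2 * max 0 s) (at (s::real))"
proof (cases s "0::real" rule: linorder_cases)
  case less
  have "((\<lambda>s. 0) has_real_derivative 0) (at s)" by simp
  then have "((\<lambda>s. (max 0 s)\<^sup>2) has_real_derivative 0) (at s)"
    by (rule has_field_derivative_transform_within_open[where S = "{..<0}"]) (use less in auto)
  then show ?thesis using less by simp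
next
  case equal
  have "((\<lambda>h. ((max 0 h)\<^sup>2 - 0) / h) \<longlongrightarrow> 0) (at (0::real))"
  proof (rule Lim_null_comparison)
    show "\<forall>\<^sub>F h in at (0::real). norm (((max 0 h)\<^sup>2 - 0) / h) \<le> \<bar>h\<bar>"
      by (intro always_eventually) (auto simp: max_def power2_eq_square)
    show "((\<lambda>h. \<bar>h\<bar>) \<longlongrightarrow> 0) (at (0::real))" by (rule tendsto_rabs_zero) simp
  qed
  then show ?thesis using equal by (simp add: has_field_derivative_iff)
next
  case greater
  have "((\<lambda>s. s\<^sup>2) has_real_derivative 2 * s) (at s)" by (auto intro!: derivative_eq_intros)
  then have "((\<lambda>s. (max 0 s)\<^sup>2) has_real_derivative 2 * s) (at s)"
    by (rule has_field_derivative_transform_within_open[where S = "{0<..}"]) (use greater in auto)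
  then show ?thesis using greater by simp
qed

text \<open>Positive exactly on the open box. Squaring the positive parts removes their kinks, which
  suffices because test functions are only required to be C1.\<close>

definition box_bump :: "real^'d::finite \<Rightarrow> real^'d \<Rightarrow> real^'d \<Rightarrow> real" where
  "box_bump a b x = (\<Prod>i\<in>UNIV. (max 0 (x $ i - a $ i))\<^sup>2 * (max 0 (b $ i - x $ i))\<^sup>2)"

lemma box_bump_eq_0: "box_bump a b x = 0 \<longleftrightarrow> x \<notin> box a b"
proof -
  have "(max 0 (x $ i - a $ i))\<^sup>2 * (max 0 (b $ i - x $ i))\<^sup>2 = 0 \<longleftrightarrow> \<not> (a $ i < x $ i \<and> x $ i < b $ i)" for i
    by (auto simp: max_def)
  then show ?thesis unfolding box_bump_def mem_box_cart by simp
qed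

lemma C1_box_bump:
  fixes a b :: "real^'d::finite"
  shows "C1 (box_bump a b)"
proof -
  have "C1 (\<lambda>x::real^'d. axis i 1 \<bullet> x + (- a $ i))" "C1 (\<lambda>x::real^'d. (- axis i 1) \<bullet> x + b $ i)" for i
    by (rule C1_affine)+
  then have "C1 (\<lambda>x::real^'d. x $ i - a $ i)" "C1 (\<lambda>x::real^'d. b $ i - x $ i)" for i
    by (simp_all add: inner_axis')
  then have "C1 (\<lambda>x. (max 0 (x $ i - a $ i))\<^sup>2)" "C1 (\<lambda>x. (max 0 (b $ i - x $ i))\<^sup>2)" for i
    by (intro C1_compose[where f = "\<lambda>s. (max 0 s)\<^sup>2", OF _ has_real_derivative_max_0_square]; auto intro!: continuous_intros)+
  then show ?thesis unfolding box_bump_def by (intro C1_prod C1_mult)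
qed

text \<open>Saturating the bump keeps the values between 0 and 1 and pushes them to 1 wherever the
  bump is positive, so the sequence in \<open>m\<close> converges boundedly to the indicator of the
  open box.\<close>

definition box_cutoff :: "real^'d::finite \<Rightarrow> real^'d \<Rightarrow> nat \<Rightarrow> real^'d \<Rightarrow> real" where
  "box_cutoff a b m x = real m * (box_bump a b x)\<^sup>2 / (1 + real m * (box_bump a b x)\<^sup>2)"

lemma one_plus_square_pos: "0 < 1 + real m * s\<^sup>2"
  by (simp add: add_pos_nonneg)

lemma test_function_box_cutoff:
  assumes "cbox a b \<subseteq> S"
  shows "test_function S (box_cutoff a b m)"
proof -
  have der: "((\<lambda>s. real m * s\<^sup>2 / (1 + real m * s\<^sup>2)) has_real_derivative
      2 * real m * s / (1 + real m * s\<^sup>2)\<^sup>2) (at s)" for s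
    using one_plus_square_pos[of m s]
    by (auto intro!: derivative_eq_intros simp: divide_simps power2_eq_square algebra_simps)
  have "continuous_on UNIV (\<lambda>s. 2 * real m * s / (1 + real m * s\<^sup>2)\<^sup>2)"
    using one_plus_square_pos[of m] by (intro continuous_intros) (auto simp: less_imp_neq[symmetric])
  then have "C1 (box_cutoff a b m)"
    unfolding box_cutoff_def using C1_compose[OF C1_box_bump der] by blast
  moreover have "closure {x. box_cutoff a b m x \<noteq> 0} \<subseteq> cbox a b"
    by (rule closure_minimal) (auto simp: box_cutoff_def box_bump_eq_0 box_subset_cbox[THEN subsetD])
  ultimately show ?thesis
    using assms unfolding test_function_def
    by (metis compact_cbox closed_closure compact_eq_bounded_closed bounded_subset subset_trans)
qed

lemma box_cutoff_bound: "\<bar>box_cutoff a b m x\<bar> \<le> 1"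
  using one_plus_square_pos[of m "box_bump a b x"] by (auto simp: box_cutoff_def divide_simps)

lemma box_cutoff_tendsto: "(\<lambda>m. box_cutoff a b m x) \<longlonglongrightarrow> indicator (box a b) x"
proof (cases "x \<in> box a b")
  case True
  define c where "c = (box_bump a b x)\<^sup>2"
  have c: "c > 0" using True box_bump_eq_0[of a b x] by (auto simp: c_def)
  have "(\<lambda>m. real m * c / (1 + real m * c)) \<longlonglongrightarrow> 1"
  proof -
    have "filterlim (\<lambda>m. real m * c) at_top sequentially"
      using c by (intro filterlim_at_top_mult_tendsto_pos[OF tendsto_const c filterlim_real_sequentially])
    then have "filterlim (\<lambda>m. 1 + real m * c) at_top sequentially"
      by (rule filterlim_tendsto_add_at_top[OF tendsto_const])
    then have "(\<lambda>m. 1 - 1 / (1 + real m * c)) \<longlonglongrightarrow> 1 - 0"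
      by (intro tendsto_intros tendsto_divide_0[OF tendsto_const] filterlim_at_top_imp_at_infinity)
    moreover have "1 - 1 / (1 + real m * c) = real m * c / (1 + real m * c)" for m
    proof -
      have "1 + real m * c \<noteq> 0" using c by (metis add_pos_nonneg less_le mult_nonneg_nonneg of_nat_0_le_iff zero_less_one less_irrefl)
      then show ?thesis by (simp add: field_simps)
    qed
    ultimately show ?thesis by simp
  qed
  then show ?thesis using True by (simp add: box_cutoff_def c_def)
next
  case False
  then show ?thesis using box_bump_eq_0[of a b x] by (simp add: box_cutoff_def)
qed

lemma test_function_bounded_support: "test_function S p \<Longrightarrow> bounded {x. p x \<noteq> 0}"
  unfolding test_function_def by (meson bounded_subset closure_subset compact_imp_bounded)

section \<open>The fundamental lemma of the calculus of variations\<close>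

lemma fundamental_lemma_box:
  fixes h :: "real^'d::finite \<Rightarrow> real"
  assumes h: "integrable lborel h" and S: "cbox a b \<subseteq> S"
    and 0: "\<And>p. test_function S p \<Longrightarrow> integral\<^sup>L lborel (\<lambda>x. h x * p x) = 0"
  shows "integral\<^sup>L lborel (\<lambda>x. indicator (box a b) x * h x) = 0"
proof -
  have "(\<lambda>m. integral\<^sup>L lborel (\<lambda>x. h x * box_cutoff a b m x)) \<longlonglongrightarrow> integral\<^sup>L lborel (\<lambda>x. indicator (box a b) x * h x)"
  proof (rule integral_dominated_convergence[where w = "\<lambda>x. \<bar>h x\<bar>"])
    show "AE x in lborel. (\<lambda>m. h x * box_cutoff a b m x) \<longlonglongrightarrow> indicator (box a b) x * h x"
      using tendsto_mult[OF tendsto_const box_cutoff_tendsto, of "h x" a b x for x] by (intro AE_I2) (simp add: mult.commute)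
    show "AE x in lborel. norm (h x * box_cutoff a b m x) \<le> \<bar>h x\<bar>" for m
      using mult_left_mono[OF box_cutoff_bound, of "\<bar>h x\<bar>" a b m x for x] by (intro AE_I2) (simp add: abs_mult)
    show "(\<lambda>x. h x * box_cutoff a b m x) \<in> borel_measurable lborel" for m
    proof -
      have "box_cutoff a b m \<in> borel_measurable borel"
        using test_function_box_cutoff[OF S, of m] C1_continuous by (auto simp: test_function_def intro!: borel_measurable_continuous_onI)
      then show ?thesis using h by simp
    qed
    show "(\<lambda>x. indicator (box a b) x * h x) \<in> borel_measurable lborel" using h by simp
  qed (use h in auto)
  then show ?thesis using 0[OF test_function_box_cutoff[OF S]] by (simp add: LIMSEQ_const_iff)
qed

text \<open>The cutoffs give vanishing integrals over boxes. Boxes are stable under intersection and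
  generate the Borel sets, so a Dynkin argument extends this to all Borel subsets of a box inside
  \<open>S\<close>, which forces \<open>h\<close> to vanish almost everywhere there; countably many
  such boxes cover \<open>S\<close>.\<close>

lemma fundamental_lemma_lborel:
  fixes h :: "real^'d::finite \<Rightarrow> real"
  assumes h: "integrable lborel h" and S: "open S"
    and 0: "\<And>p. test_function S p \<Longrightarrow> integral\<^sup>L lborel (\<lambda>x. h x * p x) = 0"
  shows "AE x in lborel. x \<in> S \<longrightarrow> h x = 0"
proof -
  have cb: "AE x in lborel. x \<in> cbox p q \<longrightarrow> h x = 0" if pq: "cbox p q \<subseteq> S" for p q
  proof -
    let ?h = "\<lambda>x. indicator (box p q) x * h x"
    have hi: "integrable lborel ?h"
      using integrable_mult_indicator[OF _ h, of "box p q"] by simp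
    have hA: "integrable lborel (\<lambda>x. indicator A x * ?h x)" if "A \<in> sets borel" for A
      using integrable_mult_indicator[OF _ hi, of A] that by simp
    have basic: "integral\<^sup>L lborel (\<lambda>x. indicator (box a b) x * ?h x) = 0" for a b
    proof -
      obtain c d where cd: "box a b \<inter> box p q = box c d" "cbox a b \<inter> cbox p q = cbox c d"
        unfolding box_Int_box Int_interval by blast
      have "(\<lambda>x. indicator (box a b) x * ?h x) = (\<lambda>x. indicator (box c d) x * h x)"
        unfolding cd(1)[symmetric] by (auto simp: indicator_def fun_eq_iff)
      moreover have "cbox c d \<subseteq> S" using cd(2) pq by blast
      ultimately show ?thesis using fundamental_lemma_box[OF h _ 0, of c d S] by simp
    qed
    have "integral\<^sup>L lborel (\<lambda>x. indicator A x * ?h x) = 0" if "A \<in> sets borel" for A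
    proof -
      have "Int_stable (range (\<lambda>(a, b). box a b :: (real^'d) set))"
        by (auto simp: Int_stable_def box_Int_box)
      moreover have "range (\<lambda>(a, b). box a b :: (real^'d) set) \<subseteq> Pow UNIV" by auto
      moreover have "A \<in> sigma_sets UNIV (range (\<lambda>(a, b). box a b :: (real^'d) set))"
        using that unfolding borel_eq_box by simp
      ultimately show ?thesis
      proof (induction rule: sigma_sets_induct_disjoint)
        case (basic A) then show ?case using \<open>\<And>a b. integral\<^sup>L lborel (\<lambda>x. indicator (box a b) x * ?h x) = 0\<close> by auto
      next
        case empty then show ?case by simp
      next
        case (compl A)
        then have A: "A \<in> sets borel" by (simp add: borel_eq_box)
        \<comment> \<open>Complements need the integral over the whole space to vanish. This is why
          \<open>h\<close> is first cut off to a single box contained in \<open>S\<close>.\<close>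
        have all: "integral\<^sup>L lborel ?h = 0" by (rule fundamental_lemma_box[OF h pq 0])
        have "(\<lambda>x. indicator (UNIV - A) x * ?h x) = (\<lambda>x. ?h x - indicator A x * ?h x)"
          by (auto simp: indicator_def fun_eq_iff)
        then show ?case using compl hA[OF A] hi all by simp
      next
        case (union F)
        then have F: "\<And>i. F i \<in> sets borel" by (simp add: borel_eq_box subset_eq)
        have "(LINT x:(\<Union>i. F i)|lborel. ?h x) = (\<Sum>i. (LINT x:(F i)|lborel. ?h x))"
        proof (rule lebesgue_integral_countable_add)
          show "\<And>i j. i \<noteq> j \<Longrightarrow> F i \<inter> F j = {}" using union(1) by (auto simp: disjoint_family_on_def)
          show "set_integrable lborel (\<Union>i. F i) ?h"
            unfolding set_integrable_def using hA[of "\<Union>i. F i"] F by simp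
        qed (use F in auto)
        then show ?case using union.IH by (simp add: set_lebesgue_integral_def)
      qed
    qed
    then have "AE x in lborel. ?h x = 0"
      by (intro sigma_finite_measure.density_zero[OF sigma_finite_lborel hi]) (auto simp: set_lebesgue_integral_def)
    moreover have "AE x in lborel. x \<notin> cbox p q - box p q"
    proof -
      have "cbox p q - box p q \<in> null_sets lborel"
        using negligible_frontier_interval[of p q] by (simp add: negligible_iff_null_sets null_sets_completion_iff)
      then show ?thesis by (rule AE_not_in)
    qed
    ultimately show ?thesis by eventually_elim (auto simp: indicator_def split: if_splits)
  qed
  obtain D where D: "countable D" "D \<subseteq> Pow S" "\<And>X. X \<in> D \<Longrightarrow> \<exists>a b. X = cbox a b" "\<Union>D = S"
    using open_countable_Union_open_cbox[OF S] by blast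
  have "AE x in lborel. \<forall>X\<in>D. x \<in> X \<longrightarrow> h x = 0"
    using D(1-3) cb by (subst AE_ball_countable) (auto, blast)
  then show ?thesis by eventually_elim (use D(4) in blast)
qed

text \<open>Passes to a Borel function equal to \<open>h\<close> almost everywhere, which leaves all
  integrals against test functions unchanged.\<close>

lemma fundamental_lemma:
  fixes h :: "real^'d::finite \<Rightarrow> real"
  assumes h: "integrable lebesgue h" and S: "open S"
    and 0: "\<And>p. test_function S p \<Longrightarrow> integral\<^sup>L lebesgue (\<lambda>x. h x * p x) = 0"
  shows "AE x in lebesgue. x \<in> S \<longrightarrow> h x = 0"
proof -
  obtain h' where h': "h' \<in> borel_measurable lborel" "AE x in lborel. h x = h' x"
    using completion_ex_borel_measurable_real[OF borel_measurable_integrable[OF h]] by auto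
  have ae: "AE x in lebesgue. h x = h' x" using h'(2) by (rule AE_completion)
  have m: "h' \<in> borel_measurable lebesgue" using h'(1) by (rule measurable_completion)
  have "integrable lebesgue h'" 
    using integrable_cong_AE[OF borel_measurable_integrable[OF h] m ae] h by simp
  then have hi: "integrable lborel h'" using h'(1) by (simp add: integrable_completion)
  have "integral\<^sup>L lborel (\<lambda>x. h' x * p x) = 0" if p: "test_function S p" for p
  proof -
    have pm: "p \<in> borel_measurable borel"
      using p C1_continuous by (auto simp: test_function_def intro!: borel_measurable_continuous_onI)
    then have pl: "p \<in> borel_measurable lebesgue" by (simp add: measurable_completion)
    have "integral\<^sup>L lborel (\<lambda>x. h' x * p x) = integral\<^sup>L lebesgue (\<lambda>x. h' x * p x)"
      using h'(1) pm by (intro integral_completion[symmetric]) simp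
    also have "\<dots> = integral\<^sup>L lebesgue (\<lambda>x. h x * p x)"
      using ae m pl borel_measurable_integrable[OF h] by (intro integral_cong_AE) auto
    finally show ?thesis using 0[OF p] by simp
  qed
  from fundamental_lemma_lborel[OF hi S this]
  have "AE x in lebesgue. x \<in> S \<longrightarrow> h' x = 0" by (rule AE_completion)
  then show ?thesis using ae by eventually_elim auto
qed

section \<open>Identification of the weak gradient inside a simplex\<close>

lemma integral_lebesgue_on:
  fixes f :: "'a::euclidean_space \<Rightarrow> real"
  assumes "A \<in> sets lebesgue"
  shows "integral\<^sup>L (lebesgue_on A) f = integral\<^sup>L lebesgue (\<lambda>x. indicator A x * f x)"
  using integral_restrict_space[of A lebesgue f] assms by simp

lemma integrable_lebesgue_on:
  fixes f :: "'a::euclidean_space \<Rightarrow> real"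
  assumes "A \<in> sets lebesgue"
  shows "integrable (lebesgue_on A) f \<longleftrightarrow> integrable lebesgue (\<lambda>x. indicator A x * f x)"
  using integrable_restrict_space[of A lebesgue f] assms by simp

text \<open>The weak gradient is only tested with functions supported in \<open>S\<close>, so no continuity of \<open>v\<close>
  across the boundary of \<open>S\<close> is involved.\<close>

lemma weak_grad_affine:
  fixes \<Omega> :: "(real^'d::finite) set"
  assumes \<Omega>: "open \<Omega>" "bounded \<Omega>" and S: "open S" "S \<subseteq> \<Omega>" and v: "\<And>x. x \<in> S \<Longrightarrow> v x = g \<bullet> x + b"
    and G: "in_L2 \<Omega> G" "has_weak_grad \<Omega> v G"
  shows "AE x in lebesgue. x \<in> S \<longrightarrow> G x = g"
proof -
  have \<Omega>s: "\<Omega> \<in> sets lebesgue" using \<Omega> by simp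
  have \<Omega>f: "emeasure lebesgue \<Omega> < \<infinity>"
    using emeasure_bounded_finite[OF \<Omega>(2)] \<Omega> by simp
  \<comment> \<open>On a bounded domain square integrable functions are integrable, since a
    component is at most 1 plus the squared norm.\<close>
  have Gi: "integrable (lebesgue_on \<Omega>) (\<lambda>x. G x $ i)" for i
  proof (rule Bochner_Integration.integrable_bound)
    have fin: "integrable (lebesgue_on \<Omega>) (\<lambda>x. 1::real)"
      using \<Omega>f \<Omega>s by (simp add: integrable_lebesgue_on integrable_real_indicator)
    then show "integrable (lebesgue_on \<Omega>) (\<lambda>x. 1 + (norm (G x))\<^sup>2)"
      using G(1) unfolding in_L2_def by auto
    have "(\<lambda>y::real^'d. y $ i) \<in> borel_measurable borel"
      by (intro borel_measurable_continuous_onI continuous_intros)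
    then show "(\<lambda>x. G x $ i) \<in> borel_measurable (lebesgue_on \<Omega>)"
      using G(1) unfolding in_L2_def by (auto intro: measurable_compose)
    have "\<bar>y $ i\<bar> \<le> 1 + (norm y)\<^sup>2" for y :: "real^'d"
    proof -
      have "0 \<le> (norm y - 1)\<^sup>2" by simp
      then have "2 * norm y \<le> 1 + (norm y)\<^sup>2" by (simp add: power2_diff)
      then show ?thesis using component_le_norm_cart[of y i] norm_ge_zero[of y] by linarith
    qed
    then show "AE x in lebesgue_on \<Omega>. norm (G x $ i) \<le> norm (1 + (norm (G x))\<^sup>2)"
      by (auto simp: abs_of_nonneg add_nonneg_nonneg)
  qed
  have comp: "AE x in lebesgue. x \<in> S \<longrightarrow> indicator \<Omega> x * (G x $ i - g $ i) = 0" for i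
  proof (rule fundamental_lemma[OF _ S(1)])
    have h: "integrable (lebesgue_on \<Omega>) (\<lambda>x. G x $ i - g $ i)"
      using Gi[of i] \<Omega>f \<Omega>s by (intro Bochner_Integration.integrable_diff) (simp_all add: integrable_lebesgue_on integrable_real_indicator)
    then show "integrable lebesgue (\<lambda>x. indicator \<Omega> x * (G x $ i - g $ i))"
      using \<Omega>s by (simp add: integrable_lebesgue_on)
    fix p assume p: "test_function S p"
    have C1: "C1 p" and supp: "closure {x. p x \<noteq> 0} \<subseteq> S" using p by (auto simp: test_function_def)
    have p0: "p x = 0" "grad p x = 0" if "x \<notin> S" for x
      using that supp closure_subset[of "{x. p x \<noteq> 0}"] grad_eq_0_outside_support[of x p] by auto
    have pc: "continuous_on UNIV p" by (rule C1_continuous[OF C1])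
    have bd: "bounded {x. p x \<noteq> 0}" by (rule test_function_bounded_support[OF p])
    \<comment> \<open>The product of the affine function with \<open>p\<close> is C1 with bounded
      support, so its partial derivatives integrate to 0. By the product rule this is integration by
      parts, and it produces the gradient \<open>g\<close>.\<close>
    have q: "C1 (\<lambda>x. (g \<bullet> x + b) * p x)" by (intro C1_mult C1_affine C1)
    have gq: "grad (\<lambda>x. (g \<bullet> x + b) * p x) x $ i = (g \<bullet> x + b) * grad p x $ i + g $ i * p x" for x
    proof -
      have "grad (\<lambda>x. (g \<bullet> x + b) * p x) x = (g \<bullet> x + b) *\<^sub>R grad p x + p x *\<^sub>R g"
        by (rule grad_eqI, rule has_derivative_eq_rhs, rule has_derivative_mult[OF _ C1_has_derivative[OF C1]])
          (auto intro!: derivative_eq_intros simp: fun_eq_iff inner_add_left)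
      then show ?thesis by simp
    qed
    have pint: "integrable lborel p" by (rule integrable_bounded_support[OF pc bd])
    have dint: "integrable lborel (\<lambda>x. (g \<bullet> x + b) * grad p x $ i)"
    proof (rule integrable_bounded_support)
      show "continuous_on UNIV (\<lambda>x. (g \<bullet> x + b) * grad p x $ i)"
        by (intro continuous_intros C1_grad_continuous[OF C1])
      have "{x. (g \<bullet> x + b) * grad p x $ i \<noteq> 0} \<subseteq> closure {x. p x \<noteq> 0}"
        using grad_eq_0_outside_support[of _ p] by force
      then show "bounded {x. (g \<bullet> x + b) * grad p x $ i \<noteq> 0}"
        using bd by (meson bounded_closure bounded_subset)
    qed
    have "integral\<^sup>L lborel (\<lambda>x. grad (\<lambda>x. (g \<bullet> x + b) * p x) x $ i) = 0"
      by (rule integral_grad_eq_0[OF q], rule bounded_subset[OF bd]) auto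
    then have ibp: "integral\<^sup>L lborel (\<lambda>x. (g \<bullet> x + b) * grad p x $ i) = - (g $ i * integral\<^sup>L lborel p)"
      using pint dint unfolding gq by simp
    have pB: "\<exists>B. \<forall>x. \<bar>p x\<bar> \<le> B"
    proof -
      have "compact (p ` closure {x. p x \<noteq> 0})"
        using p by (intro compact_continuous_image continuous_on_subset[OF pc]) (auto simp: test_function_def)
      then obtain B where B: "\<And>x. x \<in> closure {x. p x \<noteq> 0} \<Longrightarrow> \<bar>p x\<bar> \<le> B"
        using compact_imp_bounded bounded_real by (metis (no_types, lifting) imageI)
      have "\<bar>p x\<bar> \<le> max B 0" for x
        using B[of x] closure_subset[of "{x. p x \<noteq> 0}"] by (cases "p x = 0") auto
      then show ?thesis by blast
    qed
    then obtain B where B: "\<And>x. \<bar>p x\<bar> \<le> B" by blast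
    have pm: "p \<in> borel_measurable (lebesgue_on \<Omega>)"
      using pc by (intro measurable_restrict_space1 measurable_completion) (auto intro: borel_measurable_continuous_onI)
    have Gp: "integrable (lebesgue_on \<Omega>) (\<lambda>x. G x $ i * p x)"
    proof (rule Bochner_Integration.integrable_bound)
      show "integrable (lebesgue_on \<Omega>) (\<lambda>x. B * G x $ i)" using Gi by auto
      show "(\<lambda>x. G x $ i * p x) \<in> borel_measurable (lebesgue_on \<Omega>)" using Gi[of i] pm by auto
      show "AE x in lebesgue_on \<Omega>. norm (G x $ i * p x) \<le> norm (B * G x $ i)"
        using B mult_right_mono[of "\<bar>p x\<bar>" "\<bar>B\<bar>" "\<bar>G x $ i\<bar>" for x]
        by (intro AE_I2) (auto simp: abs_mult mult.commute intro!: mult_left_mono order_trans[OF B abs_ge_self])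
    qed
    have int_p: "integral\<^sup>L lborel p = integral\<^sup>L (lebesgue_on \<Omega>) p"
    proof -
      have "integral\<^sup>L lborel p = integral\<^sup>L lebesgue p"
        using pint by (intro integral_completion[symmetric]) auto
      moreover have "(\<lambda>x. indicator \<Omega> x * p x) = p" using p0 S(2) by (auto simp: indicator_def fun_eq_iff)
      ultimately show ?thesis by (simp add: integral_lebesgue_on[OF \<Omega>s])
    qed
    have pint\<Omega>: "integrable (lebesgue_on \<Omega>) p"
    proof -
      have "integrable lebesgue p" using pint by (subst integrable_completion) auto
      moreover have "(\<lambda>x. indicator \<Omega> x * p x) = p" using p0 S(2) by (auto simp: indicator_def fun_eq_iff)
      ultimately show ?thesis by (simp add: integrable_lebesgue_on[OF \<Omega>s])
    qed
    have "integral\<^sup>L (lebesgue_on \<Omega>) (\<lambda>x. v x * grad p x $ i) = integral\<^sup>L lborel (\<lambda>x. (g \<bullet> x + b) * grad p x $ i)"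
    proof -
      have "(\<lambda>x. indicator \<Omega> x * (v x * grad p x $ i)) = (\<lambda>x. (g \<bullet> x + b) * grad p x $ i)"
      proof
        show "indicator \<Omega> x * (v x * grad p x $ i) = (g \<bullet> x + b) * grad p x $ i" for x
          using p0(2)[of x] S(2) v[of x] by (cases "x \<in> S") (auto simp: indicator_def)
      qed
      then show ?thesis using dint by (simp add: integral_lebesgue_on[OF \<Omega>s] integral_completion)
    qed
    moreover have "test_function \<Omega> p" using p S(2) by (auto simp: test_function_def)
    then have "integral\<^sup>L (lebesgue_on \<Omega>) (\<lambda>x. v x * grad p x $ i) = - integral\<^sup>L (lebesgue_on \<Omega>) (\<lambda>x. G x $ i * p x)"
      using G(2) by (auto simp: has_weak_grad_def)
    ultimately have "integral\<^sup>L (lebesgue_on \<Omega>) (\<lambda>x. G x $ i * p x) = g $ i * integral\<^sup>L (lebesgue_on \<Omega>) p"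
      using ibp int_p by simp
    then have "integral\<^sup>L (lebesgue_on \<Omega>) (\<lambda>x. G x $ i * p x - g $ i * p x) = 0"
      using Gp pint\<Omega> by simp
    then show "integral\<^sup>L lebesgue (\<lambda>x. indicator \<Omega> x * (G x $ i - g $ i) * p x) = 0"
      by (simp add: integral_lebesgue_on[OF \<Omega>s] algebra_simps)
  qed
  have "AE x in lebesgue. \<forall>i. x \<in> S \<longrightarrow> indicator \<Omega> x * (G x $ i - g $ i) = 0"
    using comp by (subst AE_all_countable) auto
  then show ?thesis
    by eventually_elim (use S(2) in \<open>auto simp: vec_eq_iff indicator_def split: if_splits\<close>)
qed

section \<open>Geometry of the mesh\<close>

text \<open>Excludes slits. At a frontier point the domain locally lies strictly above a graph, so
  moving from the point a little against \<open>e\<close> leads strictly below it, into an open set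
  that misses \<Omega>. Hence a frontier point has points outside \<open>closure \<Omega>\<close>
  arbitrarily near and cannot lie in \<open>S\<close>.\<close>

lemma lipschitz_boundary_subset:
  fixes \<Omega> :: "(real^'d::finite) set"
  assumes "open \<Omega>" "lipschitz_boundary \<Omega>" "open S" "S \<subseteq> closure \<Omega>"
  shows "S \<subseteq> \<Omega>"
proof
  fix x assume x: "x \<in> S"
  show "x \<in> \<Omega>"
  proof (rule ccontr)
    assume nx: "x \<notin> \<Omega>"
    then have "x \<in> frontier \<Omega>" using x assms by (auto simp: frontier_def interior_open)
    then obtain r e \<gamma> L where r: "r > 0" "norm e = 1" "L-lipschitz_on UNIV \<gamma>"
      "\<Omega> \<inter> ball x r = {y \<in> ball x r. \<gamma> (y - (y \<bullet> e) *\<^sub>R e) < y \<bullet> e}"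
      using assms(2) unfolding lipschitz_boundary_def by (elim ballE[of _ _ x] exE conjE) (rule that, assumption+, simp)
    have c\<gamma>: "continuous_on UNIV \<gamma>" by (rule lipschitz_on_continuous_on[OF r(3)])
    obtain \<epsilon> where \<epsilon>: "\<epsilon> > 0" "ball x \<epsilon> \<subseteq> S" using assms(3) x open_contains_ball by blast
    define s where "s = min \<epsilon> r / 2"
    define y where "y = x - s *\<^sub>R e"
    have s: "0 < s" "s < \<epsilon>" "s < r" using \<epsilon> r by (auto simp: s_def)
    have yd: "dist x y = s" using s r by (simp add: y_def dist_norm)
    have ee: "e \<bullet> e = 1" using r(2) by (simp add: dot_square_norm)
    define U where "U = {y. y \<bullet> e < \<gamma> (y - (y \<bullet> e) *\<^sub>R e)} \<inter> ball x r"
    have "open U"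
      unfolding U_def
      by (intro open_Int open_ball open_Collect_less continuous_intros continuous_on_compose2[OF c\<gamma>]) auto
    moreover have "U \<inter> \<Omega> = {}"
    proof -
      have "\<gamma> (y - (y \<bullet> e) *\<^sub>R e) < y \<bullet> e" if "y \<in> \<Omega>" "y \<in> ball x r" for y
        using r(4) that by blast
      then show ?thesis unfolding U_def by fastforce
    qed
    moreover have "y \<in> U"
    proof -
      have "\<not> \<gamma> (x - (x \<bullet> e) *\<^sub>R e) < x \<bullet> e"
      proof
        assume "\<gamma> (x - (x \<bullet> e) *\<^sub>R e) < x \<bullet> e"
        then have "x \<in> {y \<in> ball x r. \<gamma> (y - (y \<bullet> e) *\<^sub>R e) < y \<bullet> e}" using r(1) by simp
        then show False using nx unfolding r(4)[symmetric] by simp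
      qed
      moreover have "y \<bullet> e = x \<bullet> e - s" by (simp add: y_def inner_diff_left ee)
      moreover have "y - (y \<bullet> e) *\<^sub>R e = x - (x \<bullet> e) *\<^sub>R e"
        by (simp add: y_def inner_diff_left ee algebra_simps)
      ultimately show ?thesis using s yd by (simp add: U_def)
    qed
    ultimately have "y \<notin> closure \<Omega>" using open_Int_closure_eq_empty[of U \<Omega>] by blast
    moreover have "y \<in> S" using \<epsilon> yd s by auto
    ultimately show False using assms(4) by blast
  qed
qed

context mesh
begin

section \<open>Gradient bounds from mesh regularity\<close>

lemma bounded_simplex: "S \<in> \<T> \<Longrightarrow> bounded S"
  using simplex_hull(3) finite_vertices_of
  by (metis bounded_closure_image bounded_convex_hull bounded_subset closure_subset finite_imp_bounded)

lemma finite_edges_of: "S \<in> \<T> \<Longrightarrow> finite (edges_of S)"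
  by (rule finite_subset[of _ "Pow (vertices_of S)"]) (auto simp: edges_of_def finite_vertices_of)

lemma sqdiff_nonneg: "E \<in> edges_of S \<Longrightarrow> 0 \<le> sqdiff v E"
  by (auto simp: edges_of_def sqdiff_edge)

lemma vertex_diff_le:
  assumes "S \<in> \<T>" "K \<in> vertices_of S" "L \<in> vertices_of S"
  shows "v K - v L \<le> sqrt (\<Sum>E\<in>edges_of S. sqdiff v E)"
proof (cases "K = L")
  case True
  then show ?thesis using sqdiff_nonneg by (auto intro!: sum_nonneg)
next
  case False
  then have "{K, L} \<in> edges_of S" using assms by (auto simp: edges_of_def)
  then have "(v K - v L)\<^sup>2 \<le> (\<Sum>E\<in>edges_of S. sqdiff v E)"
    using member_le_sum[of "{K, L}" "edges_of S" "sqdiff v"] finite_edges_of[OF assms(1)] sqdiff_nonneg[of _ S v]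
    by (auto simp: sqdiff_edge)
  then show ?thesis by (rule real_le_rsqrt)
qed

text \<open>An affine function takes its extreme values over a simplex at vertices; this is used
  first for \<open>x\<close> and then for \<open>y\<close>.\<close>

lemma interp_diff_le:
  assumes S: "S \<in> \<T>" and xy: "x \<in> closure S" "y \<in> closure S"
    and le: "\<And>K L. K \<in> vertices_of S \<Longrightarrow> L \<in> vertices_of S \<Longrightarrow> v K - v L \<le> Q"
  shows "grad_on (interp \<T> v) S \<bullet> (x - y) \<le> Q"
proof -
  let ?g = "grad_on (interp \<T> v) S"
  obtain b where b: "\<forall>K\<in>vertices_of S. v K = ?g \<bullet> K + b" by (rule interp_affine_vertices[OF S])
  have *: "?g \<bullet> K - ?g \<bullet> L \<le> Q" if "K \<in> vertices_of S" "L \<in> vertices_of S" for K L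
    using le[OF that] b that by simp
  have xyc: "x \<in> convex hull (vertices_of S)" "y \<in> convex hull (vertices_of S)"
    using xy simplex_hull(3)[OF S] by auto
  have x: "?g \<bullet> x + 0 \<le> Q + ?g \<bullet> L" if L: "L \<in> vertices_of S" for L
  proof (rule affine_le_on_convex_hull[OF _ xyc(1)])
    fix K assume "K \<in> vertices_of S"
    from *[OF this L] show "?g \<bullet> K + 0 \<le> Q + ?g \<bullet> L" by simp
  qed
  have "(- ?g) \<bullet> y + 0 \<le> Q - ?g \<bullet> x"
  proof (rule affine_le_on_convex_hull[OF _ xyc(2)])
    fix L assume "L \<in> vertices_of S"
    from x[OF this] show "(- ?g) \<bullet> L + 0 \<le> Q - ?g \<bullet> x" by simp
  qed
  then show ?thesis by (simp add: inner_diff_right)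
qed

lemma inradius_bound:
  assumes "S \<in> \<T>" "ball x r \<subseteq> S" "0 < r"
  shows "r \<le> diameter S"
proof -
  have "diameter (ball x r) \<le> diameter S" by (rule diameter_subset[OF assms(2) bounded_simplex[OF assms(1)]])
  then show ?thesis using assms(3) by (simp add: diameter_ball)
qed

lemma inradius_pos: assumes "S \<in> \<T>" shows "0 < inradius S" "0 < diameter S"
proof -
  obtain x where "x \<in> S" using simplex_hull(5)[OF assms] by auto
  then obtain r where r: "r > 0" "ball x r \<subseteq> S" using simplex_hull(4)[OF assms] open_contains_ball by blast
  have "r \<le> inradius S"
    unfolding inradius_def
    by (rule cSup_upper) (use r inradius_bound[OF assms] in \<open>auto intro!: bdd_aboveI[of _ "diameter S"]\<close>)
  then show "0 < inradius S" using r by simp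
  show "0 < diameter S" using inradius_bound[OF assms r(2,1)] r by simp
qed

text \<open>An inscribed ball of radius r contains, up to closure, two opposite points in the
  direction of the gradient g. Between them the interpolant changes by 2 r |g|, but on the simplex
  it changes by no more than the largest difference of nodal values.\<close>

lemma grad_on_inradius:
  assumes S: "S \<in> \<T>"
  shows "2 * inradius S * norm (grad_on (interp \<T> v) S) \<le> sqrt (\<Sum>E\<in>edges_of S. sqdiff v E)" (is "_ \<le> ?Q")
proof (cases "grad_on (interp \<T> v) S = 0")
  case True
  then show ?thesis using sqdiff_nonneg by (auto intro!: sum_nonneg)
next
  case False
  define g where "g = grad_on (interp \<T> v) S"
  have g: "norm g > 0" using False by (simp add: g_def)
  have "r \<le> ?Q / (2 * norm g)" if r: "0 < r" "ball x r \<subseteq> S" for r x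
  proof -
    have "cball x r \<subseteq> closure S" using r closure_mono[OF r(2)] by simp
    moreover have "x + (r / norm g) *\<^sub>R g \<in> cball x r" "x - (r / norm g) *\<^sub>R g \<in> cball x r"
      using r g by (auto simp: dist_norm)
    ultimately have "x + (r / norm g) *\<^sub>R g \<in> closure S" "x - (r / norm g) *\<^sub>R g \<in> closure S" by auto
    from interp_diff_le[OF S this, of v ?Q] vertex_diff_le[OF S]
    have "g \<bullet> ((2 * r / norm g) *\<^sub>R g) \<le> ?Q" by (simp add: g_def flip: scaleR_left_distrib)
    moreover have "g \<bullet> ((2 * r / norm g) *\<^sub>R g) = 2 * r * norm g"
      using g by (simp add: dot_square_norm power2_eq_square)
    ultimately show ?thesis using g by (simp add: field_simps)
  qed
  then have "inradius S \<le> ?Q / (2 * norm g)"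
    unfolding inradius_def using inradius_pos[OF S] simplex_hull(4,5)[OF S]
    by (intro cSup_least) (auto, meson all_not_in_conv open_contains_ball)
  then show ?thesis using g by (simp add: g_def[symmetric] field_simps)
qed

text \<open>The reverse of the inequality defining \<open>Cmin\<close>; the factor 4 comes from the
  diameter of the inscribed ball being twice its radius.\<close>

lemma grad_on_regularity:
  assumes S: "S \<in> \<T>" and \<theta>: "mesh_regularity \<T> \<le> \<theta>"
  shows "4 * (diameter S)\<^sup>2 * (norm (grad_on (interp \<T> v) S))\<^sup>2 \<le> \<theta>\<^sup>2 * (\<Sum>E\<in>edges_of S. sqdiff v E)"
proof -
  let ?g = "norm (grad_on (interp \<T> v) S)" and ?Q = "\<Sum>E\<in>edges_of S. sqdiff v E"
  have Q: "0 \<le> ?Q" using sqdiff_nonneg by (auto intro!: sum_nonneg)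
  have "diameter S / inradius S \<le> mesh_regularity \<T>"
    unfolding mesh_regularity_def using S finite_mesh by (intro Max_ge) auto
  then have ratio: "diameter S / inradius S \<le> \<theta>" using \<theta> by simp
  have "0 < diameter S / inradius S" using inradius_pos[OF S] by simp
  then have d: "diameter S \<le> \<theta> * inradius S" "0 \<le> \<theta>"
    using ratio inradius_pos(1)[OF S] by (simp add: pos_divide_le_eq, linarith)
  have "2 * diameter S * ?g \<le> 2 * (\<theta> * inradius S) * ?g" using d by (intro mult_right_mono) auto
  also have "\<dots> = \<theta> * (2 * inradius S * ?g)" by simp
  also have "\<dots> \<le> \<theta> * sqrt ?Q" by (rule mult_left_mono[OF grad_on_inradius[OF S] d(2)])
  finally have "(2 * diameter S * ?g)\<^sup>2 \<le> (\<theta> * sqrt ?Q)\<^sup>2"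
    using inradius_pos[OF S] by (intro power_mono) auto
  then show ?thesis using Q by (simp add: power_mult_distrib)
qed

section \<open>Nodal functions and dual cells\<close>

lemma nodal_basis_on:
  assumes S: "S \<in> \<T>" and x: "x \<in> closure S"
  shows "0 \<le> nodal_basis \<T> K x" "K \<notin> vertices_of S \<Longrightarrow> nodal_basis \<T> K x = 0"
proof -
  let ?v = "\<lambda>L. if L = K then 1 else 0 :: real"
  let ?g = "grad_on (interp \<T> ?v) S"
  obtain b where b: "\<forall>L\<in>vertices_of S. ?v L = ?g \<bullet> L + b" "\<forall>x\<in>closure S. interp \<T> ?v x = ?g \<bullet> x + b"
    using interp_affine[OF S, of ?v] by (elim exE conjE)
  have xc: "x \<in> convex hull (vertices_of S)" using x simplex_hull(3)[OF S] by simp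
  have "(- ?g) \<bullet> L + (- b) \<le> 0" if "L \<in> vertices_of S" for L
  proof -
    have "0 \<le> ?v L" by simp
    then have "0 \<le> ?g \<bullet> L + b" unfolding b(1)[rule_format, OF that] .
    then show ?thesis by simp
  qed
  from affine_le_on_convex_hull[OF this xc] show "0 \<le> nodal_basis \<T> K x"
    using b(2) x by (simp add: nodal_basis_def)
  assume K: "K \<notin> vertices_of S"
  have "?g \<bullet> L + b = 0 \<bullet> L + 0" if "L \<in> vertices_of S" for L
    using b(1)[rule_format, OF that] K that by (auto split: if_splits)
  from affine_eq_on_convex_hull[OF this xc] show "nodal_basis \<T> K x = 0"
    using b(2) x by (simp add: nodal_basis_def)
qed

text \<open>Otherwise the nodal function of \<open>K\<close> vanishes at \<open>x\<close>, while
  those of the vertices of \<open>S\<close> are nonnegative there, contradicting strict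
  dominance.\<close>

lemma dual_cell_vertex:
  assumes S: "S \<in> \<T>" and x: "x \<in> closure S" "x \<in> dual_cell \<Omega> \<T> K"
  shows "K \<in> vertices_of S"
proof (rule ccontr)
  assume K: "K \<notin> vertices_of S"
  obtain L where L: "L \<in> vertices_of S" using vertices_of_nonempty[OF S] by auto
  then have "nodal_basis \<T> L x < nodal_basis \<T> K x"
    using x(2) K vertices_of_subset[OF S] by (auto simp: dual_cell_def)
  then show False using nodal_basis_on[OF S x(1)] K by (metis not_le)
qed

lemma dual_cell_subset: "dual_cell \<Omega> \<T> K \<subseteq> \<Omega>"
  by (auto simp: dual_cell_def)

lemma disjoint_dual_cells: "disjoint_family_on (dual_cell \<Omega> \<T>) (mesh_vertices \<T>)"
  unfolding disjoint_family_on_def dual_cell_def by fastforce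

lemma mesh_closure: "(\<Union>S\<in>\<T>. closure S) = closure \<Omega>"
  using mesh by (simp add: simplicial_mesh_def)

lemma disjoint_mesh: "disjoint_family_on (\<lambda>S. S) \<T>"
  using mesh by (auto simp: simplicial_mesh_def disjoint_family_on_def pairwise_def disjnt_def)

end

section \<open>Decomposition of the domain up to null sets\<close>

locale domain_mesh = mesh \<Omega> \<T> for \<Omega> :: "(real^'d::finite) set" and \<T> +
  assumes domain: "polytopal_domain \<Omega>"
begin

lemma open_domain: "open \<Omega>" and bounded_domain: "bounded \<Omega>"
  using domain by (auto simp: polytopal_domain_def)

lemma domain_sets [measurable]: "\<Omega> \<in> sets lebesgue" "\<Omega> \<in> sets borel"
  using open_domain by auto

lemma open_dual_cell: "open (dual_cell \<Omega> \<T> K)"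
proof -
  have c: "continuous_on \<Omega> (nodal_basis \<T> L)" for L
    using interp_P1 mesh_closure closure_subset[of \<Omega>] unfolding nodal_basis_def P1_space_def
    by (auto intro: continuous_on_subset)
  have "dual_cell \<Omega> \<T> K = \<Omega> \<inter> (\<Inter>L\<in>mesh_vertices \<T> - {K}. \<Omega> \<inter> (\<lambda>x. nodal_basis \<T> K x - nodal_basis \<T> L x) -` {0<..})"
    by (auto simp: dual_cell_def)
  also have "open \<dots>"
    using finite_mesh_vertices open_domain c
    by (intro open_Int open_INT ballI continuous_open_preimage continuous_intros) auto
  finally show ?thesis .
qed

lemma dual_cell_sets: "dual_cell \<Omega> \<T> K \<in> sets lebesgue" "dual_cell \<Omega> \<T> K \<in> sets borel"
  using open_dual_cell by auto

lemma simplex_subset_domain: "S \<in> \<T> \<Longrightarrow> S \<subseteq> \<Omega>"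
  using lipschitz_boundary_subset[of \<Omega> S] domain simplex_hull(4) mesh_closure closure_subset[of S]
  unfolding polytopal_domain_def by blast

lemma bounded_fmeasurable: "A \<in> sets lebesgue \<Longrightarrow> A \<subseteq> \<Omega> \<Longrightarrow> A \<in> lmeasurable"
  using bounded_domain bounded_set_imp_lmeasurable bounded_subset by blast

text \<open>The closed simplices cover \<Omega>, and what they add to the open ones are frontiers of
  convex sets, hence null.\<close>

lemma AE_mesh_cover: "AE x in lebesgue. x \<in> \<Omega> \<longrightarrow> (\<exists>S\<in>\<T>. x \<in> S)"
proof -
  have "negligible (closure S - S)" if "S \<in> \<T>" for S
  proof -
    have "convex (closure S)" using simplex_hull(3)[OF that] by simp
    then have "negligible (frontier (closure S))" by (rule negligible_convex_frontier)
    moreover have "frontier (closure S) = closure S - S"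
      using simplex_hull(6)[OF that] by (simp add: frontier_def)
    ultimately show ?thesis by simp
  qed
  then have "negligible (\<Union>S\<in>\<T>. closure S - S)"
    using finite_mesh by (intro negligible_Union) auto
  then have "AE x in lebesgue. x \<notin> (\<Union>S\<in>\<T>. closure S - S)"
    by (intro AE_not_in) (simp add: negligible_iff_null_sets)
  then show ?thesis
  proof eventually_elim
    case (elim x)
    show ?case
    proof
      assume "x \<in> \<Omega>"
      then have "x \<in> closure \<Omega>" using closure_subset by blast
      then have "x \<in> (\<Union>S\<in>\<T>. closure S)" unfolding mesh_closure .
      then obtain S where "S \<in> \<T>" "x \<in> closure S" by (rule UN_E)
      with elim show "\<exists>S\<in>\<T>. x \<in> S" by (intro bexI[of _ S]) simp_all
    qed
  qed
qed

lemma AE_indicator_domain: "AE x in lebesgue. indicator \<Omega> x = (\<Sum>S\<in>\<T>. indicator S x :: real)"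
  using AE_mesh_cover
proof eventually_elim
  case (elim x)
  show ?case
  proof (cases "x \<in> \<Omega>")
    case True
    then obtain S where S: "S \<in> \<T>" "x \<in> S" using elim by auto
    have "(\<Sum>S'\<in>\<T>. indicator S' x :: real) = (\<Sum>S'\<in>\<T>. if S' = S then 1 else 0)"
      using S disjoint_mesh by (intro sum.cong) (auto simp: indicator_def disjoint_family_on_def)
    then show ?thesis using True S finite_mesh by simp
  next
    case False
    then have "x \<notin> S" if "S \<in> \<T>" for S using simplex_subset_domain[OF that] by auto
    then show ?thesis using False by (simp add: indicator_def)
  qed
qed

lemma sum_vol_dual_cells: "(\<Sum>K\<in>mesh_vertices \<T>. vol (dual_cell \<Omega> \<T> K)) \<le> vol \<Omega>"
proof -
  have "(\<Sum>K\<in>mesh_vertices \<T>. vol (dual_cell \<Omega> \<T> K)) = vol (\<Union>K\<in>mesh_vertices \<T>. dual_cell \<Omega> \<T> K)"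
    using finite_mesh_vertices disjoint_dual_cells dual_cell_sets bounded_fmeasurable[OF dual_cell_sets(1) dual_cell_subset]
    by (intro measure_finite_Union[symmetric]) (auto simp: fmeasurable_def top.not_eq_extremum)
  also have "\<dots> \<le> vol \<Omega>"
    using dual_cell_subset dual_cell_sets finite_mesh_vertices bounded_fmeasurable[of \<Omega>] domain_sets
    by (intro measure_mono_fmeasurable sets.finite_UN) auto
  finally show ?thesis .
qed

end

section \<open>Energy bound for the electric potential\<close>

text \<open>The Dirichlet energy, written with elementwise gradients so that it makes sense before
  any weak gradient is known.\<close>

definition energy :: "(real^'d::finite) set set \<Rightarrow> (real^'d \<Rightarrow> real) \<Rightarrow> real" where
  "energy \<T> w = (\<Sum>S\<in>\<T>. vol S * (norm (grad_on w S))\<^sup>2)"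

lemma energy_nonneg: "0 \<le> energy \<T> w"
  by (auto simp: energy_def intro!: sum_nonneg)

lemma L2_norm_square: "(L2_norm A f)\<^sup>2 = integral\<^sup>L (lebesgue_on A) (\<lambda>x. (norm (f x))\<^sup>2)"
  unfolding L2_norm_def by (intro real_sqrt_pow2 integral_nonneg_AE) auto

lemma L2_norm_nonneg: "0 \<le> L2_norm A f"
  unfolding L2_norm_def by (intro real_sqrt_ge_zero integral_nonneg_AE) auto

lemma measurable_indicator_mult:
  fixes f :: "'a::euclidean_space \<Rightarrow> real"
  assumes "A \<in> sets lebesgue" "f \<in> borel_measurable (lebesgue_on A)"
  shows "(\<lambda>x. indicator A x * f x) \<in> borel_measurable lebesgue"
  using borel_measurable_restrict_space_iff[of A lebesgue f] assms by simp

context domain_mesh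
begin

text \<open>\<open>weak_grad\<close> is an arbitrary choice, but any admissible choice agrees almost
  everywhere with the elementwise gradient, simplex by simplex.\<close>

lemma weak_grad_P1:
  assumes "w \<in> P1_space \<T>" "w \<in> H1 \<Omega>"
  shows "in_L2 \<Omega> (weak_grad \<Omega> w)"
    "AE x in lebesgue. \<forall>S\<in>\<T>. x \<in> S \<longrightarrow> weak_grad \<Omega> w x = grad_on w S"
proof -
  have "\<exists>g. in_L2 \<Omega> g \<and> has_weak_grad \<Omega> w g" using assms(2) by (simp add: H1_def)
  then have G: "in_L2 \<Omega> (weak_grad \<Omega> w) \<and> has_weak_grad \<Omega> w (weak_grad \<Omega> w)"
    unfolding weak_grad_def by (rule someI_ex)
  then show "in_L2 \<Omega> (weak_grad \<Omega> w)" by simp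
  have "AE x in lebesgue. x \<in> S \<longrightarrow> weak_grad \<Omega> w x = grad_on w S" if S: "S \<in> \<T>" for S
  proof -
    obtain b where b: "\<forall>x\<in>closure S. w x = grad_on w S \<bullet> x + b"
      using P1_on_closure[OF assms(1) S] by (elim exE)
    have "w x = grad_on w S \<bullet> x + b" if "x \<in> S" for x
      using b that closure_subset[of S] by (simp add: subset_iff)
    from weak_grad_affine[OF open_domain bounded_domain simplex_hull(4)[OF S] simplex_subset_domain[OF S] this]
    show ?thesis using G by simp
  qed
  then show "AE x in lebesgue. \<forall>S\<in>\<T>. x \<in> S \<longrightarrow> weak_grad \<Omega> w x = grad_on w S"
    using finite_mesh by (intro AE_finite_allI) auto
qed

lemma integral_simplices:
  fixes F :: "real^'d \<Rightarrow> real"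
  assumes "F \<in> borel_measurable (lebesgue_on \<Omega>)" "AE x in lebesgue. \<forall>S\<in>\<T>. x \<in> S \<longrightarrow> F x = c S"
  shows "integral\<^sup>L (lebesgue_on \<Omega>) F = (\<Sum>S\<in>\<T>. vol S * c S)"
proof -
  have S: "S \<in> sets lebesgue" "S \<in> lmeasurable" if "S \<in> \<T>" for S
    using simplex_hull(4)[OF that] bounded_fmeasurable[of S] simplex_subset_domain[OF that] by auto
  have "integral\<^sup>L (lebesgue_on \<Omega>) F = integral\<^sup>L lebesgue (\<lambda>x. indicator \<Omega> x * F x)"
    by (rule integral_lebesgue_on[OF domain_sets(1)])
  also have "\<dots> = integral\<^sup>L lebesgue (\<lambda>x. \<Sum>S\<in>\<T>. c S * indicator S x)"
  proof (rule integral_cong_AE)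
    show "(\<lambda>x. indicator \<Omega> x * F x) \<in> borel_measurable lebesgue"
      by (rule measurable_indicator_mult[OF domain_sets(1) assms(1)])
    show "(\<lambda>x. \<Sum>S\<in>\<T>. c S * indicator S x) \<in> borel_measurable lebesgue"
      using S by (intro borel_measurable_sum borel_measurable_times borel_measurable_indicator) auto
    show "AE x in lebesgue. indicator \<Omega> x * F x = (\<Sum>S\<in>\<T>. c S * indicator S x)"
      using assms(2) AE_indicator_domain
    proof eventually_elim
      case (elim x)
      have "indicator S x * F x = c S * indicator S x" if "S \<in> \<T>" for S
        using elim(1) that by (auto simp: indicator_def)
      then show ?case unfolding elim(2) sum_distrib_right by (rule sum.cong[OF refl])
    qed
  qed
  also have "\<dots> = (\<Sum>S\<in>\<T>. vol S * c S)"
    using S(2) by (subst Bochner_Integration.integral_sum)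
      (auto simp: lmeasurable_iff_integrable mult.commute intro!: integrable_mult_right)
  finally show ?thesis .
qed

lemma L2_weak_grad:
  assumes "w \<in> P1_space \<T>" "w \<in> H1 \<Omega>"
  shows "(L2_norm \<Omega> (weak_grad \<Omega> w))\<^sup>2 = energy \<T> w"
  unfolding L2_norm_square energy_def
proof (rule integral_simplices)
  show "(\<lambda>x. (norm (weak_grad \<Omega> w x))\<^sup>2) \<in> borel_measurable (lebesgue_on \<Omega>)"
    using weak_grad_P1(1)[OF assms] by (auto simp: in_L2_def)
  show "AE x in lebesgue. \<forall>S\<in>\<T>. x \<in> S \<longrightarrow> (norm (weak_grad \<Omega> w x))\<^sup>2 = (norm (grad_on w S))\<^sup>2"
    using weak_grad_P1(2)[OF assms] by eventually_elim simp
qed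

text \<open>A point of \<open>S\<close> in the dual cell of \<open>K\<close> makes \<open>K\<close>
  a vertex of \<open>S\<close>, so both lie where \<open>w\<close> is affine. Their distance is
  bounded by the diameter of \<Omega> rather than of \<open>S\<close>; this keeps the constant free
  of the mesh size.\<close>

lemma nodal_value_diff:
  assumes w: "w \<in> P1_space \<T>" and S: "S \<in> \<T>" "x \<in> S" "x \<in> dual_cell \<Omega> \<T> K"
  shows "\<bar>w K\<bar> \<le> \<bar>w x\<bar> + diameter \<Omega> * norm (grad_on w S)"
proof -
  have xc: "x \<in> closure S" using S closure_subset by blast
  have K: "K \<in> closure S" using dual_cell_vertex[OF S(1) xc S(3)] vertices_of_subset_closure[OF S(1)] by blast
  obtain b where b: "\<forall>x\<in>closure S. w x = grad_on w S \<bullet> x + b"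
    using P1_on_closure[OF w S(1)] by (elim exE)
  have "w K - w x = grad_on w S \<bullet> (K - x)" using b K xc by (simp add: inner_diff_right)
  then have "\<bar>w K - w x\<bar> \<le> norm (grad_on w S) * norm (K - x)" using Cauchy_Schwarz_ineq2 by metis
  also have "\<dots> \<le> norm (grad_on w S) * diameter \<Omega>"
  proof (rule mult_left_mono)
    have "K \<in> closure \<Omega>" "x \<in> closure \<Omega>" using K xc S(1) mesh_closure by auto
    then have "dist K x \<le> diameter (closure \<Omega>)" using bounded_domain by (intro diameter_bounded_bound) auto
    then show "norm (K - x) \<le> diameter \<Omega>" using diameter_closure[OF bounded_domain] by (simp add: dist_norm)
  qed simp
  finally show ?thesis by (simp add: mult.commute)
qed

lemma integrable_L2_product:
  assumes "in_L2 \<Omega> (f :: real^'d \<Rightarrow> real)"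
  shows "integrable (lebesgue_on \<Omega>) f" "integrable (lebesgue_on \<Omega>) (\<lambda>x. (f x)\<^sup>2)"
proof -
  show f2: "integrable (lebesgue_on \<Omega>) (\<lambda>x. (f x)\<^sup>2)" using assms by (simp add: in_L2_def)
  have 1: "integrable (lebesgue_on \<Omega>) (\<lambda>x. 1::real)"
    using bounded_fmeasurable[of \<Omega>] domain_sets by (simp add: integrable_lebesgue_on integrable_real_indicator fmeasurable_def)
  show "integrable (lebesgue_on \<Omega>) f"
  proof (rule Bochner_Integration.integrable_bound)
    show "integrable (lebesgue_on \<Omega>) (\<lambda>x. 1 + (f x)\<^sup>2)" using 1 f2 by simp
    show "f \<in> borel_measurable (lebesgue_on \<Omega>)" using assms by (simp add: in_L2_def)
    have "\<bar>y\<bar> \<le> 1 + y\<^sup>2" for y :: real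
    proof -
      have "0 \<le> (\<bar>y\<bar> - 1)\<^sup>2" by simp
      then have "2 * \<bar>y\<bar> \<le> 1 + y\<^sup>2" by (simp add: power2_diff)
      then show ?thesis using abs_ge_zero[of y] by linarith
    qed
    then show "AE x in lebesgue_on \<Omega>. norm (f x) \<le> norm (1 + (f x)\<^sup>2)"
      by (intro AE_I2) (simp add: abs_of_nonneg add_nonneg_nonneg)
  qed
qed

text \<open>On a dual cell the nodal value differs from the P1 function by at most the diameter times the
  gradient; thus mass lumping is controlled by the energy without any quadrature formula.\<close>

lemma load_bound:
  assumes w: "w \<in> P1_space \<T>" "w \<in> H1 \<Omega>" and f: "in_L2 \<Omega> f"
    and \<rho>: "\<And>K. K \<in> mesh_vertices \<T> \<Longrightarrow> \<bar>\<rho> K\<bar> \<le> Z"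
    and P: "L2_norm \<Omega> w \<le> CP * L2_norm \<Omega> (weak_grad \<Omega> w)" and \<eta>: "\<eta> > 0"
  shows "(\<Sum>K\<in>mesh_vertices \<T>. w K * (vol (dual_cell \<Omega> \<T> K) * \<rho> K + integral\<^sup>L (lebesgue_on (dual_cell \<Omega> \<T> K)) f))
    \<le> (Z\<^sup>2 * vol \<Omega> + (L2_norm \<Omega> f)\<^sup>2) / \<eta> + \<eta> * (CP\<^sup>2 + (diameter \<Omega>)\<^sup>2) * energy \<T> w"
proof -
  let ?V = "mesh_vertices \<T>" and ?D = "dual_cell \<Omega> \<T>" and ?G = "weak_grad \<Omega> w" and ?\<delta> = "diameter \<Omega>"
  let ?ll = "\<lambda>x. indicator \<Omega> x * f x"
  have fin: "integrable lebesgue ?ll"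
    using integrable_L2_product(1)[OF f] by (simp add: integrable_lebesgue_on[OF domain_sets(1)])
  have Df: "integrable lebesgue (\<lambda>x. indicator (?D K) x * f x)" for K
  proof -
    have "integrable lebesgue (\<lambda>x. indicator (?D K) x * ?ll x)"
      using integrable_mult_indicator[OF dual_cell_sets(1) fin, of K] by simp
    also have "(\<lambda>x. indicator (?D K) x * ?ll x) = (\<lambda>x. indicator (?D K) x * f x)"
      using dual_cell_subset[of K] by (auto simp: indicator_def fun_eq_iff)
    finally show ?thesis .
  qed
  have D1: "integrable lebesgue (\<lambda>x. indicator (?D K) x :: real)" for K
    using bounded_fmeasurable[OF dual_cell_sets(1) dual_cell_subset, of K] by (simp add: lmeasurable_iff_integrable)
  \<comment> \<open>Writes the nodal load as one integral: on the dual cell of \<open>K\<close> the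
    integrand is \<open>w K * (\<rho> K + f x)\<close>, and elsewhere it is 0.\<close>
  define H where "H x = (\<Sum>K\<in>?V. w K * (\<rho> K * indicator (?D K) x + indicator (?D K) x * f x))" for x
  have Hint: "integrable lebesgue H" unfolding H_def using Df D1 by (intro Bochner_Integration.integrable_sum) simp
  have sum_eq: "(\<Sum>K\<in>?V. w K * (vol (?D K) * \<rho> K + integral\<^sup>L (lebesgue_on (?D K)) f)) = integral\<^sup>L lebesgue H"
    unfolding H_def using Df D1 dual_cell_sets
    by (subst Bochner_Integration.integral_sum) (auto simp: integral_lebesgue_on mult.commute intro!: sum.cong)
  \<comment> \<open>The pointwise majorant of \<open>H\<close>: Young's inequality with weight
    \<eta> for the product of |w| + diameter |G| and Z + |f|. Splitting the squares of these sums
    costs a factor 2, which cancels the 1/2 in Young's inequality.\<close>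
  define R where "R x = (Z\<^sup>2 + (f x)\<^sup>2) / \<eta> + \<eta> * ((w x)\<^sup>2 + ?\<delta>\<^sup>2 * (norm (?G x))\<^sup>2)" for x
  have G2: "integrable (lebesgue_on \<Omega>) (\<lambda>x. (norm (?G x))\<^sup>2)"
    using weak_grad_P1(1)[OF w] by (simp add: in_L2_def)
  have wL2: "in_L2 \<Omega> w" using w(2) by (simp add: H1_def)
  have 1: "integrable (lebesgue_on \<Omega>) (\<lambda>x. 1::real)" "integral\<^sup>L (lebesgue_on \<Omega>) (\<lambda>x. 1::real) = vol \<Omega>"
    using bounded_fmeasurable[of \<Omega>] domain_sets by (auto simp: integral_lebesgue_on integrable_lebesgue_on integrable_real_indicator fmeasurable_def measure_restrict_space)
  have Rint: "integrable (lebesgue_on \<Omega>) R"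
    unfolding R_def using G2 integrable_L2_product(2)[OF f] integrable_L2_product(2)[OF wL2] integrable_mult_right[OF 1(1), of "Z\<^sup>2"] by simp
  have "integral\<^sup>L lebesgue H \<le> integral\<^sup>L lebesgue (\<lambda>x. indicator \<Omega> x * R x)"
  proof (rule integral_mono_AE[OF Hint])
    show "integrable lebesgue (\<lambda>x. indicator \<Omega> x * R x)"
      using Rint by (simp add: integrable_lebesgue_on[OF domain_sets(1)])
    show "AE x in lebesgue. H x \<le> indicator \<Omega> x * R x"
      using AE_mesh_cover weak_grad_P1(2)[OF w]
    proof eventually_elim
      case (elim x)
      have R0: "0 \<le> R x" using \<eta> by (simp add: R_def)
      show ?case
      proof (cases "\<exists>K\<in>?V. x \<in> ?D K")
        case False
        then have "H x = 0" unfolding H_def by (intro sum.neutral) (simp add: indicator_def)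
        then show ?thesis using R0 by (simp add: indicator_def)
      next
        case True
        then obtain K where K: "K \<in> ?V" "x \<in> ?D K" by (rule bexE)
        then have x\<Omega>: "x \<in> \<Omega>" using dual_cell_subset by blast
        then obtain S where S: "S \<in> \<T>" "x \<in> S" using elim(1) by (elim impE bexE)
        have "x \<notin> ?D L" if "L \<in> ?V" "L \<noteq> K" for L
          using disjoint_dual_cells K that unfolding disjoint_family_on_def by blast
        then have "H x = (\<Sum>L\<in>?V. if L = K then w K * (\<rho> K + f x) else 0)"
          unfolding H_def using K by (intro sum.cong) (auto simp: indicator_def)
        then have H: "H x = w K * (\<rho> K + f x)" using K finite_mesh_vertices by simp
        have wK: "\<bar>w K\<bar> \<le> \<bar>w x\<bar> + ?\<delta> * norm (?G x)"
          using nodal_value_diff[OF w(1) S K(2)] elim(2) S by simp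
        define a where "a = \<bar>w x\<bar>"
        define b where "b = ?\<delta> * norm (?G x)"
        have ab: "0 \<le> a" "0 \<le> b" by (auto simp: a_def b_def diameter_ge_0[OF bounded_domain])
        have "H x \<le> \<bar>w K\<bar> * \<bar>\<rho> K + f x\<bar>" unfolding H abs_mult[symmetric] by simp
        also have "\<dots> \<le> (a + b) * (Z + \<bar>f x\<bar>)"
          using wK \<rho>[OF K(1)] ab by (intro mult_mono) (auto simp: a_def b_def)
        also have "\<dots> \<le> (Z\<^sup>2 + (f x)\<^sup>2) / \<eta> + \<eta> * (a\<^sup>2 + b\<^sup>2)"
        proof -
          have y: "s * t \<le> t\<^sup>2 / (2 * \<eta>) + \<eta> * s\<^sup>2 / 2" for s t :: real
          proof -
            have "0 \<le> (t - \<eta> * s)\<^sup>2 / (2 * \<eta>)" using \<eta> by simp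
            also have "\<dots> = t\<^sup>2 / (2 * \<eta>) + \<eta> * s\<^sup>2 / 2 - s * t"
              using \<eta> by (simp add: power2_diff divide_simps) (simp add: power2_eq_square algebra_simps)
            finally show ?thesis by simp
          qed
          have 2: "(s + t)\<^sup>2 \<le> 2 * (s\<^sup>2 + t\<^sup>2)" for s t :: real
            using sum_squares_bound[of s t] by (simp add: power2_sum)
          have "(a + b) * (Z + \<bar>f x\<bar>) \<le> (Z + \<bar>f x\<bar>)\<^sup>2 / (2 * \<eta>) + \<eta> * (a + b)\<^sup>2 / 2" by (rule y)
          also have "\<dots> \<le> 2 * (Z\<^sup>2 + \<bar>f x\<bar>\<^sup>2) / (2 * \<eta>) + \<eta> * (2 * (a\<^sup>2 + b\<^sup>2)) / 2"
            using \<eta> by (intro add_mono divide_right_mono mult_left_mono 2) auto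
          also have "\<dots> = (Z\<^sup>2 + \<bar>f x\<bar>\<^sup>2) / \<eta> + \<eta> * (a\<^sup>2 + b\<^sup>2)"
          proof -
            have "2 * s / (2 * \<eta>) + \<eta> * (2 * t) / 2 = s / \<eta> + \<eta> * t" for s t :: real by simp
            then show ?thesis .
          qed
          finally show ?thesis by simp
        qed
        also have "\<dots> = R x" by (simp add: R_def a_def b_def power_mult_distrib)
        finally show ?thesis using x\<Omega> by simp
      qed
    qed
  qed
  also have "\<dots> = integral\<^sup>L (lebesgue_on \<Omega>) R" by (simp add: integral_lebesgue_on[OF domain_sets(1)])
  also have "\<dots> = (Z\<^sup>2 * vol \<Omega> + (L2_norm \<Omega> f)\<^sup>2) / \<eta> + \<eta> * ((L2_norm \<Omega> w)\<^sup>2 + ?\<delta>\<^sup>2 * (L2_norm \<Omega> ?G)\<^sup>2)"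
  proof -
    have i: "integrable (lebesgue_on \<Omega>) (\<lambda>x. Z\<^sup>2)" "integral\<^sup>L (lebesgue_on \<Omega>) (\<lambda>x. Z\<^sup>2) = Z\<^sup>2 * vol \<Omega>"
      using integrable_mult_right[OF 1(1), of "Z\<^sup>2"] 1(2) by (auto simp: mult.commute)
    have "integral\<^sup>L (lebesgue_on \<Omega>) R = (integral\<^sup>L (lebesgue_on \<Omega>) (\<lambda>x. Z\<^sup>2) + integral\<^sup>L (lebesgue_on \<Omega>) (\<lambda>x. (f x)\<^sup>2)) / \<eta>
        + \<eta> * (integral\<^sup>L (lebesgue_on \<Omega>) (\<lambda>x. (w x)\<^sup>2) + ?\<delta>\<^sup>2 * integral\<^sup>L (lebesgue_on \<Omega>) (\<lambda>x. (norm (?G x))\<^sup>2))"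
      unfolding R_def using G2 i(1) integrable_L2_product(2)[OF f] integrable_L2_product(2)[OF wL2] by simp
    then show ?thesis unfolding i(2) L2_norm_square by simp
  qed
  also have "\<dots> \<le> (Z\<^sup>2 * vol \<Omega> + (L2_norm \<Omega> f)\<^sup>2) / \<eta> + \<eta> * (CP\<^sup>2 * energy \<T> w + ?\<delta>\<^sup>2 * energy \<T> w)"
  proof -
    have "(L2_norm \<Omega> w)\<^sup>2 \<le> (CP * L2_norm \<Omega> ?G)\<^sup>2" by (rule power_mono[OF P L2_norm_nonneg])
    then show ?thesis using \<eta> by (simp add: power_mult_distrib L2_weak_grad[OF w])
  qed
  finally show ?thesis unfolding sum_eq by (simp add: algebra_simps)
qed

text \<open>The test function is the difference \<open>v\<close> of the potential and the lifting.
  It vanishes at Dirichlet vertices, exactly where the discrete Poisson equation is not imposed, and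
  it lies in \<open>H1D\<close>, so the Poincare inequality controls the load.\<close>

lemma potential_energy:
  assumes PC: "poincare_const \<Omega> \<Gamma>D CP" and CP: "CP > 0" and lam: "lam > 0"
    and V: "P1_space_D \<T> \<Gamma>D \<subseteq> H1D \<Omega> \<Gamma>D" and f: "in_L2 \<Omega> f"
    and \<psi>: "\<psi> \<in> P1_space \<T>" "\<psi> \<in> H1 \<Omega>" "H1_norm \<Omega> \<psi> \<le> C\<psi>"
    and \<rho>: "\<And>K. K \<in> mesh_vertices \<T> \<Longrightarrow> \<bar>\<rho> K\<bar> \<le> Z"
    and \<phi>: "\<And>K. K \<in> mesh_vertices \<T> \<Longrightarrow> K \<in> \<Gamma>D \<Longrightarrow> \<phi> K = \<psi> K"
    "\<And>K. K \<in> mesh_vertices \<T> \<Longrightarrow> K \<notin> \<Gamma>D \<Longrightarrow>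
       lam\<^sup>2 * (\<Sum>S\<in>simplices_at \<T> K. \<Sum>L\<in>vertices_of S. stiffness \<T> S K L * (\<phi> K - \<phi> L))
       = vol (dual_cell \<Omega> \<T> K) * \<rho> K + integral\<^sup>L (lebesgue_on (dual_cell \<Omega> \<T> K)) f"
  shows "energy \<T> (interp \<T> \<phi>)
    \<le> 16 * (Z\<^sup>2 * vol \<Omega> + (L2_norm \<Omega> f)\<^sup>2) * (CP\<^sup>2 + (diameter \<Omega>)\<^sup>2) / lam ^ 4 + 6 * C\<psi>\<^sup>2"
proof -
  define v where "v = interp \<T> (\<lambda>K. \<phi> K - \<psi> K)"
  define A where "A = Z\<^sup>2 * vol \<Omega> + (L2_norm \<Omega> f)\<^sup>2"
  define B where "B = CP\<^sup>2 + (diameter \<Omega>)\<^sup>2"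
  define q where "q = A * B / lam ^ 4"
  have B: "B > 0" unfolding B_def using CP by (simp add: add_pos_nonneg)
  have vP: "v \<in> P1_space \<T>" unfolding v_def by (rule interp_P1)
  have vK: "v K = \<phi> K - \<psi> K" if "K \<in> mesh_vertices \<T>" for K
    using interp_vertex[OF that] by (simp add: v_def)
  have v0: "v K = 0" if "K \<in> mesh_vertices \<T>" "K \<in> \<Gamma>D" for K
    using vK[OF that(1)] \<phi>(1)[OF that] by simp
  have "v \<in> P1_space_D \<T> \<Gamma>D" unfolding P1_space_D_def using vP v0 by auto
  then have vD: "v \<in> H1D \<Omega> \<Gamma>D" using V by blast
  then have vH: "v \<in> H1 \<Omega>" by (simp add: H1D_def)
  have P: "L2_norm \<Omega> v \<le> CP * L2_norm \<Omega> (weak_grad \<Omega> v)" using PC vD by (simp add: poincare_const_def)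
  have \<psi>E: "energy \<T> \<psi> \<le> C\<psi>\<^sup>2"
  proof -
    have "energy \<T> \<psi> \<le> (H1_norm \<Omega> \<psi>)\<^sup>2" unfolding H1_norm_def L2_weak_grad[OF \<psi>(1,2)] using energy_nonneg[of \<T> \<psi>] by simp
    also have "\<dots> \<le> C\<psi>\<^sup>2" by (rule power_mono[OF \<psi>(3)]) (simp add: H1_norm_def)
    finally show ?thesis .
  qed
  have g\<phi>: "grad_on (interp \<T> \<phi>) S = grad_on v S + grad_on \<psi> S" if "S \<in> \<T>" for S
    unfolding v_def using grad_on_interp_diff[OF that, of \<phi> \<psi>] interp_P1_space[OF \<psi>(1)] by simp
  have "lam\<^sup>2 * (\<Sum>S\<in>\<T>. vol S * (grad_on (interp \<T> \<phi>) S \<bullet> grad_on v S))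
      = lam\<^sup>2 * (\<Sum>S\<in>\<T>. \<Sum>K\<in>vertices_of S. \<Sum>L\<in>vertices_of S. stiffness \<T> S K L * (\<phi> K - \<phi> L) * v K)"
  proof (intro arg_cong[where f = "\<lambda>x. lam\<^sup>2 * x"] sum.cong refl)
    fix S assume S: "S \<in> \<T>"
    show "vol S * (grad_on (interp \<T> \<phi>) S \<bullet> grad_on v S)
      = (\<Sum>K\<in>vertices_of S. \<Sum>L\<in>vertices_of S. stiffness \<T> S K L * (\<phi> K - \<phi> L) * v K)"
      unfolding sum_stiffness[OF S] interp_P1_space[OF vP] ..
  qed
  also have "\<dots> = (\<Sum>K\<in>mesh_vertices \<T>. v K * (lam\<^sup>2 * (\<Sum>S\<in>simplices_at \<T> K. \<Sum>L\<in>vertices_of S. stiffness \<T> S K L * (\<phi> K - \<phi> L))))"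
    unfolding sum_vertices_simplices[symmetric] by (simp add: sum_distrib_left mult_ac)
  also have "\<dots> = (\<Sum>K\<in>mesh_vertices \<T>. v K * (vol (dual_cell \<Omega> \<T> K) * \<rho> K + integral\<^sup>L (lebesgue_on (dual_cell \<Omega> \<T> K)) f))"
  proof (intro sum.cong refl)
    fix K assume K: "K \<in> mesh_vertices \<T>"
    show "v K * (lam\<^sup>2 * (\<Sum>S\<in>simplices_at \<T> K. \<Sum>L\<in>vertices_of S. stiffness \<T> S K L * (\<phi> K - \<phi> L)))
      = v K * (vol (dual_cell \<Omega> \<T> K) * \<rho> K + integral\<^sup>L (lebesgue_on (dual_cell \<Omega> \<T> K)) f)"
      using v0[OF K] \<phi>(2)[OF K] by (cases "K \<in> \<Gamma>D") simp_all
  qed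
  \<comment> \<open>The weight \<open>lam\<^sup>2 / (4 * B)\<close> is chosen so that, after
    division by \<open>lam\<^sup>2\<close>, the load uses up one quarter of the energy of
    \<open>v\<close>.\<close>
  also have "\<dots> \<le> A / (lam\<^sup>2 / (4 * B)) + lam\<^sup>2 / (4 * B) * B * energy \<T> v"
    unfolding A_def B_def
    by (rule load_bound[OF vP vH f \<rho> P]) (use lam B in \<open>auto simp: B_def\<close>)
  also have "\<dots> = lam\<^sup>2 * (4 * q + energy \<T> v / 4)"
    using lam B by (simp add: q_def field_simps power2_eq_square power4_eq_xxxx)
  finally have 1: "(\<Sum>S\<in>\<T>. vol S * (grad_on (interp \<T> \<phi>) S \<bullet> grad_on v S)) \<le> 4 * q + energy \<T> v / 4"
    using lam by simp
  \<comment> \<open>Completing a square gives a second quarter to the cross term with the lifting.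
    Half of the energy of \<open>v\<close> remains, whence
    \<open>8 * q + 2 * C\<psi>\<^sup>2\<close> below; the bound for the sum of \<open>v\<close> and
    the lifting doubles this and adds twice the energy of the lifting.\<close>
  have "energy \<T> v * (3 / 4) - energy \<T> \<psi> \<le> (\<Sum>S\<in>\<T>. vol S * (grad_on (interp \<T> \<phi>) S \<bullet> grad_on v S))"
    unfolding energy_def sum_distrib_right sum_subtractf[symmetric]
  proof (rule sum_mono)
    fix S assume S: "S \<in> \<T>"
    let ?a = "grad_on v S" and ?b = "grad_on \<psi> S"
    have "0 \<le> (norm ((1/2) *\<^sub>R ?a + ?b))\<^sup>2" by simp
    also have "\<dots> = (norm ?a)\<^sup>2 / 4 + (?b \<bullet> ?a) + (norm ?b)\<^sup>2"
      unfolding power2_norm_eq_inner by (simp add: inner_add_left inner_add_right inner_commute)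
    finally have "(norm ?a)\<^sup>2 * (3 / 4) - (norm ?b)\<^sup>2 \<le> (?a + ?b) \<bullet> ?a"
      by (simp add: inner_add_left power2_norm_eq_inner)
    from mult_left_mono[OF this, of "vol S"]
    show "vol S * (norm ?a)\<^sup>2 * (3 / 4) - vol S * (norm ?b)\<^sup>2 \<le> vol S * (grad_on (interp \<T> \<phi>) S \<bullet> ?a)"
      unfolding g\<phi>[OF S] by (simp add: algebra_simps)
  qed
  then have 2: "energy \<T> v \<le> 8 * q + 2 * C\<psi>\<^sup>2" using 1 \<psi>E by linarith
  have "energy \<T> (interp \<T> \<phi>) \<le> 2 * energy \<T> v + 2 * energy \<T> \<psi>"
    unfolding energy_def sum_distrib_left sum.distrib[symmetric]
  proof (rule sum_mono)
    fix S assume S: "S \<in> \<T>"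
    let ?a = "grad_on v S" and ?b = "grad_on \<psi> S"
    have "0 \<le> (norm (?a - ?b))\<^sup>2" by simp
    then have "(norm (?a + ?b))\<^sup>2 \<le> 2 * (norm ?a)\<^sup>2 + 2 * (norm ?b)\<^sup>2"
      unfolding power2_norm_eq_inner by (simp add: inner_add_left inner_add_right inner_diff_left inner_diff_right inner_commute)
    from mult_left_mono[OF this, of "vol S"]
    show "vol S * (norm (grad_on (interp \<T> \<phi>) S))\<^sup>2 \<le> 2 * (vol S * (norm ?a)\<^sup>2) + 2 * (vol S * (norm ?b)\<^sup>2)"
      unfolding g\<phi>[OF S] by (simp add: algebra_simps)
  qed
  with 2 \<psi>E have "energy \<T> (interp \<T> \<phi>) \<le> 16 * q + 6 * C\<psi>\<^sup>2" by linarith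
  then show ?thesis unfolding q_def A_def B_def by (simp only: mult.assoc times_divide_eq_right)
qed

end

section \<open>Algebraic estimate along an edge\<close>

text \<open>Convexity: the increment is bounded by the slope at the larger argument.\<close>

lemma abs_exp_diff_le: "\<bar>exp x - exp y\<bar> \<le> max (exp x) (exp y) * \<bar>x - (y::real)\<bar>"
proof -
  have *: "exp a - exp b \<le> exp a * (a - b)" for a b :: real
  proof -
    have "1 + (b - a) \<le> exp (b - a)" by (rule exp_ge_add_one_self)
    then have "exp a * (1 + (b - a)) \<le> exp a * exp (b - a)" by (intro mult_left_mono) auto
    then show ?thesis by (simp add: exp_diff algebra_simps)
  qed
  show ?thesis using *[of x y] *[of y x] by (cases "x \<le> y") (auto simp: max_def)
qed

text \<open>Jensen's inequality for weights of total mass at most 1. The weights will be the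
  concentrations other than the solvent at one vertex, so no power of \<open>n\<close>
  enters.\<close>

lemma Cauchy_Schwarz_weighted:
  fixes w a :: "'i \<Rightarrow> real"
  assumes "\<And>i. i \<in> I \<Longrightarrow> 0 \<le> w i" "(\<Sum>i\<in>I. w i) \<le> 1"
  shows "(\<Sum>i\<in>I. w i * a i)\<^sup>2 \<le> (\<Sum>i\<in>I. w i * (a i)\<^sup>2)"
proof -
  have "(\<Sum>i\<in>I. w i * a i) = (\<Sum>i\<in>I. sqrt (w i) * (sqrt (w i) * a i))"
    using assms(1) by (intro sum.cong) (auto simp flip: mult.assoc)
  then have "(\<Sum>i\<in>I. w i * a i)\<^sup>2 \<le> (\<Sum>i\<in>I. (sqrt (w i))\<^sup>2) * (\<Sum>i\<in>I. (sqrt (w i) * a i)\<^sup>2)"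
    using Cauchy_Schwarz_ineq_sum[of "\<lambda>i. sqrt (w i)" "\<lambda>i. sqrt (w i) * a i" I] by simp
  also have "\<dots> = (\<Sum>i\<in>I. w i) * (\<Sum>i\<in>I. w i * (a i)\<^sup>2)"
    using assms(1) by (simp add: power_mult_distrib)
  also have "\<dots> \<le> 1 * (\<Sum>i\<in>I. w i * (a i)\<^sup>2)"
    using assms by (intro mult_right_mono sum_nonneg) auto
  finally show ?thesis by simp
qed

text \<open>Values \<open>p\<close>, \<open>q\<close> of the solvent concentration at both ends of an edge, for chemical potentials \<open>\<mu>\<close>, \<open>\<nu>\<close>.\<close>

locale edge_pair =
  fixes n :: nat and \<mu> \<nu> :: "nat \<Rightarrow> real" and p q :: real
  assumes p: "p = 1 / (1 + (\<Sum>j=1..n. exp (\<mu> j)))"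
    and q: "q = 1 / (1 + (\<Sum>j=1..n. exp (\<nu> j)))"
    and le: "q \<le> p"
begin

lemma pos: "0 < p" "0 < q"
  using p q by (auto intro!: add_pos_nonneg sum_nonneg)

lemma inverse_eq: "1 / p = 1 + (\<Sum>j=1..n. exp (\<mu> j))" "1 / q = 1 + (\<Sum>j=1..n. exp (\<nu> j))"
  using p q by auto

lemma sum_eq: "(\<Sum>j=1..n. p * exp (\<mu> j)) = 1 - p" "(\<Sum>j=1..n. q * exp (\<nu> j)) = 1 - q"
proof -
  have "p * (1 / p) = 1" "q * (1 / q) = 1" using pos by auto
  then show "(\<Sum>j=1..n. p * exp (\<mu> j)) = 1 - p" "(\<Sum>j=1..n. q * exp (\<nu> j)) = 1 - q"
    unfolding inverse_eq by (auto simp: sum_distrib_left algebra_simps)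
qed

lemma conc_le_1: "i \<in> {1..n} \<Longrightarrow> p * exp (\<mu> i) \<le> 1" "i \<in> {1..n} \<Longrightarrow> q * exp (\<nu> i) \<le> 1"
  using sum_eq pos member_le_sum[of i "{1..n}" "\<lambda>j. p * exp (\<mu> j)"] member_le_sum[of i "{1..n}" "\<lambda>j. q * exp (\<nu> j)"]
  by auto

lemma p_le_1: "p \<le> 1"
  using sum_eq(1) pos by (smt (verit) exp_gt_zero mult_pos_pos sum_nonneg)

text \<open>Only the species with \<open>\<nu> i > \<mu> i\<close> contribute to \<open>1 / q - 1 / p \<ge> 0\<close>; this is what makes
  the concentrations at the end with the smaller solvent concentration appear.\<close>

lemma sqrt_diff_square: "(sqrt p - sqrt q)\<^sup>2 \<le> (\<Sum>i=1..n. p * (q * exp (\<nu> i)) * (\<mu> i - \<nu> i)\<^sup>2)"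
proof -
  have "1 / q - 1 / p = (\<Sum>i=1..n. exp (\<nu> i) - exp (\<mu> i))"
    by (simp add: inverse_eq sum_subtractf)
  also have "\<dots> \<le> (\<Sum>i=1..n. exp (\<nu> i) * \<bar>\<mu> i - \<nu> i\<bar>)"
  proof (rule sum_mono)
    fix i
    show "exp (\<nu> i) - exp (\<mu> i) \<le> exp (\<nu> i) * \<bar>\<mu> i - \<nu> i\<bar>"
    proof (cases "\<mu> i \<le> \<nu> i")
      case True then show ?thesis using abs_exp_diff_le[of "\<nu> i" "\<mu> i"] by (auto simp: max_def abs_minus_commute split: if_splits)
    next
      case False
      then have "exp (\<nu> i) - exp (\<mu> i) \<le> 0" by simp
      also have "0 \<le> exp (\<nu> i) * \<bar>\<mu> i - \<nu> i\<bar>" by simp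
      finally show ?thesis .
    qed
  qed
  finally have "p * q * (1 / q - 1 / p) \<le> p * q * (\<Sum>i=1..n. exp (\<nu> i) * \<bar>\<mu> i - \<nu> i\<bar>)"
    using pos by (intro mult_left_mono) auto
  moreover have "p * q * (1 / q - 1 / p) = p - q" using pos by (simp add: field_simps)
  moreover define A where "A = (\<Sum>i=1..n. q * exp (\<nu> i) * \<bar>\<mu> i - \<nu> i\<bar>)"
  moreover have "q * (\<Sum>i=1..n. exp (\<nu> i) * \<bar>\<mu> i - \<nu> i\<bar>) = A" by (simp add: A_def sum_distrib_left mult.assoc)
  ultimately have pq: "p - q \<le> p * A" by (simp add: mult.assoc)
  have sq: "p - q = (sqrt p - sqrt q) * (sqrt p + sqrt q)" "p = sqrt p * sqrt p" "0 < sqrt p" "0 < sqrt q" "sqrt q \<le> sqrt p"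
    using pos le by (auto simp: algebra_simps)
  \<comment> \<open>Keeping only \<open>sqrt p\<close> of the factor \<open>sqrt p + sqrt q\<close>
    allows a division by \<open>sqrt p\<close>, which leaves a single factor \<open>p\<close> after
    squaring, as the weight on the right requires.\<close>
  have "(sqrt p - sqrt q) * sqrt p \<le> p - q"
    unfolding sq(1) using sq by (intro mult_left_mono) auto
  also have "\<dots> \<le> (sqrt p * A) * sqrt p" using pq sq(2) by (simp add: mult.commute mult.left_commute)
  finally have "sqrt p - sqrt q \<le> sqrt p * A" using sq(3) by (simp add: mult.commute)
  then have "(sqrt p - sqrt q)\<^sup>2 \<le> (sqrt p * A)\<^sup>2" using sq by (intro power_mono) auto
  also have "\<dots> = p * A\<^sup>2" using pos by (simp add: power_mult_distrib)
  also have "\<dots> \<le> p * (\<Sum>i=1..n. q * exp (\<nu> i) * \<bar>\<mu> i - \<nu> i\<bar>\<^sup>2)"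
    unfolding A_def using pos sum_eq(2) by (intro mult_left_mono Cauchy_Schwarz_weighted) auto
  finally show ?thesis by (simp add: sum_distrib_left mult.assoc)
qed

lemma diff_square: "(p - q)\<^sup>2 \<le> 4 * (sqrt p - sqrt q)\<^sup>2"
proof -
  have "(p - q)\<^sup>2 = (sqrt p - sqrt q)\<^sup>2 * (sqrt p + sqrt q)\<^sup>2"
    using pos by (simp flip: power_mult_distrib add: algebra_simps)
  also have "\<dots> \<le> (sqrt p - sqrt q)\<^sup>2 * 2\<^sup>2"
  proof (intro mult_left_mono power_mono)
    have "sqrt p \<le> 1" "sqrt q \<le> 1" using p_le_1 le by auto
    then show "sqrt p + sqrt q \<le> 2" by linarith
  qed (use pos in auto)
  finally show ?thesis by simp
qed

text \<open>With r and s the roots of \<open>p\<close> and \<open>q\<close>, the expressions are r^3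
  exp(\<mu> i) and s^3 exp(\<nu> i). The difference of the cubes is paired with exp(\<mu> i),
  because r^2 exp(\<mu> i) is a concentration and thus at most 1. The difference of the exponentials
  is paired with the smaller s^3, because s^2 times either exponential is at most one of the two
  concentrations. Squaring the sum of the two parts doubles each square; 18 is 2 times 3^2.\<close>

lemma product_diff:
  assumes i: "i \<in> {1..n}"
  shows "(p * exp (\<mu> i) * sqrt p - q * exp (\<nu> i) * sqrt q)\<^sup>2
    \<le> 18 * (sqrt p - sqrt q)\<^sup>2 + 2 * (q * (p * exp (\<mu> i) + q * exp (\<nu> i)) * (\<mu> i - \<nu> i)\<^sup>2)"
proof -
  let ?a = "p * exp (\<mu> i)" and ?b = "q * exp (\<nu> i)"
  define r s where "r = sqrt p" and "s = sqrt q"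
  have rs: "0 < s" "s \<le> r" "r \<le> 1" "p = r\<^sup>2" "q = s\<^sup>2" using pos le p_le_1 by (auto simp: r_def s_def)
  have ab: "0 \<le> ?a" "?a \<le> 1" "0 \<le> ?b" "?b \<le> 1" using conc_le_1[OF i] pos by auto
  have split: "?a * r - ?b * s = (r ^ 3 - s ^ 3) * exp (\<mu> i) + s ^ 3 * (exp (\<mu> i) - exp (\<nu> i))"
    unfolding rs(4,5) by (simp add: algebra_simps power2_eq_square power3_eq_cube)
  have "(r ^ 3 - s ^ 3) * exp (\<mu> i) \<le> 3 * (r - s)"
  proof -
    have "r ^ 3 - s ^ 3 = (r - s) * (r\<^sup>2 + r * s + s\<^sup>2)" by (simp add: algebra_simps power2_eq_square power3_eq_cube)
    also have "\<dots> \<le> (r - s) * (3 * r\<^sup>2)"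
    proof (rule mult_left_mono)
      have "r * s \<le> r\<^sup>2" "s\<^sup>2 \<le> r\<^sup>2" using rs by (auto simp: power2_eq_square intro: mult_mono)
      then show "r\<^sup>2 + r * s + s\<^sup>2 \<le> 3 * r\<^sup>2" by simp
    qed (use rs in auto)
    finally have "(r ^ 3 - s ^ 3) * exp (\<mu> i) \<le> (r - s) * (3 * r\<^sup>2) * exp (\<mu> i)"
      by (rule mult_right_mono) simp
    also have "\<dots> = 3 * (r - s) * ?a" by (simp add: rs(4))
    also have "\<dots> \<le> 3 * (r - s) * 1" using ab rs by (intro mult_left_mono) auto
    finally show ?thesis by simp
  qed
  moreover have "0 \<le> (r ^ 3 - s ^ 3) * exp (\<mu> i)" using rs by (auto intro!: power_mono)
  moreover have "\<bar>s ^ 3 * (exp (\<mu> i) - exp (\<nu> i))\<bar> \<le> s * max ?a ?b * \<bar>\<mu> i - \<nu> i\<bar>"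
  proof -
    have "\<bar>s ^ 3 * (exp (\<mu> i) - exp (\<nu> i))\<bar> \<le> s ^ 3 * (max (exp (\<mu> i)) (exp (\<nu> i)) * \<bar>\<mu> i - \<nu> i\<bar>)"
      using abs_exp_diff_le[of "\<mu> i" "\<nu> i"] rs by (simp add: abs_mult)
    also have "\<dots> = s * (q * max (exp (\<mu> i)) (exp (\<nu> i))) * \<bar>\<mu> i - \<nu> i\<bar>"
      by (simp add: rs(5) power2_eq_square power3_eq_cube)
    also have "\<dots> \<le> s * max ?a ?b * \<bar>\<mu> i - \<nu> i\<bar>"
    proof (intro mult_right_mono mult_left_mono)
      have "q * exp (\<mu> i) \<le> ?a" using le by (intro mult_right_mono) auto
      moreover have "max (exp (\<mu> i)) (exp (\<nu> i)) = exp (\<mu> i) \<or> max (exp (\<mu> i)) (exp (\<nu> i)) = exp (\<nu> i)"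
        by (simp add: max_def)
      ultimately show "q * max (exp (\<mu> i)) (exp (\<nu> i)) \<le> max ?a ?b"
        by (elim disjE) (simp_all only: le_max_iff_disj order.refl simp_thms)
    qed (use rs in auto)
    finally show ?thesis .
  qed
  ultimately have "\<bar>?a * r - ?b * s\<bar> \<le> 3 * (r - s) + s * max ?a ?b * \<bar>\<mu> i - \<nu> i\<bar>"
    unfolding split by linarith
  then have "(?a * r - ?b * s)\<^sup>2 \<le> (3 * (r - s) + s * max ?a ?b * \<bar>\<mu> i - \<nu> i\<bar>)\<^sup>2"
    by (meson abs_ge_zero abs_le_square_iff order_trans abs_ge_self)
  also have "\<dots> \<le> 2 * (3 * (r - s))\<^sup>2 + 2 * (s * max ?a ?b * \<bar>\<mu> i - \<nu> i\<bar>)\<^sup>2"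
    using sum_squares_bound[of "3 * (r - s)" "s * max ?a ?b * \<bar>\<mu> i - \<nu> i\<bar>"] by (simp add: power2_sum)
  also have "(s * max ?a ?b * \<bar>\<mu> i - \<nu> i\<bar>)\<^sup>2 = q * (max ?a ?b)\<^sup>2 * (\<mu> i - \<nu> i)\<^sup>2"
    by (simp add: power_mult_distrib rs(5))
  also have "\<dots> \<le> q * (?a + ?b) * (\<mu> i - \<nu> i)\<^sup>2"
  proof (intro mult_right_mono mult_left_mono)
    have "(max ?a ?b)\<^sup>2 \<le> max ?a ?b * 1" unfolding power2_eq_square using ab by (intro mult_left_mono) auto
    then show "(max ?a ?b)\<^sup>2 \<le> ?a + ?b" using ab by linarith
  qed (use pos in auto)
  finally have "(?a * r - ?b * s)\<^sup>2 \<le> 2 * (9 * (r - s)\<^sup>2) + 2 * (q * (?a + ?b) * (\<mu> i - \<nu> i)\<^sup>2)"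
    unfolding power_mult_distrib[of 3] by simp
  then show ?thesis by (simp add: r_def s_def)
qed

end

section \<open>Entropy\<close>

lemma mult_ln_bounds:
  assumes "0 \<le> x" "x \<le> (1::real)"
  shows "- 1 \<le> x * ln x" "x * ln x \<le> 0"
proof -
  show "x * ln x \<le> 0" using assms by (cases "x = 0") (auto simp: mult_nonneg_nonpos)
  show "- 1 \<le> x * ln x"
  proof (cases "x = 0")
    case False
    then have x: "0 < x" using assms by simp
    then have "ln (1 / x) \<le> 1 / x - 1" by (intro ln_le_minus_one) simp
    then have "x * - ln x \<le> x * (1 / x - 1)" using x by (intro mult_left_mono) (simp_all add: ln_div)
    then show ?thesis using x by (simp add: algebra_simps)
  qed simp
qed

lemma zeta_bounds:
  assumes "0 \<le> x" "x \<le> 1"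
  shows "0 \<le> zeta x" "zeta x \<le> 1"
proof -
  show "0 \<le> zeta x"
  proof (cases "x = 0")
    case False
    then have x: "0 < x" using assms by simp
    then have "ln (1 / x) \<le> 1 / x - 1" by (intro ln_le_minus_one) simp
    then have "x * - ln x \<le> x * (1 / x - 1)" using x by (intro mult_left_mono) (simp_all add: ln_div)
    then show ?thesis using x by (simp add: zeta_def algebra_simps)
  qed (simp add: zeta_def)
  show "zeta x \<le> 1"
  proof (cases "x = 0")
    case False
    then have "zeta x = x * ln x - x + 1" by (simp add: zeta_def right_diff_distrib)
    then show ?thesis using mult_ln_bounds(2)[OF assms] assms(1) by linarith
  qed (simp add: zeta_def)
qed

text \<open>Gibbs' inequality: the relative entropy of \<open>v\<close> with respect to
  \<open>u\<close> is nonnegative. Substituting ln u_i = ln u_0 + \<mu>_i, the terms with ln u_0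
  cancel because both families add up to 1. Entries of \<open>v\<close> may vanish, as they do for
  pure initial states.\<close>

lemma entropy_convex:
  fixes u v \<mu> :: "nat \<Rightarrow> real"
  assumes u: "\<And>i. i \<le> n \<Longrightarrow> 0 < u i" "(\<Sum>i=0..n. u i) = 1"
    and v: "\<And>i. i \<le> n \<Longrightarrow> 0 \<le> v i" "(\<Sum>i=0..n. v i) = 1"
    and \<mu>: "\<And>i. i \<in> {1..n} \<Longrightarrow> u i = u 0 * exp (\<mu> i)"
  shows "(\<Sum>i=0..n. u i * ln (u i)) - (\<Sum>i=0..n. v i * ln (v i)) \<le> (\<Sum>i=1..n. (u i - v i) * \<mu> i)"
proof -
  have ln_u: "ln (u i) = ln (u 0) + \<mu> i" if "i \<in> {1..n}" for i
    using \<mu>[OF that] u(1)[of 0] by (simp add: ln_mult)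
  have pointwise: "v i - u i \<le> v i * ln (v i) - v i * ln (u i)" if i: "i \<in> {0..n}" for i
  proof (cases "v i = 0")
    case True
    then show ?thesis using u(1)[of i] i by simp
  next
    case False
    have "i \<le> n" using i by simp
    from False v(1)[OF this] u(1)[OF this] have vi: "0 < v i" "0 < u i" by linarith+
    then have "ln (u i / v i) \<le> u i / v i - 1" by (intro ln_le_minus_one) simp
    then have "v i * (ln (u i) - ln (v i)) \<le> v i * (u i / v i - 1)"
      using vi by (intro mult_left_mono) (simp_all add: ln_div)
    then show ?thesis using vi by (simp add: algebra_simps)
  qed
  have "(\<Sum>i=0..n. v i - u i) \<le> (\<Sum>i=0..n. v i * ln (v i) - v i * ln (u i))"
    by (rule sum_mono) (rule pointwise)
  then have "0 \<le> (\<Sum>i=0..n. v i * ln (v i)) - (\<Sum>i=0..n. v i * ln (u i))"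
    using u(2) v(2) by (simp add: sum_subtractf)
  then have "(\<Sum>i=0..n. u i * ln (u i)) - (\<Sum>i=0..n. v i * ln (v i)) \<le> (\<Sum>i=0..n. (u i - v i) * ln (u i))"
    by (simp add: left_diff_distrib sum_subtractf)
  also have "\<dots> = (u 0 - v 0) * ln (u 0) + (\<Sum>i=1..n. (u i - v i) * (ln (u 0) + \<mu> i))"
  proof -
    have "(\<Sum>i=1..n. (u i - v i) * ln (u i)) = (\<Sum>i=1..n. (u i - v i) * (ln (u 0) + \<mu> i))"
      by (intro sum.cong refl) (simp add: ln_u)
    then show ?thesis by (simp add: sum.atLeast_Suc_atMost[of 0 n])
  qed
  also have "\<dots> = ln (u 0) * ((u 0 - v 0) + (\<Sum>i=1..n. u i - v i)) + (\<Sum>i=1..n. (u i - v i) * \<mu> i)"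
    by (simp add: distrib_left sum.distrib sum_distrib_left mult_ac)
  also have "(u 0 - v 0) + (\<Sum>i=1..n. u i - v i) = 0"
    using u(2) v(2) by (simp add: sum.atLeast_Suc_atMost[of 0 n] sum_subtractf)
  finally show ?thesis by simp
qed

section \<open>Discrete concentrations\<close>

text \<open>All that the estimates use of the choice between maximum and average: the simplex value
  lies between 0 and 1 and dominates every vertex value up to the factor d + 1.\<close>

lemma (in mesh) simplex_value_bounds:
  assumes S: "S \<in> \<T>" and v: "\<And>K. K \<in> vertices_of S \<Longrightarrow> 0 \<le> v K"
  shows "0 \<le> simplex_value ch S v"
    "K \<in> vertices_of S \<Longrightarrow> v K \<le> (real CARD('d) + 1) * simplex_value ch S v"
    "(\<And>K. K \<in> vertices_of S \<Longrightarrow> v K \<le> 1) \<Longrightarrow> simplex_value ch S v \<le> 1"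
proof -
  let ?V = "vertices_of S"
  have fin: "finite ?V" "?V \<noteq> {}" "real (card ?V) = real CARD('d) + 1"
    using finite_vertices_of[OF S] vertices_of_nonempty[OF S] simplex_hull(2)[OF S] by auto
  have sum0: "0 \<le> (\<Sum>L\<in>?V. v L)" using v by (rule sum_nonneg)
  obtain L where L: "L \<in> ?V" using fin by auto
  have max: "v K \<le> Max (v ` ?V)" if "K \<in> ?V" for K using fin that by simp
  have max0: "0 \<le> Max (v ` ?V)" using max[OF L] v[OF L] by simp
  show "0 \<le> simplex_value ch S v" using sum0 max0 by (cases ch) auto
  show "v K \<le> (real CARD('d) + 1) * simplex_value ch S v" if K: "K \<in> ?V"
  proof (cases ch)
    case Maximum
    have "v K \<le> 1 * Max (v ` ?V)" using max[OF K] by simp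
    also have "\<dots> \<le> (real CARD('d) + 1) * Max (v ` ?V)" using max0 by (intro mult_right_mono) auto
    finally show ?thesis using Maximum by simp
  next
    case Average
    have "v K \<le> (\<Sum>L\<in>?V. v L)" using fin K v by (intro member_le_sum) auto
    moreover have "real CARD('d) + 1 \<noteq> 0" by linarith
    ultimately show ?thesis using Average by simp
  qed
  assume le: "\<And>K. K \<in> ?V \<Longrightarrow> v K \<le> 1"
  show "simplex_value ch S v \<le> 1"
  proof (cases ch)
    case Maximum
    then show ?thesis using fin le by simp
  next
    case Average
    have "(\<Sum>L\<in>?V. v L) \<le> real (card ?V)" using sum_bounded_above[of ?V v 1] le by simp
    then show ?thesis using Average fin by (simp add: divide_simps)
  qed
qed

lemma conc_potential:
  assumes "k \<noteq> 0"
  shows "conc n \<Omega> \<T> uini \<mu> 0 k K = 1 / (1 + (\<Sum>j=1..n. exp (\<mu> j k K)))"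
    "i \<noteq> 0 \<Longrightarrow> conc n \<Omega> \<T> uini \<mu> i k K = conc n \<Omega> \<T> uini \<mu> 0 k K * exp (\<mu> i k K)"
  using assms by (simp_all add: conc_def)

lemma conc_pos: "k \<noteq> 0 \<Longrightarrow> 0 < conc n \<Omega> \<T> uini \<mu> i k K"
  by (auto simp: conc_def intro!: divide_pos_pos add_pos_nonneg sum_nonneg)

lemma sum_conc:
  assumes "k \<noteq> 0"
  shows "(\<Sum>i=0..n. conc n \<Omega> \<T> uini \<mu> i k K) = 1"
proof -
  let ?s = "\<Sum>j=1..n. exp (\<mu> j k K)"
  have "0 < 1 + ?s" by (intro add_pos_nonneg sum_nonneg) auto
  moreover have "(\<Sum>i=0..n. conc n \<Omega> \<T> uini \<mu> i k K) = 1 / (1 + ?s) + 1 / (1 + ?s) * ?s"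
    using assms unfolding sum.atLeast_Suc_atMost[of 0 n, OF le0] by (simp add: conc_def sum_distrib_left)
  ultimately show ?thesis by (simp add: field_simps)
qed

lemma conc_le_1:
  assumes "k \<noteq> 0" "i \<le> n"
  shows "conc n \<Omega> \<T> uini \<mu> i k K \<le> 1"
proof -
  have "conc n \<Omega> \<T> uini \<mu> i k K \<le> (\<Sum>i=0..n. conc n \<Omega> \<T> uini \<mu> i k K)"
  proof (rule member_le_sum)
    show "i \<in> {0..n}" using assms(2) by simp
    show "0 \<le> conc n \<Omega> \<T> uini \<mu> j k K" for j
      by (rule less_imp_le[OF conc_pos[OF assms(1)]])
  qed simp
  then show ?thesis unfolding sum_conc[OF assms(1)] .
qed

context domain_mesh
begin

text \<open>Cell averages inherit sign and sum from the initial data. On a null cell division by 0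
  makes all averages 0, hence the condition in the second claim.\<close>

lemma conc_initial:
  assumes ini: "admissible_initial \<Omega> n M uini"
  shows "i \<le> n \<Longrightarrow> 0 \<le> conc n \<Omega> \<T> uini \<mu> i 0 K"
    "vol (dual_cell \<Omega> \<T> K) \<noteq> 0 \<Longrightarrow> (\<Sum>i=0..n. conc n \<Omega> \<T> uini \<mu> i 0 K) = 1"
proof -
  let ?D = "dual_cell \<Omega> \<T> K"
  have D: "?D \<in> sets lebesgue" "?D \<in> lmeasurable"
    using dual_cell_sets(1) bounded_fmeasurable[OF dual_cell_sets(1) dual_cell_subset] by auto
  have AE_D: "AE x in lebesgue_on ?D. P x" if "AE x in lebesgue_on \<Omega>. P x" for P
  proof -
    have "AE x in lebesgue. x \<in> \<Omega> \<longrightarrow> P x" using that domain_sets(1) by (subst (asm) AE_restrict_space_iff) auto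
    then have "AE x in lebesgue. x \<in> ?D \<longrightarrow> P x" by eventually_elim (use dual_cell_subset in blast)
    then show ?thesis using D by (subst AE_restrict_space_iff) auto
  qed
  have nn: "AE x in lebesgue_on ?D. 0 \<le> uini i x" if "i \<le> n" for i
    using ini that by (intro AE_D) (auto simp: admissible_initial_def)
  show "0 \<le> conc n \<Omega> \<T> uini \<mu> i 0 K" if "i \<le> n"
    using integral_nonneg_AE[OF nn[OF that]] by (simp add: conc_def)
  assume vol: "vol ?D \<noteq> 0"
  have sub: "space (lebesgue_on ?D) = ?D" by (simp add: space_restrict_space)
  have 1: "integrable (lebesgue_on ?D) (\<lambda>x. 1::real)" "integral\<^sup>L (lebesgue_on ?D) (\<lambda>x. 1::real) = vol ?D"
    unfolding integral_lebesgue_on[OF D(1)] integrable_lebesgue_on[OF D(1)]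
    using D by (simp_all add: lmeasurable_iff_integrable)
  have int: "integrable (lebesgue_on ?D) (uini i)" if i: "i \<le> n" for i
  proof -
    have "\<exists>B. AE x in lebesgue_on \<Omega>. \<bar>uini i x\<bar> \<le> B"
      using ini i by (simp add: admissible_initial_def)
    then obtain B where B: "AE x in lebesgue_on \<Omega>. \<bar>uini i x\<bar> \<le> B" by (rule exE)
    show ?thesis
    proof (rule Bochner_Integration.integrable_bound)
      show "integrable (lebesgue_on ?D) (\<lambda>x. B * 1)" using 1(1) by (rule integrable_mult_right)
      have "uini i \<in> borel_measurable (lebesgue_on \<Omega>)" using ini i by (auto simp: admissible_initial_def)
      then show "uini i \<in> borel_measurable (lebesgue_on ?D)"
        using measurable_restrict_mono[OF _ dual_cell_subset] by blast
      show "AE x in lebesgue_on ?D. norm (uini i x) \<le> norm (B * 1)"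
        using AE_D[OF B] by eventually_elim simp
    qed
  qed
  have "(\<Sum>i=0..n. integral\<^sup>L (lebesgue_on ?D) (uini i)) = integral\<^sup>L (lebesgue_on ?D) (\<lambda>x. \<Sum>i=0..n. uini i x)"
    by (rule Bochner_Integration.integral_sum[symmetric]) (use int in auto)
  also have "\<dots> = integral\<^sup>L (lebesgue_on ?D) (\<lambda>x. 1)"
  proof (rule integral_cong_AE)
    show "AE x in lebesgue_on ?D. (\<Sum>i=0..n. uini i x) = 1"
      using ini by (intro AE_D) (simp add: admissible_initial_def)
    show "(\<lambda>x. \<Sum>i=0..n. uini i x) \<in> borel_measurable (lebesgue_on ?D)"
      using int by (intro borel_measurable_sum borel_measurable_integrable) auto
  qed simp
  finally show "(\<Sum>i=0..n. conc n \<Omega> \<T> uini \<mu> i 0 K) = 1"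
    unfolding 1(2) using vol by (simp add: conc_def sum_divide_distrib[symmetric])
qed

end

section \<open>Space-time norm of reconstructed gradients\<close>

lemma time_grid_strict_mono:
  assumes "time_grid T N t" "j < k" "k \<le> N"
  shows "t j < t k"
  using assms(2,3)
proof (induction k)
  case (Suc k)
  have "t k < t (Suc k)" using assms(1) Suc.prems unfolding time_grid_def by (auto dest!: bspec[of _ _ "Suc k"])
  then show ?case using Suc by (cases "j = k") auto
qed simp

lemma time_grid_mono:
  assumes "time_grid T N t" "j \<le> k" "k \<le> N"
  shows "t j \<le> t k"
  using time_grid_strict_mono[OF assms(1), of j k] assms(2,3) by (cases "j = k") auto

lemma time_step_pos: "time_grid T N t \<Longrightarrow> k \<in> {1..N} \<Longrightarrow> 0 < time_step t k"
  by (simp add: time_grid_def time_step_def)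

lemma sum_time_step: "time_grid T N t \<Longrightarrow> (\<Sum>k=1..N. time_step t k) = T"
  using sum_telescope''[of 0 N t] by (simp add: time_grid_def time_step_def)

lemma time_interval_unique:
  assumes t: "time_grid T N t" and jk: "j \<in> {1..N}" "k \<in> {1..N}"
    and s: "s \<in> {t (j - 1)<..t j}" "s \<in> {t (k - 1)<..t k}"
  shows "j = k"
proof -
  have "\<not> a < b" if "a \<in> {1..N}" "b \<in> {1..N}" "s \<in> {t (a - 1)<..t a}" "s \<in> {t (b - 1)<..t b}" for a b
  proof
    assume "a < b"
    then have "t a \<le> t (b - 1)" using that by (intro time_grid_mono[OF t]) auto
    then show False using that by auto
  qed
  from this[of j k] this[of k j] show ?thesis using jk s by auto
qed

lemma time_interval_exists:
  assumes t: "time_grid T N t" and s: "0 < s" "s < T"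
  shows "\<exists>k\<in>{1..N}. t (k - 1) < s \<and> s \<le> t k"
proof -
  define k where "k = (LEAST k. s \<le> t k)"
  have N: "s \<le> t N" using t s by (simp add: time_grid_def)
  have k: "s \<le> t k" unfolding k_def by (rule LeastI[of "\<lambda>k. s \<le> t k", OF N])
  have "k \<le> N" unfolding k_def by (rule Least_le[of "\<lambda>k. s \<le> t k", OF N])
  moreover have "k \<noteq> 0" using k t s by (intro notI) (simp add: time_grid_def)
  moreover have "\<not> s \<le> t (k - 1)" using \<open>k \<noteq> 0\<close> unfolding k_def by (intro not_less_Least) simp
  ultimately show ?thesis using k by (intro bexI[of _ k]) auto
qed

text \<open>For open sets the product formula can be read off from the Borel measure, before
  completion.\<close>

lemma measure_lebesgue_Times:
  fixes A :: "'a::euclidean_space set" and B :: "'b::euclidean_space set"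
  assumes "open A" "open B"
  shows "measure lebesgue (A \<times> B) = measure lebesgue A * measure lebesgue B"
proof -
  have "emeasure lborel (A \<times> B) = emeasure lborel A * emeasure lborel B"
    using lborel.emeasure_pair_measure_Times[of A lborel B] assms by (simp add: lborel_prod)
  then show ?thesis using assms by (simp add: measure_def enn2real_mult open_Times)
qed

context domain_mesh
begin

lemma recon_eq:
  assumes t: "time_grid T N t" and k: "k \<in> {1..N}" "s \<in> {t (k - 1)<..t k}"
  shows "recon \<T> N t v s = interp \<T> (v k)"
proof -
  have "(THE k. k \<in> {1..N} \<and> s \<in> {t (k - 1)<..t k}) = k"
  proof (rule the_equality)
    show "k \<in> {1..N} \<and> s \<in> {t (k - 1)<..t k}" using k by (rule conjI)
    show "j = k" if "j \<in> {1..N} \<and> s \<in> {t (j - 1)<..t j}" for j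
      by (rule time_interval_unique[OF t conjunct1[OF that] k(1) conjunct2[OF that] k(2)])
  qed
  then show ?thesis by (simp add: recon_def)
qed

text \<open>Omitting the end points of the time intervals loses only a null set and makes the cell
  open with convex closure, so its boundary is negligible.\<close>

definition space_time_cell :: "(nat \<Rightarrow> real) \<Rightarrow> nat \<times> (real^'d) set \<Rightarrow> (real \<times> (real^'d)) set" where
  "space_time_cell t = (\<lambda>(k, S). {t (k - 1)<..<t k} \<times> S)"

lemma space_time_cell:
  assumes t: "time_grid T N t" and kS: "kS \<in> {1..N} \<times> \<T>"
  shows "open (space_time_cell t kS)" "space_time_cell t kS \<subseteq> {0<..<T} \<times> \<Omega>"
    "space_time_cell t kS \<in> lmeasurable"
    "measure lebesgue (space_time_cell t kS) = time_step t (fst kS) * vol (snd kS)"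
    "negligible (closure (space_time_cell t kS) - space_time_cell t kS)"
proof -
  obtain k S where kS': "kS = (k, S)" "k \<in> {1..N}" "S \<in> \<T>" using kS by auto
  have S: "open S" "bounded S" "S \<subseteq> \<Omega>" "convex (closure S)" "S = interior (closure S)"
    using kS'(3) simplex_hull bounded_simplex simplex_subset_domain by auto
  have tk: "t (k - 1) < t k" "0 \<le> t (k - 1)" "t k \<le> T"
    using kS'(2) t time_grid_mono[OF t, of 0 "k - 1"] time_grid_mono[OF t, of k N] by (auto simp: time_grid_def)
  have c: "space_time_cell t kS = {t (k - 1)<..<t k} \<times> S" by (simp add: space_time_cell_def kS'(1))
  show o: "open (space_time_cell t kS)" unfolding c using S by (intro open_Times) auto
  show "space_time_cell t kS \<subseteq> {0<..<T} \<times> \<Omega>" unfolding c using S tk by auto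
  show "space_time_cell t kS \<in> lmeasurable"
    using o S unfolding c by (intro bounded_set_imp_lmeasurable bounded_Times) auto
  show "measure lebesgue (space_time_cell t kS) = time_step t (fst kS) * vol (snd kS)"
    unfolding c using S tk by (subst measure_lebesgue_Times) (auto simp: kS'(1) time_step_def)
  have cl: "closure (space_time_cell t kS) = {t (k - 1)..t k} \<times> closure S"
    unfolding c closure_Times using tk by simp
  have "interior (closure (space_time_cell t kS)) = space_time_cell t kS"
    unfolding cl unfolding c interior_Times interior_atLeastAtMost_real S(5)[symmetric] ..
  moreover have "negligible (frontier (closure (space_time_cell t kS)))"
    unfolding cl by (intro negligible_convex_frontier convex_Times S) simp
  ultimately show "negligible (closure (space_time_cell t kS) - space_time_cell t kS)"
    by (simp add: frontier_def)
qed

lemma AE_space_time_cover: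
  assumes t: "time_grid T N t"
  shows "AE y in lebesgue. y \<in> {0<..<T} \<times> \<Omega> \<longrightarrow> (\<exists>kS\<in>{1..N} \<times> \<T>. y \<in> space_time_cell t kS)"
proof -
  have "negligible (\<Union>kS\<in>{1..N} \<times> \<T>. closure (space_time_cell t kS) - space_time_cell t kS)"
    using finite_mesh space_time_cell(5)[OF t] by (intro negligible_Union) auto
  then have "AE y in lebesgue. y \<notin> (\<Union>kS\<in>{1..N} \<times> \<T>. closure (space_time_cell t kS) - space_time_cell t kS)"
    by (intro AE_not_in) (simp add: negligible_iff_null_sets)
  then show ?thesis
  proof eventually_elim
    case (elim y)
    show ?case
    proof
      assume y: "y \<in> {0<..<T} \<times> \<Omega>"
      obtain s x where sx: "y = (s, x)" by (cases y)
      have "0 < s" "s < T" using y sx by auto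
      then obtain k where k: "k \<in> {1..N}" "t (k - 1) < s" "s \<le> t k"
        using time_interval_exists[OF t] by blast
      have "x \<in> closure \<Omega>" using y sx closure_subset by blast
      then have "x \<in> (\<Union>S\<in>\<T>. closure S)" unfolding mesh_closure .
      then obtain S where S: "S \<in> \<T>" "x \<in> closure S" by (rule UN_E)
      have "y \<in> closure (space_time_cell t (k, S))"
        using k S(2) by (simp add: space_time_cell_def closure_Times sx)
      with elim k(1) S(1) show "\<exists>kS\<in>{1..N} \<times> \<T>. y \<in> space_time_cell t kS"
        by (intro bexI[of _ "(k, S)"]) auto
    qed
  qed
qed

lemma space_time_cell_unique:
  assumes t: "time_grid T N t" and kS: "kS \<in> {1..N} \<times> \<T>" "kS' \<in> {1..N} \<times> \<T>"
    and y: "y \<in> space_time_cell t kS" "y \<in> space_time_cell t kS'"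
  shows "kS = kS'"
proof -
  obtain k S k' S' s x where e: "kS = (k, S)" "kS' = (k', S')" "y = (s, x)" by (metis prod.exhaust)
  have "k = k'" by (rule time_interval_unique[OF t, of _ _ s]) (use kS y in \<open>auto simp: e space_time_cell_def\<close>)
  moreover have "S = S'"
    using disjoint_mesh kS y by (auto simp: e space_time_cell_def disjoint_family_on_def)
  ultimately show ?thesis by (simp add: e)
qed

text \<open>Off a null set the integrand is constant on each space-time cell. If it is integrable,
  equality holds; if not, the integral defining the left side is 0 by convention and the right side
  is nonnegative. The inequality covers both cases and is the direction needed.\<close>

lemma grad_recon_sq_le:
  assumes t: "time_grid T N t"
  shows "grad_recon_sq \<Omega> T \<T> N t v \<le> (\<Sum>k=1..N. time_step t k * energy \<T> (interp \<T> (v k)))" (is "_ \<le> ?rhs")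
proof -
  let ?I = "{1..N} \<times> \<T>" and ?W = "{0<..<T} \<times> \<Omega>"
  define F where "F y = (norm (case y of (s, x) \<Rightarrow> grad (recon \<T> N t v s) x))\<^sup>2" for y
  define c where "c = (\<lambda>(k, S). (norm (grad_on (interp \<T> (v k)) S))\<^sup>2)"
  have fin: "finite ?I" using finite_mesh by simp
  have W: "?W \<in> sets lebesgue" 
    using open_Times[OF open_greaterThanLessThan open_domain, of 0 T] lborelD borel_open by blast
  have lhs: "grad_recon_sq \<Omega> T \<T> N t v = integral\<^sup>L lebesgue (\<lambda>y. indicator ?W y * F y)"
    unfolding grad_recon_sq_def L2_norm_square F_def[symmetric] by (rule integral_lebesgue_on[OF W])
  have FC: "F y = c kS" if "kS \<in> ?I" "y \<in> space_time_cell t kS" for y kS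
  proof -
    obtain k S s x where e: "kS = (k, S)" "y = (s, x)" by (metis prod.exhaust)
    have "grad (recon \<T> N t v s) x = grad_on (interp \<T> (v k)) S"
      using recon_eq[OF t, of k s v] P1_grad[OF interp_P1, of S x "v k"] that
      by (auto simp: e space_time_cell_def)
    then show ?thesis by (simp add: F_def c_def e)
  qed
  have ae: "AE y in lebesgue. indicator ?W y * F y = (\<Sum>kS\<in>?I. c kS * indicator (space_time_cell t kS) y)"
    using AE_space_time_cover[OF t]
  proof eventually_elim
    case (elim y)
    show ?case
    proof (cases "y \<in> ?W")
      case False
      have "y \<notin> space_time_cell t kS" if "kS \<in> ?I" for kS
        using space_time_cell(2)[OF t that] False by blast
      then show ?thesis using False by (simp add: indicator_def)
    next
      case True
      then obtain kS where kS: "kS \<in> ?I" "y \<in> space_time_cell t kS" using elim by (elim impE bexE)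
      have "(\<Sum>kS'\<in>?I. c kS' * indicator (space_time_cell t kS') y) = (\<Sum>kS'\<in>?I. if kS' = kS then c kS else 0)"
      proof (intro sum.cong refl)
        fix kS' assume kS': "kS' \<in> ?I"
        have "y \<in> space_time_cell t kS' \<Longrightarrow> kS' = kS"
          by (rule space_time_cell_unique[OF t kS' kS(1) _ kS(2)])
        then show "c kS' * indicator (space_time_cell t kS') y = (if kS' = kS then c kS else 0)"
          using kS(2) by (cases "kS' = kS") (auto simp: indicator_def)
      qed
      also have "\<dots> = c kS" using kS fin by simp
      finally show ?thesis using FC[OF kS] True by simp
    qed
  qed
  have int: "integrable lebesgue (\<lambda>y. c kS * indicator (space_time_cell t kS) y)" if "kS \<in> ?I" for kS
    using space_time_cell(3)[OF t that] by (simp add: lmeasurable_iff_integrable)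
  have rhs: "integral\<^sup>L lebesgue (\<lambda>y. \<Sum>kS\<in>?I. c kS * indicator (space_time_cell t kS) y) = ?rhs"
  proof -
    have "integral\<^sup>L lebesgue (\<lambda>y. \<Sum>kS\<in>?I. c kS * indicator (space_time_cell t kS) y)
        = (\<Sum>kS\<in>?I. c kS * measure lebesgue (space_time_cell t kS))"
      by (subst Bochner_Integration.integral_sum[OF int]) auto
    also have "\<dots> = (\<Sum>kS\<in>?I. c kS * (time_step t (fst kS) * vol (snd kS)))"
      by (intro sum.cong refl) (simp add: space_time_cell(4)[OF t])
    also have "\<dots> = ?rhs"
      unfolding sum.cartesian_product[symmetric] energy_def c_def
      by (simp add: sum_distrib_left mult_ac sum.cartesian_product')
    finally show ?thesis .
  qed
  show ?thesis
  proof (cases "integrable lebesgue (\<lambda>y. indicator ?W y * F y)")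
    case True
    have "integrable lebesgue (\<lambda>y. \<Sum>kS\<in>?I. c kS * indicator (space_time_cell t kS) y)"
      by (rule Bochner_Integration.integrable_sum[OF int])
    then have "integral\<^sup>L lebesgue (\<lambda>y. indicator ?W y * F y) = ?rhs"
      unfolding rhs[symmetric] using integral_cong_AE[OF _ _ ae] True by (simp add: borel_measurable_integrable)
    then show ?thesis using lhs by simp
  next
    case False
    then have "grad_recon_sq \<Omega> T \<T> N t v = 0" unfolding lhs by (rule not_integrable_integral_eq)
    moreover have "0 \<le> ?rhs"
      using time_step_pos[OF t] energy_nonneg by (intro sum_nonneg mult_nonneg_nonneg) (auto simp: less_imp_le)
    ultimately show ?thesis by simp
  qed
qed

end

section \<open>Entropy dissipation of the scheme\<close>

locale scheme = domain_mesh \<Omega> \<T> for \<Omega> :: "(real^'d::finite) set" and \<T> +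
  fixes T lam \<beta> C\<phi> CP :: real and n N :: nat and z D M t :: "nat \<Rightarrow> real" and \<Gamma>D :: "(real^'d) set"
    and f \<psi> :: "real^'d \<Rightarrow> real" and uini :: "nat \<Rightarrow> real^'d \<Rightarrow> real" and ch :: simplex_choice
    and \<mu> :: "nat \<Rightarrow> nat \<Rightarrow> real^'d \<Rightarrow> real" and \<phi> :: "nat \<Rightarrow> real^'d \<Rightarrow> real"
  assumes lam: "lam > 0" and D: "\<And>i. i \<in> {1..n} \<Longrightarrow> D i > 0" and CP: "CP > 0"
    and poincare: "poincare_const \<Omega> \<Gamma>D CP" and f: "in_L2 \<Omega> f"
    and initial: "admissible_initial \<Omega> n M uini" and P1D: "P1_space_D \<T> \<Gamma>D \<subseteq> H1D \<Omega> \<Gamma>D"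
    and lifting: "\<psi> \<in> P1_space \<T>" "\<psi> \<in> H1 \<Omega>" "H1_norm \<Omega> \<psi> \<le> C\<phi>"
    and grid: "time_grid T N t"
    and solution: "scheme_solution n z D lam \<beta> \<Omega> \<Gamma>D f uini \<T> \<psi> N t ch \<mu> \<phi>"
begin

definition u :: "nat \<Rightarrow> nat \<Rightarrow> real^'d \<Rightarrow> real" where
  "u = conc n \<Omega> \<T> uini \<mu>"

definition uS :: "nat \<Rightarrow> nat \<Rightarrow> (real^'d) set \<Rightarrow> real" where
  "uS i k S = simplex_value ch S (u i k)"

text \<open>Each simplex is counted once here; this is the quantity that arises when the
  conservation laws are tested with the potentials.\<close>

definition dissipation :: "nat \<Rightarrow> real" where
  "dissipation k = (\<Sum>i=1..n. D i * (\<Sum>S\<in>\<T>. uS 0 k S * uS i k S * (vol S * (norm (grad_on (interp \<T> (\<mu> i k)) S))\<^sup>2)))"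

text \<open>The solvent, \<open>i = 0\<close>, is included. Since the concentrations add up to 1, ln
  u_i - ln u_0 is then the derivative of the entropy along the constraint.\<close>

definition entropy :: "nat \<Rightarrow> real" where
  "entropy k = (\<Sum>K\<in>mesh_vertices \<T>. vol (dual_cell \<Omega> \<T> K) * (\<Sum>i=0..n. u i k K * ln (u i k K)))"

text \<open>The bound of \<open>potential_energy\<close> with Z the sum of the |z i|, which
  dominates the charge density because concentrations are at most 1.\<close>

definition potential_bound :: real where
  "potential_bound = 16 * ((\<Sum>i=1..n. \<bar>z i\<bar>)\<^sup>2 * vol \<Omega> + (L2_norm \<Omega> f)\<^sup>2) * (CP\<^sup>2 + (diameter \<Omega>)\<^sup>2) / lam ^ 4 + 6 * C\<phi>\<^sup>2"

section \<open>Bounds on concentrations, entropy and potential\<close>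

lemma uS_bounds:
  assumes "k \<in> {1..N}" "i \<le> n" "S \<in> \<T>"
  shows "0 \<le> uS i k S" "uS i k S \<le> 1"
    "K \<in> vertices_of S \<Longrightarrow> u i k K \<le> (real CARD('d) + 1) * uS i k S"
proof -
  have k: "k \<noteq> 0" using assms by simp
  have pos: "0 \<le> u i k L" for L unfolding u_def by (rule less_imp_le[OF conc_pos[OF k]])
  have le: "u i k L \<le> 1" for L unfolding u_def by (rule conc_le_1[OF k assms(2)])
  show "0 \<le> uS i k S" unfolding uS_def by (rule simplex_value_bounds(1)[OF assms(3) pos])
  show "uS i k S \<le> 1" unfolding uS_def by (rule simplex_value_bounds(3)[OF assms(3) pos le])
  show "K \<in> vertices_of S \<Longrightarrow> u i k K \<le> (real CARD('d) + 1) * uS i k S"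
    unfolding uS_def by (rule simplex_value_bounds(2)[OF assms(3) pos])
qed

lemma weight_bounds:
  assumes "k \<in> {1..N}" "i \<le> n" "S \<in> \<T>"
  shows "0 \<le> uS 0 k S * uS i k S" "uS 0 k S * uS i k S \<le> 1"
  using uS_bounds[OF assms] uS_bounds[OF assms(1) _ assms(3), of 0] by (auto intro: mult_le_one)

lemma conc_nonneg: "i \<le> n \<Longrightarrow> 0 \<le> u i k K"
  unfolding u_def using conc_initial(1)[OF initial] less_imp_le[OF conc_pos] by (cases "k = 0") auto

lemma sum_conc_eq_1: "vol (dual_cell \<Omega> \<T> K) \<noteq> 0 \<or> k \<noteq> 0 \<Longrightarrow> (\<Sum>i=0..n. u i k K) = 1"
  unfolding u_def using conc_initial(2)[OF initial] sum_conc by (cases "k = 0") auto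

lemma conc_le: "vol (dual_cell \<Omega> \<T> K) \<noteq> 0 \<or> k \<noteq> 0 \<Longrightarrow> i \<le> n \<Longrightarrow> u i k K \<le> 1"
  using member_le_sum[of i "{0..n}" "\<lambda>i. u i k K"] sum_conc_eq_1[of K k] conc_nonneg[of _ k K] by simp

text \<open>On [0,1] the function x ln x takes values in [-1,0], and null cells carry weight 0; so
  both bounds hold at every time, including the initial one.\<close>

lemma entropy_bounds: "- (real n + 1) * vol \<Omega> \<le> entropy k" "entropy k \<le> 0"
proof -
  have summand: "- (real n + 1) * vol (dual_cell \<Omega> \<T> K) \<le> vol (dual_cell \<Omega> \<T> K) * (\<Sum>i=0..n. u i k K * ln (u i k K))"
    "vol (dual_cell \<Omega> \<T> K) * (\<Sum>i=0..n. u i k K * ln (u i k K)) \<le> 0" for K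
  proof (atomize (full), cases "vol (dual_cell \<Omega> \<T> K) = 0")
    case False
    then have b: "0 \<le> u i k K" "u i k K \<le> 1" if "i \<le> n" for i using conc_nonneg conc_le that by auto
    have "- (real n + 1) = (\<Sum>i=0..n. - 1)" by simp
    also have "\<dots> \<le> (\<Sum>i=0..n. u i k K * ln (u i k K))" by (intro sum_mono mult_ln_bounds(1) b) auto
    finally have l: "- (real n + 1) \<le> (\<Sum>i=0..n. u i k K * ln (u i k K))" .
    have r: "(\<Sum>i=0..n. u i k K * ln (u i k K)) \<le> 0" by (intro sum_nonpos mult_ln_bounds(2) b) auto
    show "- (real n + 1) * vol (dual_cell \<Omega> \<T> K) \<le> vol (dual_cell \<Omega> \<T> K) * (\<Sum>i=0..n. u i k K * ln (u i k K))
      \<and> vol (dual_cell \<Omega> \<T> K) * (\<Sum>i=0..n. u i k K * ln (u i k K)) \<le> 0"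
      using mult_left_mono[OF l, of "vol (dual_cell \<Omega> \<T> K)"] mult_nonneg_nonpos[OF measure_nonneg r]
      by (simp add: mult.commute)
  qed simp
  show "entropy k \<le> 0" unfolding entropy_def by (rule sum_nonpos) (rule summand(2))
  have "(real n + 1) * (\<Sum>K\<in>mesh_vertices \<T>. vol (dual_cell \<Omega> \<T> K)) \<le> (real n + 1) * vol \<Omega>"
    by (rule mult_left_mono[OF sum_vol_dual_cells]) simp
  then have "- (real n + 1) * vol \<Omega> \<le> (\<Sum>K\<in>mesh_vertices \<T>. - (real n + 1) * vol (dual_cell \<Omega> \<T> K))"
    by (simp only: mult_minus_left sum_negf sum_distrib_left[symmetric] neg_le_iff_le)
  also have "\<dots> \<le> entropy k" unfolding entropy_def by (rule sum_mono) (rule summand(1))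
  finally show "- (real n + 1) * vol \<Omega> \<le> entropy k" .
qed

lemma potential_energy_le:
  assumes k: "k \<in> {1..N}"
  shows "energy \<T> (interp \<T> (\<phi> k)) \<le> potential_bound"
  unfolding potential_bound_def
proof (rule potential_energy[OF poincare CP lam P1D f lifting])
  let ?\<rho> = "\<lambda>K. \<Sum>i=1..n. z i * u i k K"
  show "\<bar>?\<rho> K\<bar> \<le> (\<Sum>i=1..n. \<bar>z i\<bar>)" for K
  proof (rule order_trans[OF sum_abs], rule sum_mono)
    fix i assume i: "i \<in> {1..n}"
    have "\<bar>z i\<bar> * \<bar>u i k K\<bar> \<le> \<bar>z i\<bar> * 1"
      using conc_nonneg[of i k K] conc_le[of K k i] i k by (intro mult_left_mono) auto
    then show "\<bar>z i * u i k K\<bar> \<le> \<bar>z i\<bar>" by (simp add: abs_mult)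
  qed
  have sol: "if K \<in> \<Gamma>D then \<phi> k K = \<psi> K
        else lam\<^sup>2 * (\<Sum>S\<in>simplices_at \<T> K. \<Sum>L\<in>vertices_of S. stiffness \<T> S K L * (\<phi> k K - \<phi> k L))
             = vol (dual_cell \<Omega> \<T> K) * ?\<rho> K + integral\<^sup>L (lebesgue_on (dual_cell \<Omega> \<T> K)) f"
    if "K \<in> mesh_vertices \<T>" for K
    using solution k that unfolding scheme_solution_def Let_def u_def by blast
  fix K assume K: "K \<in> mesh_vertices \<T>"
  show "K \<in> \<Gamma>D \<Longrightarrow> \<phi> k K = \<psi> K" using sol[OF K] by simp
  show "K \<notin> \<Gamma>D \<Longrightarrow>
       lam\<^sup>2 * (\<Sum>S\<in>simplices_at \<T> K. \<Sum>L\<in>vertices_of S. stiffness \<T> S K L * (\<phi> k K - \<phi> k L))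
       = vol (dual_cell \<Omega> \<T> K) * ?\<rho> K + integral\<^sup>L (lebesgue_on (dual_cell \<Omega> \<T> K)) f"
    using sol[OF K] by simp
qed

text \<open>The weight in front of the flux is constant on each simplex, so
  \<open>sum_stiffness\<close> applies to the diffusion and to the drift part separately.\<close>

lemma flux_energy:
  "(\<Sum>K\<in>mesh_vertices \<T>. \<mu> i k K * (\<Sum>S\<in>simplices_at \<T> K. \<Sum>L\<in>vertices_of S. uS 0 k S * uS i k S * flux D z \<beta> \<T> \<mu> \<phi> i k S K L))
   = D i * (\<Sum>S\<in>\<T>. uS 0 k S * uS i k S * (vol S * ((grad_on (interp \<T> (\<mu> i k)) S + (\<beta> * z i) *\<^sub>R grad_on (interp \<T> (\<phi> k)) S)
        \<bullet> grad_on (interp \<T> (\<mu> i k)) S)))"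
proof -
  have "(\<Sum>K\<in>mesh_vertices \<T>. \<mu> i k K * (\<Sum>S\<in>simplices_at \<T> K. \<Sum>L\<in>vertices_of S. uS 0 k S * uS i k S * flux D z \<beta> \<T> \<mu> \<phi> i k S K L))
    = (\<Sum>K\<in>mesh_vertices \<T>. \<Sum>S\<in>simplices_at \<T> K. \<mu> i k K * (\<Sum>L\<in>vertices_of S. uS 0 k S * uS i k S * flux D z \<beta> \<T> \<mu> \<phi> i k S K L))"
    by (simp add: sum_distrib_left)
  also have "\<dots> = (\<Sum>S\<in>\<T>. \<Sum>K\<in>vertices_of S. \<mu> i k K * (\<Sum>L\<in>vertices_of S. uS 0 k S * uS i k S * flux D z \<beta> \<T> \<mu> \<phi> i k S K L))"
    by (rule sum_vertices_simplices)
  also have "\<dots> = (\<Sum>S\<in>\<T>. D i * (uS 0 k S * uS i k S * (vol S * ((grad_on (interp \<T> (\<mu> i k)) S + (\<beta> * z i) *\<^sub>R grad_on (interp \<T> (\<phi> k)) S)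
        \<bullet> grad_on (interp \<T> (\<mu> i k)) S))))"
  proof (rule sum.cong[OF refl])
    fix S assume S: "S \<in> \<T>"
    let ?V = "vertices_of S" and ?w = "uS 0 k S * uS i k S"
    have "(\<Sum>K\<in>?V. \<mu> i k K * (\<Sum>L\<in>?V. ?w * flux D z \<beta> \<T> \<mu> \<phi> i k S K L))
      = D i * (?w * ((\<Sum>K\<in>?V. \<Sum>L\<in>?V. stiffness \<T> S K L * (\<mu> i k K - \<mu> i k L) * \<mu> i k K)
          + \<beta> * z i * (\<Sum>K\<in>?V. \<Sum>L\<in>?V. stiffness \<T> S K L * (\<phi> k K - \<phi> k L) * \<mu> i k K)))"
      unfolding sum_distrib_left sum.distrib[symmetric]
      by (intro sum.cong refl) (simp add: flux_def algebra_simps)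
    then show "(\<Sum>K\<in>?V. \<mu> i k K * (\<Sum>L\<in>?V. ?w * flux D z \<beta> \<T> \<mu> \<phi> i k S K L))
      = D i * (?w * (vol S * ((grad_on (interp \<T> (\<mu> i k)) S + (\<beta> * z i) *\<^sub>R grad_on (interp \<T> (\<phi> k)) S)
        \<bullet> grad_on (interp \<T> (\<mu> i k)) S)))"
      unfolding sum_stiffness[OF S] by (simp add: inner_add_left algebra_simps)
  qed
  finally show ?thesis by (simp only: sum_distrib_left)
qed

text \<open>Convexity bounds the entropy increment by the tested time difference, the scheme
  replaces that by fluxes, and the drift is absorbed by Young's inequality at the price of half of
  the dissipation.\<close>

lemma entropy_step:
  assumes k: "k \<in> {1..N}"
  shows "entropy k - entropy (k - 1) + time_step t k * (dissipation k / 2)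
    \<le> time_step t k * (\<beta>\<^sup>2 * (\<Sum>i=1..n. D i * (z i)\<^sup>2) * potential_bound / 2)"
proof -
  let ?V = "mesh_vertices \<T>" and ?\<tau> = "time_step t k" and ?D = "\<lambda>K. vol (dual_cell \<Omega> \<T> K)"
  let ?F = "\<lambda>i K. \<Sum>S\<in>simplices_at \<T> K. \<Sum>L\<in>vertices_of S. uS 0 k S * uS i k S * flux D z \<beta> \<T> \<mu> \<phi> i k S K L"
  have \<tau>: "?\<tau> > 0" by (rule time_step_pos[OF grid k])
  have k0: "k \<noteq> 0" using k by simp
  have S3: "?D K * (u i k K - u i (k - 1) K) = - ?\<tau> * ?F i K" if "i \<in> {1..n}" "K \<in> ?V" for i K
  proof -
    have "?D K * ((u i k K - u i (k - 1) K) / ?\<tau>) + ?F i K = 0"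
      using solution k that unfolding scheme_solution_def Let_def u_def uS_def by blast
    then have "?D K * ((u i k K - u i (k - 1) K) / ?\<tau>) = - ?F i K" by linarith
    then have "?\<tau> * (?D K * ((u i k K - u i (k - 1) K) / ?\<tau>)) = ?\<tau> * - ?F i K" by simp
    then show ?thesis using \<tau> by simp
  qed
  have "entropy k - entropy (k - 1) = (\<Sum>K\<in>?V. ?D K * ((\<Sum>i=0..n. u i k K * ln (u i k K)) - (\<Sum>i=0..n. u i (k - 1) K * ln (u i (k - 1) K))))"
    by (simp add: entropy_def sum_subtractf right_diff_distrib)
  also have "\<dots> \<le> (\<Sum>K\<in>?V. ?D K * (\<Sum>i=1..n. (u i k K - u i (k - 1) K) * \<mu> i k K))"
  proof (rule sum_mono)
    fix K assume "K \<in> ?V"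
    show "?D K * ((\<Sum>i=0..n. u i k K * ln (u i k K)) - (\<Sum>i=0..n. u i (k - 1) K * ln (u i (k - 1) K)))
      \<le> ?D K * (\<Sum>i=1..n. (u i k K - u i (k - 1) K) * \<mu> i k K)"
    \<comment> \<open>On a null cell the values at step 0 need not add up to 1, but both sides carry
      the factor 0.\<close>
    proof (cases "?D K = 0")
      case False
      show ?thesis
      proof (rule mult_left_mono[OF entropy_convex])
        show "0 < u i k K" for i unfolding u_def by (rule conc_pos[OF k0])
        show "(\<Sum>i=0..n. u i k K) = 1" "(\<Sum>i=0..n. u i (k - 1) K) = 1" using False by (simp_all add: sum_conc_eq_1)
        show "0 \<le> u i (k - 1) K" if "i \<le> n" for i by (rule conc_nonneg[OF that])
        show "u i k K = u 0 k K * exp (\<mu> i k K)" if "i \<in> {1..n}" for i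
          unfolding u_def by (rule conc_potential(2)[OF k0]) (use that in simp)
      qed simp
    qed simp
  qed
  also have "\<dots> = (\<Sum>K\<in>?V. \<Sum>i=1..n. - ?\<tau> * (\<mu> i k K * ?F i K))"
  proof (rule sum.cong[OF refl])
    fix K assume K: "K \<in> ?V"
    have "?D K * (\<Sum>i=1..n. (u i k K - u i (k - 1) K) * \<mu> i k K) = (\<Sum>i=1..n. ?D K * (u i k K - u i (k - 1) K) * \<mu> i k K)"
      by (simp add: sum_distrib_left mult.assoc)
    also have "\<dots> = (\<Sum>i=1..n. - ?\<tau> * ?F i K * \<mu> i k K)"
      using S3 K by (intro sum.cong refl) simp
    also have "\<dots> = (\<Sum>i=1..n. - ?\<tau> * (\<mu> i k K * ?F i K))" by (intro sum.cong refl) (simp add: mult_ac)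
    finally show "?D K * (\<Sum>i=1..n. (u i k K - u i (k - 1) K) * \<mu> i k K) = (\<Sum>i=1..n. - ?\<tau> * (\<mu> i k K * ?F i K))" .
  qed
  also have "\<dots> = - ?\<tau> * (\<Sum>i=1..n. \<Sum>K\<in>?V. \<mu> i k K * ?F i K)"
    by (subst sum.swap) (simp only: sum_distrib_left)
  finally have 1: "entropy k - entropy (k - 1) \<le> - ?\<tau> * (\<Sum>i=1..n. \<Sum>K\<in>?V. \<mu> i k K * ?F i K)" .
  have 2: "dissipation k / 2 - \<beta>\<^sup>2 * (\<Sum>i=1..n. D i * (z i)\<^sup>2) * potential_bound / 2 \<le> (\<Sum>i=1..n. \<Sum>K\<in>?V. \<mu> i k K * ?F i K)"
  proof -
    have each: "D i * (\<Sum>S\<in>\<T>. uS 0 k S * uS i k S * (vol S * (norm (grad_on (interp \<T> (\<mu> i k)) S))\<^sup>2)) / 2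
        - \<beta>\<^sup>2 * (D i * (z i)\<^sup>2) * potential_bound / 2 \<le> (\<Sum>K\<in>?V. \<mu> i k K * ?F i K)" if i: "i \<in> {1..n}" for i
    proof -
      let ?a = "\<lambda>S. grad_on (interp \<T> (\<mu> i k)) S" and ?b = "\<lambda>S. grad_on (interp \<T> (\<phi> k)) S" and ?w = "\<lambda>S. uS 0 k S * uS i k S"
      have "(\<Sum>S\<in>\<T>. ?w S * (vol S * (norm (?a S))\<^sup>2)) / 2 - (\<beta> * z i)\<^sup>2 * energy \<T> (interp \<T> (\<phi> k)) / 2
          = (\<Sum>S\<in>\<T>. ?w S * (vol S * (norm (?a S))\<^sup>2) / 2 - (\<beta> * z i)\<^sup>2 * (vol S * (norm (?b S))\<^sup>2) / 2)"
        by (simp add: energy_def sum_subtractf sum_distrib_left sum_divide_distrib)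
      also have "\<dots> \<le> (\<Sum>S\<in>\<T>. ?w S * (vol S * ((?a S + (\<beta> * z i) *\<^sub>R ?b S) \<bullet> ?a S)))"
      proof (rule sum_mono)
        fix S assume S: "S \<in> \<T>"
        have w: "0 \<le> ?w S" "?w S \<le> 1" using weight_bounds[OF k _ S, of i] i by auto
        \<comment> \<open>Young's inequality as the nonnegativity of a single square, with a and b
          the gradients of \<mu> and \<phi>: (a + c b).a is at least |a|^2/2 - c^2 |b|^2/2, where c
          is \<open>\<beta> * z i\<close>.\<close>
        have "0 \<le> (norm (?a S + (\<beta> * z i) *\<^sub>R ?b S))\<^sup>2" by simp
        then have "(norm (?a S))\<^sup>2 / 2 - (\<beta> * z i)\<^sup>2 * (norm (?b S))\<^sup>2 / 2 \<le> (?a S + (\<beta> * z i) *\<^sub>R ?b S) \<bullet> ?a S"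
          unfolding power2_norm_eq_inner by (simp add: inner_add_left inner_add_right inner_commute power2_eq_square algebra_simps)
        then have "?w S * (vol S * ((norm (?a S))\<^sup>2 / 2 - (\<beta> * z i)\<^sup>2 * (norm (?b S))\<^sup>2 / 2))
          \<le> ?w S * (vol S * ((?a S + (\<beta> * z i) *\<^sub>R ?b S) \<bullet> ?a S))"
          using w by (intro mult_left_mono) auto
        \<comment> \<open>The weight is at most 1, so it may be dropped from the drift term, leaving
          the unweighted energy of the potential.\<close>
        moreover have "?w S * ((\<beta> * z i)\<^sup>2 * (vol S * (norm (?b S))\<^sup>2) / 2) \<le> 1 * ((\<beta> * z i)\<^sup>2 * (vol S * (norm (?b S))\<^sup>2) / 2)"
          using w by (intro mult_right_mono) auto
        ultimately show "?w S * (vol S * (norm (?a S))\<^sup>2) / 2 - (\<beta> * z i)\<^sup>2 * (vol S * (norm (?b S))\<^sup>2) / 2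
          \<le> ?w S * (vol S * ((?a S + (\<beta> * z i) *\<^sub>R ?b S) \<bullet> ?a S))"
          by (simp add: algebra_simps)
      qed
      finally have "(\<Sum>S\<in>\<T>. ?w S * (vol S * (norm (?a S))\<^sup>2)) / 2 - (\<beta> * z i)\<^sup>2 * potential_bound / 2
          \<le> (\<Sum>S\<in>\<T>. ?w S * (vol S * ((?a S + (\<beta> * z i) *\<^sub>R ?b S) \<bullet> ?a S)))"
        using mult_left_mono[OF potential_energy_le[OF k], of "(\<beta> * z i)\<^sup>2"] by simp
      from mult_left_mono[OF this less_imp_le[OF D[OF i]]]
      show ?thesis unfolding flux_energy by (simp add: algebra_simps power_mult_distrib)
    qed
    have "dissipation k / 2 - \<beta>\<^sup>2 * (\<Sum>i=1..n. D i * (z i)\<^sup>2) * potential_bound / 2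
      = (\<Sum>i=1..n. D i * (\<Sum>S\<in>\<T>. uS 0 k S * uS i k S * (vol S * (norm (grad_on (interp \<T> (\<mu> i k)) S))\<^sup>2)) / 2
        - \<beta>\<^sup>2 * (D i * (z i)\<^sup>2) * potential_bound / 2)"
      by (simp only: dissipation_def sum_subtractf sum_distrib_left[of "\<beta>\<^sup>2"] sum_distrib_right sum_divide_distrib)
    also have "\<dots> \<le> (\<Sum>i=1..n. \<Sum>K\<in>?V. \<mu> i k K * ?F i K)" by (rule sum_mono) (rule each)
    finally show ?thesis .
  qed
  from mult_left_mono[OF 2 less_imp_le[OF \<tau>]] 1 show ?thesis by (simp add: algebra_simps)
qed

text \<open>Telescoping over the time steps: the entropy starts at most at 0 and ends no lower than
  its general lower bound.\<close>

lemma total_dissipation: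
  "(\<Sum>k=1..N. time_step t k * (dissipation k / 2))
    \<le> (real n + 1) * vol \<Omega> + T * (\<beta>\<^sup>2 * (\<Sum>i=1..n. D i * (z i)\<^sup>2) * potential_bound / 2)"
proof -
  let ?c = "\<beta>\<^sup>2 * (\<Sum>i=1..n. D i * (z i)\<^sup>2) * potential_bound / 2"
  have "(\<Sum>k=1..N. time_step t k * (dissipation k / 2)) \<le> (\<Sum>k=1..N. time_step t k * ?c - (entropy k - entropy (k - 1)))"
  proof (rule sum_mono)
    fix k assume "k \<in> {1..N}"
    from entropy_step[OF this] show "time_step t k * (dissipation k / 2) \<le> time_step t k * ?c - (entropy k - entropy (k - 1))"
      by linarith
  qed
  also have "\<dots> = T * ?c - (entropy N - entropy 0)"
    unfolding sum_subtractf sum_distrib_right[symmetric] sum_time_step[OF grid]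
    using sum_telescope''[of 0 N entropy] by (simp add: sum_subtractf)
  also have "\<dots> \<le> T * ?c + (real n + 1) * vol \<Omega>" using entropy_bounds(1)[of N] entropy_bounds(2)[of 0]
    by (simp add: algebra_simps)
  finally show ?thesis by simp
qed

text \<open>The sign allows this sum to be added to the right side of the first estimate; the upper
  bound removes the initial data from the second one.\<close>

lemma zeta_initial_bounds:
  "0 \<le> (\<Sum>i=1..n. \<Sum>K\<in>mesh_vertices \<T>. vol (dual_cell \<Omega> \<T> K) * zeta (u i 0 K))"
  "(\<Sum>i=1..n. \<Sum>K\<in>mesh_vertices \<T>. vol (dual_cell \<Omega> \<T> K) * zeta (u i 0 K)) \<le> real n * vol \<Omega>"
proof -
  have b: "0 \<le> vol (dual_cell \<Omega> \<T> K) * zeta (u i 0 K) \<and> vol (dual_cell \<Omega> \<T> K) * zeta (u i 0 K) \<le> vol (dual_cell \<Omega> \<T> K)"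
    if "i \<in> {1..n}" for i K
  proof (cases "vol (dual_cell \<Omega> \<T> K) = 0")
    case False
    then have "0 \<le> zeta (u i 0 K)" "zeta (u i 0 K) \<le> 1"
      using zeta_bounds[of "u i 0 K"] conc_nonneg[of i 0 K] conc_le[of K 0 i] that by auto
    then show ?thesis using mult_left_mono[of "zeta (u i 0 K)" 1 "vol (dual_cell \<Omega> \<T> K)"] by simp
  qed simp
  show "0 \<le> (\<Sum>i=1..n. \<Sum>K\<in>mesh_vertices \<T>. vol (dual_cell \<Omega> \<T> K) * zeta (u i 0 K))"
    using b by (intro sum_nonneg) blast
  have "(\<Sum>i=1..n. \<Sum>K\<in>mesh_vertices \<T>. vol (dual_cell \<Omega> \<T> K) * zeta (u i 0 K)) \<le> (\<Sum>i=1..n. \<Sum>K\<in>mesh_vertices \<T>. vol (dual_cell \<Omega> \<T> K))"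
    using b by (intro sum_mono) blast
  also have "\<dots> \<le> (\<Sum>i=1..n. vol \<Omega>)" by (intro sum_mono sum_vol_dual_cells)
  finally show "(\<Sum>i=1..n. \<Sum>K\<in>mesh_vertices \<T>. vol (dual_cell \<Omega> \<T> K) * zeta (u i 0 K)) \<le> real n * vol \<Omega>" by simp
qed

text \<open>Each simplex is counted once for each of its \<open>d + 1\<close> vertices.\<close>

lemma vertex_simplex_dissipation:
  "(\<Sum>k=1..N. time_step t k / 2 * (\<Sum>i=1..n. \<Sum>K\<in>mesh_vertices \<T>. \<Sum>S\<in>simplices_at \<T> K.
            vol S * uS 0 k S * uS i k S * D i * (norm (grad_on (interp \<T> (\<mu> i k)) S))\<^sup>2))
   = (real CARD('d) + 1) * (\<Sum>k=1..N. time_step t k * (dissipation k / 2))"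
proof -
  have "(\<Sum>K\<in>mesh_vertices \<T>. \<Sum>S\<in>simplices_at \<T> K.
            vol S * uS 0 k S * uS i k S * D i * (norm (grad_on (interp \<T> (\<mu> i k)) S))\<^sup>2)
    = (real CARD('d) + 1) * (D i * (\<Sum>S\<in>\<T>. uS 0 k S * uS i k S * (vol S * (norm (grad_on (interp \<T> (\<mu> i k)) S))\<^sup>2)))" for i k
    unfolding sum_vertices_simplices sum_distrib_left
    by (intro sum.cong refl) (simp add: simplex_hull(2) mult_ac)
  then show ?thesis
    by (simp only: dissipation_def sum_distrib_left) (simp add: sum_distrib_left sum_divide_distrib mult_ac)
qed

section \<open>Gradients of the concentrations\<close>

definition edge_dissipation :: "nat \<Rightarrow> (real^'d) set \<Rightarrow> (real^'d) set \<Rightarrow> real" where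
  "edge_dissipation k S E = (\<Sum>i=1..n. uS 0 k S * uS i k S * sqdiff (\<mu> i k) E)"

text \<open>The edge is oriented so that \<open>K\<close> is the end with more solvent, as
  \<open>edge_pair\<close> requires. The products of concentrations there may belong to different
  ends; since simplex values dominate the values at all vertices, any such product is at most (d +
  1)^2 times the weight of the simplex.\<close>

lemma edge_estimates:
  assumes k: "k \<in> {1..N}" and S: "S \<in> \<T>" and E: "E \<in> edges_of S"
  shows "sqdiff (\<lambda>K. sqrt (u 0 k K)) E \<le> (real CARD('d) + 1)\<^sup>2 * edge_dissipation k S E"
    "sqdiff (u 0 k) E \<le> 4 * (real CARD('d) + 1)\<^sup>2 * edge_dissipation k S E"
    "i \<in> {1..n} \<Longrightarrow> sqdiff (\<lambda>K. u i k K * sqrt (u 0 k K)) E \<le> 22 * (real CARD('d) + 1)\<^sup>2 * edge_dissipation k S E"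
proof -
  let ?d = "real CARD('d) + 1"
  have k0: "k \<noteq> 0" using k by simp
  obtain K L where KL: "E = {K, L}" "K \<in> vertices_of S" "L \<in> vertices_of S" "u 0 k L \<le> u 0 k K"
  proof -
    obtain A B where AB: "E = {A, B}" "A \<in> vertices_of S" "B \<in> vertices_of S"
      using E by (auto simp: edges_of_def)
    show thesis
    proof (cases "u 0 k B \<le> u 0 k A")
      case True then show thesis using AB that by blast
    next
      case False then show thesis using AB that[of B A] by (simp add: insert_commute)
    qed
  qed
  interpret edge_pair n "\<lambda>j. \<mu> j k K" "\<lambda>j. \<mu> j k L" "u 0 k K" "u 0 k L"
    by unfold_locales (use KL(4) in \<open>simp_all add: u_def conc_potential(1)[OF k0]\<close>)
  have ui: "u i k A = u 0 k A * exp (\<mu> i k A)" if "i \<in> {1..n}" for i A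
    unfolding u_def by (rule conc_potential(2)[OF k0]) (use that in simp)
  have nn: "0 \<le> u i k A" if "i \<le> n" for i A by (rule conc_nonneg[OF that])
  have le: "u 0 k A * u i k B \<le> ?d\<^sup>2 * (uS 0 k S * uS i k S)" if "i \<le> n" "A \<in> vertices_of S" "B \<in> vertices_of S" for i A B
  proof -
    have "u 0 k A * u i k B \<le> (?d * uS 0 k S) * (?d * uS i k S)"
      using that nn uS_bounds[OF k _ S] by (intro mult_mono) auto
    then show ?thesis by (simp add: power2_eq_square mult_ac)
  qed
  have summand: "0 \<le> uS 0 k S * uS i k S * sqdiff (\<mu> i k) E" if "i \<in> {1..n}" for i
    using mult_nonneg_nonneg[OF weight_bounds(1)[OF k _ S, of i] sqdiff_nonneg[OF E]] that by simp
  have sq: "(sqrt (u 0 k K) - sqrt (u 0 k L))\<^sup>2 \<le> ?d\<^sup>2 * edge_dissipation k S E"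
  proof (rule order_trans[OF sqrt_diff_square])
    show "(\<Sum>i=1..n. u 0 k K * (u 0 k L * exp (\<mu> i k L)) * (\<mu> i k K - \<mu> i k L)\<^sup>2) \<le> ?d\<^sup>2 * edge_dissipation k S E"
      unfolding edge_dissipation_def sum_distrib_left
    proof (rule sum_mono)
      fix i assume i: "i \<in> {1..n}"
      have "u 0 k K * u i k L * (\<mu> i k K - \<mu> i k L)\<^sup>2 \<le> ?d\<^sup>2 * (uS 0 k S * uS i k S) * (\<mu> i k K - \<mu> i k L)\<^sup>2"
        using le[of i K L] i KL by (intro mult_right_mono) auto
      then show "u 0 k K * (u 0 k L * exp (\<mu> i k L)) * (\<mu> i k K - \<mu> i k L)\<^sup>2 \<le> ?d\<^sup>2 * (uS 0 k S * uS i k S * sqdiff (\<mu> i k) E)"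
        by (simp add: ui[OF i, symmetric] KL(1) sqdiff_edge mult.assoc)
    qed
  qed
  then show "sqdiff (\<lambda>K. sqrt (u 0 k K)) E \<le> ?d\<^sup>2 * edge_dissipation k S E" by (simp add: KL(1) sqdiff_edge)
  show "sqdiff (u 0 k) E \<le> 4 * ?d\<^sup>2 * edge_dissipation k S E"
    using diff_square sq by (simp add: KL(1) sqdiff_edge)
  assume i: "i \<in> {1..n}"
  \<comment> \<open>Two products, each bounded by (d + 1)^2 times the weight. With the factor 2 of
    \<open>product_diff\<close> this contributes 4, and 18 + 4 = 22.\<close>
  have "u 0 k L * (u i k K + u i k L) * (\<mu> i k K - \<mu> i k L)\<^sup>2 \<le> 2 * ?d\<^sup>2 * (uS 0 k S * uS i k S) * (\<mu> i k K - \<mu> i k L)\<^sup>2"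
    using le[of i L K] le[of i L L] i KL by (intro mult_right_mono) (auto simp: distrib_left)
  also have "\<dots> \<le> 2 * ?d\<^sup>2 * edge_dissipation k S E"
  proof -
    have "uS 0 k S * uS i k S * sqdiff (\<mu> i k) E \<le> edge_dissipation k S E"
      unfolding edge_dissipation_def using i summand by (intro member_le_sum[of i "{1..n}" "\<lambda>i. uS 0 k S * uS i k S * sqdiff (\<mu> i k) E"]) auto
    from mult_left_mono[OF this, of "2 * ?d\<^sup>2"] show ?thesis by (simp add: KL(1) sqdiff_edge mult.assoc)
  qed
  finally show "sqdiff (\<lambda>K. u i k K * sqrt (u 0 k K)) E \<le> 22 * ?d\<^sup>2 * edge_dissipation k S E"
    using product_diff[OF i] sq unfolding ui[OF i, symmetric] by (simp add: KL(1) sqdiff_edge)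
qed

definition total_edge_dissipation :: real where
  "total_edge_dissipation = (\<Sum>k=1..N. time_step t k * (\<Sum>S\<in>\<T>. vol S / (diameter S)\<^sup>2 * (\<Sum>E\<in>edges_of S. edge_dissipation k S E)))"

text \<open>Mesh regularity converts bounds on edge differences, simplex by simplex, into a bound on
  the space-time gradient; the factor \<theta>^2/4 is that of
  \<open>grad_on_regularity\<close>.\<close>

lemma grad_recon_sq_edge:
  assumes \<theta>: "mesh_regularity \<T> \<le> \<theta>"
    and le: "\<And>k S E. k \<in> {1..N} \<Longrightarrow> S \<in> \<T> \<Longrightarrow> E \<in> edges_of S \<Longrightarrow> sqdiff (v k) E \<le> c * edge_dissipation k S E"
  shows "grad_recon_sq \<Omega> T \<T> N t v \<le> c * (\<theta>\<^sup>2 / 4 * total_edge_dissipation)"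
proof -
  have "energy \<T> (interp \<T> (v k)) \<le> c * (\<theta>\<^sup>2 / 4 * (\<Sum>S\<in>\<T>. vol S / (diameter S)\<^sup>2 * (\<Sum>E\<in>edges_of S. edge_dissipation k S E)))"
    if k: "k \<in> {1..N}" for k
    unfolding energy_def sum_distrib_left[of _ _ \<T>]
  proof (rule sum_mono)
    fix S assume S: "S \<in> \<T>"
    let ?g = "norm (grad_on (interp \<T> (v k)) S)"
    have d: "0 < diameter S" by (rule inradius_pos(2)[OF S])
    have "4 * (diameter S)\<^sup>2 * ?g\<^sup>2 \<le> \<theta>\<^sup>2 * (\<Sum>E\<in>edges_of S. sqdiff (v k) E)" by (rule grad_on_regularity[OF S \<theta>])
    also have "\<dots> \<le> \<theta>\<^sup>2 * (\<Sum>E\<in>edges_of S. c * edge_dissipation k S E)"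
      using le[OF k S] by (intro mult_left_mono sum_mono) auto
    finally have "?g\<^sup>2 \<le> \<theta>\<^sup>2 * (c * (\<Sum>E\<in>edges_of S. edge_dissipation k S E)) / (4 * (diameter S)\<^sup>2)"
      using d by (simp add: field_simps sum_distrib_left)
    from mult_left_mono[OF this, of "vol S"]
    show "vol S * ?g\<^sup>2 \<le> c * (\<theta>\<^sup>2 / 4 * (vol S / (diameter S)\<^sup>2 * (\<Sum>E\<in>edges_of S. edge_dissipation k S E)))"
      by (simp add: mult_ac)
  qed
  then have "(\<Sum>k=1..N. time_step t k * energy \<T> (interp \<T> (v k)))
    \<le> (\<Sum>k=1..N. time_step t k * (c * (\<theta>\<^sup>2 / 4 * (\<Sum>S\<in>\<T>. vol S / (diameter S)\<^sup>2 * (\<Sum>E\<in>edges_of S. edge_dissipation k S E)))))"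
    using time_step_pos[OF grid] by (intro sum_mono mult_left_mono) (auto simp: less_imp_le)
  also have "\<dots> = c * (\<theta>\<^sup>2 / 4 * total_edge_dissipation)"
    unfolding total_edge_dissipation_def by (simp add: sum_distrib_left mult_ac)
  finally show ?thesis using grad_recon_sq_le[OF grid, of v] by linarith
qed

lemma gradient_bound:
  assumes \<theta>: "mesh_regularity \<T> \<le> \<theta>"
  shows "(\<Sum>i=1..n. grad_recon_sq \<Omega> T \<T> N t (\<lambda>k K. u i k K * sqrt (u 0 k K)))
      + grad_recon_sq \<Omega> T \<T> N t (\<lambda>k K. u 0 k K)
      + grad_recon_sq \<Omega> T \<T> N t (\<lambda>k K. sqrt (u 0 k K))
    \<le> (22 * real n + 5) * (real CARD('d) + 1)\<^sup>2 * (\<theta>\<^sup>2 / 4 * total_edge_dissipation)"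
proof -
  let ?d = "(real CARD('d) + 1)\<^sup>2" and ?Y = "\<theta>\<^sup>2 / 4 * total_edge_dissipation"
  have "(\<Sum>i=1..n. grad_recon_sq \<Omega> T \<T> N t (\<lambda>k K. u i k K * sqrt (u 0 k K))) \<le> (\<Sum>i=1..n. 22 * ?d * ?Y)"
    by (intro sum_mono grad_recon_sq_edge[OF \<theta>] edge_estimates(3)) auto
  moreover have "grad_recon_sq \<Omega> T \<T> N t (\<lambda>k K. u 0 k K) \<le> 4 * ?d * ?Y"
    by (intro grad_recon_sq_edge[OF \<theta>] edge_estimates(2)) auto
  moreover have "grad_recon_sq \<Omega> T \<T> N t (\<lambda>k K. sqrt (u 0 k K)) \<le> ?d * ?Y"
    by (intro grad_recon_sq_edge[OF \<theta>] edge_estimates(1)) auto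
  ultimately show ?thesis by (simp add: algebra_simps)
qed

section \<open>Comparison of edge differences with elementwise gradients\<close>

definition weighted_edge_dissipation :: real where
  "weighted_edge_dissipation = (\<Sum>k=1..N. time_step t k * (\<Sum>i=1..n. D i * (\<Sum>S\<in>\<T>.
     vol S / (diameter S)\<^sup>2 * uS 0 k S * uS i k S * (\<Sum>E\<in>edges_of S. sqdiff (\<mu> i k) E))))"

lemma weighted_edge_dissipation_le:
  assumes Cmin: "\<And>S v. S \<in> \<T> \<Longrightarrow> Cmin * (vol S / (diameter S)\<^sup>2) * (\<Sum>E\<in>edges_of S. sqdiff v E)
                        \<le> vol S * (norm (grad_on (interp \<T> v) S))\<^sup>2"
  shows "Cmin * weighted_edge_dissipation \<le> (\<Sum>k=1..N. time_step t k * dissipation k)"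
proof -
  have "Cmin * (vol S / (diameter S)\<^sup>2 * uS 0 k S * uS i k S * (\<Sum>E\<in>edges_of S. sqdiff (\<mu> i k) E))
    \<le> uS 0 k S * uS i k S * (vol S * (norm (grad_on (interp \<T> (\<mu> i k)) S))\<^sup>2)"
    if "k \<in> {1..N}" "i \<in> {1..n}" "S \<in> \<T>" for k i S
    using mult_left_mono[OF Cmin[OF that(3), of "\<mu> i k"] weight_bounds(1)[OF that(1) _ that(3), of i]] that
    by (simp add: mult_ac)
  then have "(\<Sum>k=1..N. time_step t k * (\<Sum>i=1..n. D i * (\<Sum>S\<in>\<T>.
     Cmin * (vol S / (diameter S)\<^sup>2 * uS 0 k S * uS i k S * (\<Sum>E\<in>edges_of S. sqdiff (\<mu> i k) E)))))
    \<le> (\<Sum>k=1..N. time_step t k * dissipation k)"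
    unfolding dissipation_def using D time_step_pos[OF grid]
    by (intro sum_mono mult_left_mono) (simp_all add: less_imp_le)
  then show ?thesis unfolding weighted_edge_dissipation_def by (simp add: sum_distrib_left mult_ac)
qed

lemma weighted_edge_dissipation_nonneg: "0 \<le> weighted_edge_dissipation"
  unfolding weighted_edge_dissipation_def
proof (intro sum_nonneg mult_nonneg_nonneg)
  fix k i S E assume *: "k \<in> {1..N}" "i \<in> {1..n}" "S \<in> \<T>" "E \<in> edges_of S"
  show "0 \<le> sqdiff (\<mu> i k) E" by (rule sqdiff_nonneg[OF *(4)])
qed (use time_step_pos[OF grid] D uS_bounds(1) in \<open>auto simp: less_imp_le\<close>)

text \<open>The edge estimates carry no diffusion coefficients; a common lower bound
  \<open>Dmin\<close> brings them back.\<close>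

lemma total_edge_dissipation_le:
  assumes "\<And>i. i \<in> {1..n} \<Longrightarrow> Dmin \<le> D i"
  shows "Dmin * total_edge_dissipation \<le> weighted_edge_dissipation"
proof -
  have "(\<Sum>S\<in>\<T>. vol S / (diameter S)\<^sup>2 * (\<Sum>E\<in>edges_of S. edge_dissipation k S E))
    = (\<Sum>i=1..n. \<Sum>S\<in>\<T>. vol S / (diameter S)\<^sup>2 * uS 0 k S * uS i k S * (\<Sum>E\<in>edges_of S. sqdiff (\<mu> i k) E))" for k
  proof -
    have edge_sum: "(\<Sum>E\<in>edges_of S. edge_dissipation k S E) = (\<Sum>i=1..n. uS 0 k S * uS i k S * (\<Sum>E\<in>edges_of S. sqdiff (\<mu> i k) E))" for S
      unfolding edge_dissipation_def by (subst sum.swap) (simp only: sum_distrib_left)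
    show ?thesis unfolding edge_sum by (subst sum.swap) (simp add: sum_distrib_left mult_ac)
  qed
  then have "Dmin * total_edge_dissipation = (\<Sum>k=1..N. time_step t k * (\<Sum>i=1..n. Dmin * (\<Sum>S\<in>\<T>.
     vol S / (diameter S)\<^sup>2 * uS 0 k S * uS i k S * (\<Sum>E\<in>edges_of S. sqdiff (\<mu> i k) E))))"
    unfolding total_edge_dissipation_def by (simp add: sum_distrib_left mult_ac)
  also have "\<dots> \<le> weighted_edge_dissipation"
    unfolding weighted_edge_dissipation_def
  proof (rule sum_mono, rule mult_left_mono, rule sum_mono, rule mult_right_mono)
    fix k assume k: "k \<in> {1..N}"
    show "0 \<le> time_step t k" using time_step_pos[OF grid k] by simp
    fix i assume i: "i \<in> {1..n}"
    show "Dmin \<le> D i" by (rule assms[OF i])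
    show "0 \<le> (\<Sum>S\<in>\<T>. vol S / (diameter S)\<^sup>2 * uS 0 k S * uS i k S * (\<Sum>E\<in>edges_of S. sqdiff (\<mu> i k) E))"
      using uS_bounds(1)[OF k] i sqdiff_nonneg by (intro sum_nonneg mult_nonneg_nonneg) auto
  qed
  finally show ?thesis .
qed

end

section \<open>Choice of the constants and conclusion\<close>

theorem lemma3p2:
  fixes \<Omega> :: "(real^'d::finite) set"
    and T lam \<beta> \<theta> C\<phi> CP F Cmin :: real
    and n :: nat
    and z D M :: "nat \<Rightarrow> real"
  assumes "CARD('d) \<in> {2, 3}"
    and "polytopal_domain \<Omega>"
    and "T > 0" and "lam > 0" and "\<beta> > 0"
    and "n \<ge> 1"
    and "\<forall>i\<in>{1..n}. D i > 0"
    and "\<forall>i\<in>{0..n}. M i > 0"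
    and "CP > 0"
    and "Cmin > 0"
    and "\<forall>(\<Omega>' :: (real^'d) set) \<T>. polytopal_domain \<Omega>' \<and> simplicial_mesh \<Omega>' \<T> \<and> mesh_regularity \<T> \<le> \<theta> \<longrightarrow>
           (\<forall>S\<in>\<T>. \<forall>v. Cmin * (vol S / (diameter S)\<^sup>2) * (\<Sum>E\<in>edges_of S. sqdiff v E)
                        \<le> vol S * (norm (grad_on (interp \<T> v) S))\<^sup>2)"
  shows "\<exists>C1>0. \<exists>C2>0.
    \<forall>\<Gamma>D \<Gamma>N f \<phi>D uini \<T> \<phi>DT N t ch \<mu> \<phi>.
      boundary_partition \<Omega> \<Gamma>D \<Gamma>N \<and> poincare_const \<Omega> \<Gamma>D CP \<and>
      in_L2 \<Omega> f \<and> L2_norm \<Omega> f = F \<and> \<phi>D \<in> H1 \<Omega> \<and> admissible_initial \<Omega> n M uini \<and>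
      simplicial_mesh \<Omega> \<T> \<and> mesh_regularity \<T> \<le> \<theta> \<and> P1_space_D \<T> \<Gamma>D \<subseteq> H1D \<Omega> \<Gamma>D \<and>
      \<phi>DT \<in> P1_space \<T> \<and> \<phi>DT \<in> H1 \<Omega> \<and> H1_norm \<Omega> \<phi>DT \<le> C\<phi> \<and>
      time_grid T N t \<and>
      scheme_solution n z D lam \<beta> \<Omega> \<Gamma>D f uini \<T> \<phi>DT N t ch \<mu> \<phi>
      \<longrightarrow>
      (let u = conc n \<Omega> \<T> uini \<mu>; uS = (\<lambda>j k S. simplex_value ch S (u j k)) in
        (\<Sum>k=1..N. time_step t k * (Cmin / 2) * (\<Sum>i=1..n. D i * (\<Sum>S\<in>\<T>.
            vol S / (diameter S)\<^sup>2 * uS 0 k S * uS i k S * (\<Sum>E\<in>edges_of S. sqdiff (\<mu> i k) E))))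
        \<le> (\<Sum>k=1..N. time_step t k / 2 * (\<Sum>i=1..n. \<Sum>K\<in>mesh_vertices \<T>. \<Sum>S\<in>simplices_at \<T> K.
            vol S * uS 0 k S * uS i k S * D i * (norm (grad_on (interp \<T> (\<mu> i k)) S))\<^sup>2))
        \<and>
        (\<Sum>k=1..N. time_step t k / 2 * (\<Sum>i=1..n. \<Sum>K\<in>mesh_vertices \<T>. \<Sum>S\<in>simplices_at \<T> K.
            vol S * uS 0 k S * uS i k S * D i * (norm (grad_on (interp \<T> (\<mu> i k)) S))\<^sup>2))
        \<le> (\<Sum>i=1..n. \<Sum>K\<in>mesh_vertices \<T>. vol (dual_cell \<Omega> \<T> K) * zeta (u i 0 K)) + T * C1
        \<and>
        (\<Sum>i=1..n. grad_recon_sq \<Omega> T \<T> N t (\<lambda>k K. u i k K * sqrt (u 0 k K)))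
          + grad_recon_sq \<Omega> T \<T> N t (\<lambda>k K. u 0 k K)
          + grad_recon_sq \<Omega> T \<T> N t (\<lambda>k K. sqrt (u 0 k K))
        \<le> C2)"
proof -
  define G where "G = 16 * ((\<Sum>i=1..n. \<bar>z i\<bar>)\<^sup>2 * vol \<Omega> + F\<^sup>2) * (CP\<^sup>2 + (diameter \<Omega>)\<^sup>2) / lam ^ 4 + 6 * C\<phi>\<^sup>2"
  define R where "R = (real n + 1) * vol \<Omega> + T * (\<beta>\<^sup>2 * (\<Sum>i=1..n. D i * (z i)\<^sup>2) * G / 2)"
  \<comment> \<open>\<open>R\<close> bounds half of the time-integrated dissipation, and d + 1
    accounts for the repeated simplices. The division by \<open>T\<close> undoes the factor in the
    claim, and the added 1 makes the constant positive.\<close>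
  define C1 where "C1 = (real CARD('d) + 1) * R / T + 1"
  \<comment> \<open>Positive because \<open>n \<ge> 1\<close> makes this the minimum of a nonempty
    finite set of positive numbers.\<close>
  define Dmin where "Dmin = Min (D ` {1..n})"
  \<comment> \<open>Bounds \<open>total_edge_dissipation\<close>: the first estimate, with the sum
    of \<open>zeta\<close> replaced by its upper bound, divided by
    \<open>Cmin * Dmin / 2\<close>.\<close>
  define Y where "Y = 2 * (real n * vol \<Omega> + T * C1) / (Cmin * Dmin)"
  define C2 where "C2 = (22 * real n + 5) * (real CARD('d) + 1)\<^sup>2 * (\<theta>\<^sup>2 / 4 * Y) + 1"
  have D: "D i > 0" if "i \<in> {1..n}" for i using assms(7) that by blast
  have Dmin: "Dmin > 0" "\<And>i. i \<in> {1..n} \<Longrightarrow> Dmin \<le> D i"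
    using D assms(6) by (auto simp: Dmin_def)
  have "0 \<le> G" using assms(4) unfolding G_def by (auto intro!: add_nonneg_nonneg divide_nonneg_nonneg mult_nonneg_nonneg)
  then have R: "0 \<le> R"
    unfolding R_def using assms(3) D by (auto intro!: add_nonneg_nonneg mult_nonneg_nonneg sum_nonneg simp: less_imp_le)
  have C1: "C1 > 0" "T * C1 = (real CARD('d) + 1) * R + T"
    unfolding C1_def using assms(3) R by (auto intro!: add_nonneg_pos divide_nonneg_nonneg simp: distrib_left)
  have "0 \<le> Y" unfolding Y_def using assms(3,10) C1(1) Dmin(1)
    by (auto intro!: add_nonneg_nonneg divide_nonneg_nonneg mult_nonneg_nonneg simp: less_imp_le)
  then have C2: "C2 > 0" unfolding C2_def by (intro add_nonneg_pos mult_nonneg_nonneg) auto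
  show ?thesis
  proof (rule exI[of _ C1], rule conjI[OF C1(1)], rule exI[of _ C2], rule conjI[OF C2], intro allI impI, elim conjE)
    fix \<Gamma>D \<Gamma>N f \<phi>D uini \<T> \<phi>DT N t ch \<mu> \<phi>
    assume data: "poincare_const \<Omega> \<Gamma>D CP" "in_L2 \<Omega> f" "L2_norm \<Omega> f = F" "admissible_initial \<Omega> n M uini"
      "simplicial_mesh \<Omega> \<T>" "mesh_regularity \<T> \<le> \<theta>" "P1_space_D \<T> \<Gamma>D \<subseteq> H1D \<Omega> \<Gamma>D"
      "\<phi>DT \<in> P1_space \<T>" "\<phi>DT \<in> H1 \<Omega>" "H1_norm \<Omega> \<phi>DT \<le> C\<phi>" "time_grid T N t"
      "scheme_solution n z D lam \<beta> \<Omega> \<Gamma>D f uini \<T> \<phi>DT N t ch \<mu> \<phi>"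
    interpret scheme \<Omega> \<T> T lam \<beta> C\<phi> CP n N z D M t \<Gamma>D f \<phi>DT uini ch \<mu> \<phi>
      by unfold_locales (use data assms(2,4,6,9) D in blast)+
    have PB: "potential_bound = G" by (simp add: potential_bound_def G_def data(3))
    let ?X = "\<Sum>k=1..N. time_step t k * (dissipation k / 2)"
    let ?B = "\<Sum>i=1..n. \<Sum>K\<in>mesh_vertices \<T>. vol (dual_cell \<Omega> \<T> K) * zeta (u i 0 K)"
    have X: "?X \<le> R" using total_dissipation by (simp only: PB R_def)
    have "Cmin * weighted_edge_dissipation \<le> (\<Sum>k=1..N. time_step t k * dissipation k)"
    proof (rule weighted_edge_dissipation_le)
      fix S v assume "S \<in> \<T>"
      then show "Cmin * (vol S / (diameter S)\<^sup>2) * (\<Sum>E\<in>edges_of S. sqdiff v E) \<le> vol S * (norm (grad_on (interp \<T> v) S))\<^sup>2"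
        using assms(2,11) data(5,6) by blast
    qed
    then have W: "Cmin / 2 * weighted_edge_dissipation \<le> ?X" by (simp flip: sum_divide_distrib)
    have W0: "0 \<le> weighted_edge_dissipation"
      using weighted_edge_dissipation_nonneg .
    have X0: "0 \<le> ?X" using W W0 assms(10) by (meson divide_nonneg_nonneg less_imp_le mult_nonneg_nonneg order_trans zero_le_numeral)
    \<comment> \<open>The lower estimate holds with each simplex counted once; since
      \<open>?X\<close> is nonnegative, the factor d + 1 only enlarges the middle term.\<close>
    have "1 * ?X \<le> (real CARD('d) + 1) * ?X" using X0 by (intro mult_right_mono) auto
    then have first: "Cmin / 2 * weighted_edge_dissipation \<le> (real CARD('d) + 1) * ?X" using W by linarith
    have "(real CARD('d) + 1) * ?X \<le> (real CARD('d) + 1) * R" using X by (intro mult_left_mono) auto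
    \<comment> \<open>\<open>T * C1\<close> alone exceeds the bound by \<open>T\<close>; the sum
      \<open>?B\<close> is added because it is nonnegative.\<close>
    then have second: "(real CARD('d) + 1) * ?X \<le> ?B + T * C1"
      using zeta_initial_bounds(1) assms(3) unfolding C1(2) by linarith
    have "Cmin / 2 * (Dmin * total_edge_dissipation) \<le> Cmin / 2 * weighted_edge_dissipation"
      using assms(10) by (intro mult_left_mono total_edge_dissipation_le Dmin) auto
    then have "Cmin / 2 * (Dmin * total_edge_dissipation) \<le> real n * vol \<Omega> + T * C1"
      using first second zeta_initial_bounds(2) by linarith
    then have "total_edge_dissipation \<le> Y" unfolding Y_def using assms(10) Dmin(1) by (simp add: field_simps)
    then have "\<theta>\<^sup>2 / 4 * total_edge_dissipation \<le> \<theta>\<^sup>2 / 4 * Y" by (rule mult_left_mono) simp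
    then have "(22 * real n + 5) * (real CARD('d) + 1)\<^sup>2 * (\<theta>\<^sup>2 / 4 * total_edge_dissipation)
      \<le> (22 * real n + 5) * (real CARD('d) + 1)\<^sup>2 * (\<theta>\<^sup>2 / 4 * Y)" by (rule mult_left_mono) simp
    also have "\<dots> \<le> C2" unfolding C2_def by linarith
    finally have "(22 * real n + 5) * (real CARD('d) + 1)\<^sup>2 * (\<theta>\<^sup>2 / 4 * total_edge_dissipation) \<le> C2" .
    note third = order_trans[OF gradient_bound[OF data(6)] this]
    have lhs: "(\<Sum>k=1..N. time_step t k * (Cmin / 2) * (\<Sum>i=1..n. D i * (\<Sum>S\<in>\<T>.
            vol S / (diameter S)\<^sup>2 * uS 0 k S * uS i k S * (\<Sum>E\<in>edges_of S. sqdiff (\<mu> i k) E))))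
      = Cmin / 2 * weighted_edge_dissipation"
      unfolding weighted_edge_dissipation_def sum_distrib_left[of "Cmin / 2"] by (intro sum.cong refl) (simp only: mult_ac)
    show "let u = conc n \<Omega> \<T> uini \<mu>; uS = (\<lambda>j k S. simplex_value ch S (u j k)) in
        (\<Sum>k=1..N. time_step t k * (Cmin / 2) * (\<Sum>i=1..n. D i * (\<Sum>S\<in>\<T>.
            vol S / (diameter S)\<^sup>2 * uS 0 k S * uS i k S * (\<Sum>E\<in>edges_of S. sqdiff (\<mu> i k) E))))
        \<le> (\<Sum>k=1..N. time_step t k / 2 * (\<Sum>i=1..n. \<Sum>K\<in>mesh_vertices \<T>. \<Sum>S\<in>simplices_at \<T> K.
            vol S * uS 0 k S * uS i k S * D i * (norm (grad_on (interp \<T> (\<mu> i k)) S))\<^sup>2))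
        \<and>
        (\<Sum>k=1..N. time_step t k / 2 * (\<Sum>i=1..n. \<Sum>K\<in>mesh_vertices \<T>. \<Sum>S\<in>simplices_at \<T> K.
            vol S * uS 0 k S * uS i k S * D i * (norm (grad_on (interp \<T> (\<mu> i k)) S))\<^sup>2))
        \<le> (\<Sum>i=1..n. \<Sum>K\<in>mesh_vertices \<T>. vol (dual_cell \<Omega> \<T> K) * zeta (u i 0 K)) + T * C1
        \<and>
        (\<Sum>i=1..n. grad_recon_sq \<Omega> T \<T> N t (\<lambda>k K. u i k K * sqrt (u 0 k K)))
          + grad_recon_sq \<Omega> T \<T> N t (\<lambda>k K. u 0 k K)
          + grad_recon_sq \<Omega> T \<T> N t (\<lambda>k K. sqrt (u 0 k K))
        \<le> C2"
      unfolding Let_def u_def[symmetric] uS_def[symmetric] lhs vertex_simplex_dissipation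
      by (intro conjI first second third)
  qed
qed

end
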